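(* For $\sigma\in gl(M|N)$ (a $K\times K$ matrix) define the functionals of the classical fields $$Q^{(0)}_\sigma=\int dx\,\Phi^\dagger(x)\sigma\Phi(x),\qquad Q^{(1)}_\sigma=\int dx\,\Phi^\dagger(x)\sigma\,\partial\Phi(x)-\frac g2\int dx\,dy\,\mathrm{sg}(x-y)\,\Phi^\dagger(x)\sigma\Phi(y)\cdot\Phi^\dagger(y)\Phi(x),$$ $$Q^{(2)}_\sigma=\int dx\,\Phi^\dagger(x)\sigma\,\partial^2\Phi(x)-\frac g2\int dx\,dy\,\mathrm{sg}(x-y)\big(\Phi^\dagger(x)\sigma\,\partial\Phi(y)-\partial\Phi^\dagger(x)\sigma\Phi(y)\big)\Phi^\dagger(y)\Phi(x)$$ $$\qquad\qquad+\frac{g^2}4\int dx\,dy\,dz\,\mathrm{sg}(x-y)\,\mathrm{sg}(y-z)\;\Phi^\dagger(y)\Phi(x)\cdot\Phi^\dagger(x)\sigma\Phi(z)\cdot\Phi^\dagger(z)\Phi(y).$$ Then $\{H,Q^{(n)}_\sigma\}=0$ for $n=0,1,2$, so the $Q^{(n)}_\sigma$ are symmetry generators of the classical nonlinear super-Schrödinger equation. Moreover, for homogeneous $\sigma,\omega\in gl(M|N)$, $$\{Q^{(0)}_\sigma,Q^{(n)}_\omega\}=i\,Q^{(n)}_{[\![\sigma,\omega]\!]},\qquad n=0,1,2,$$ $$\{Q^{(1)}_\sigma,Q^{(1)}_\omega\}=i\,Q^{(2)}_{[\![\sigma,\omega]\!]}-i\Big(\frac g2\Big)^2\int dx\,dy\,dt\,S(x,y,t)\Big(\Phi^\dagger(x)\sigma\Phi(y)\cdot\Phi^\dagger(y)\omega\Phi(t)-(-1)^{[\sigma][\omega]}\Phi^\dagger(x)\omega\Phi(y)\cdot\Phi^\dagger(y)\sigma\Phi(t)\Big)\Phi^\dagger(t)\Phi(x),$$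 where $S(x,y,t)=\mathrm{sg}(t-x)\mathrm{sg}(x-y)+\mathrm{sg}(x-y)\mathrm{sg}(y-t)+\mathrm{sg}(y-t)\mathrm{sg}(t-x)$.
   Context: $M,N\ge0$ integers, $K=M+N$, $g>0$; $[j]=0$ for $1\le j\le M$, $[j]=1$ for $M<j\le K$. $gl(M|N)$ is the superalgebra of $K\times K$ complex matrices, with the elementary matrix $E_{jk}$ of grade $[j]+[k]$ and supercommutator $[\![\sigma,\omega]\!]=\sigma\omega-(-1)^{[\sigma][\omega]}\omega\sigma$. $\phi_j(x),\phi_j^\dagger(x)$ ($1\le j\le K$) are supercommuting classical fields of grade $[j]$ on $\mathbb R$, smooth and rapidly decreasing. Notation: $\Phi^\dagger(x)\sigma\Phi(y)=\sum_{j,k=1}^K\phi_j^\dagger(x)\sigma^{jk}\phi_k(y)$, $\Phi^\dagger(x)\Phi(y)=\sum_j\phi_j^\dagger(x)\phi_j(y)$, and similarly with derivatives; $\partial=\partial_x$; all integrals are over $\mathbb R$; $\mathrm{sg}$ is the sign function. The graded Poisson bracket is $\{F,G\}=i\sum_{\ell=1}^K\int dx\,(-1)^{[F][\ell]}\Big((-1)^{[\ell]}\frac{\delta F}{\delta\phi_\ell(x)}\frac{\delta G}{\delta\phi_\ell^\dagger(x)}-\frac{\delta F}{\delta\phi_\ell^\dagger(x)}\frac{\delta G}{\delta\phi_\ell(x)}\Big)$, so $\{\phi_j(x),\phi_k^\dagger(y)\}=i\delta_{jk}\delta(x-y)=-(-1)^{[j][k]}\{\phi_k^\dagger(y),\phi_j(x)\}$.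 The Hamiltonian is $H=\int dx\,\big(\partial\Phi^\dagger(x)\partial\Phi(x)+g(\Phi^\dagger(x)\Phi(x))^2\big)$, and the nonlinear super-Schrödinger equation is $i\partial_t\phi_j=-\partial_x^2\phi_j+2g(\sum_k\phi_k^\dagger\phi_k)\phi_j$. *)

theory Defs
  imports "HOL-Analysis.Analysis" "Jordan_Normal_Form.Matrix"
begin

text \<open>
  The fields take values in a supercommutative Banach algebra over the complex numbers. The
  \<open>\<int>/2\<close>-grading is given by its parity automorphism (identity on the even part, minus the identity
  on the odd part). HOL-Analysis has no class of complex normed algebras, so the complex structure
  is given by the element \<open>im_unit\<close>, which is even and hence central. Separability is what Bochner
  integration in HOL-Analysis asks for. Examples are the complex numbers and the \<open>\<ell>\<^sup>1\<close> Grassmann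
  algebra on countably many generators.
\<close>

class super_banach_algebra = real_normed_algebra_1 + banach + second_countable_topology +
  fixes parity :: "'a \<Rightarrow> 'a" and im_unit :: 'a
  assumes parity_add: "parity (a + b) = parity a + parity b"
    and parity_scaleR: "parity (r *\<^sub>R a) = r *\<^sub>R parity a"
    and parity_bounded: "\<exists>B. \<forall>a. norm (parity a) \<le> norm a * B"
    and parity_parity: "parity (parity a) = a"
    and parity_mult: "parity (a * b) = parity a * parity b"
    and supercommute:
      "parity a = (-1::real) ^ p *\<^sub>R a \<Longrightarrow> parity b = (-1::real) ^ q *\<^sub>R b \<Longrightarrow>
        a * b = (-1::real) ^ (p * q) *\<^sub>R (b * a)"
    and parity_im_unit: "parity im_unit = im_unit"
    and im_unit_square: "im_unit * im_unit = -1"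

definition graded :: "nat \<Rightarrow> 'a::super_banach_algebra set" where
  "graded p = {a. parity a = (-1::real) ^ p *\<^sub>R a}"

definition gpart :: "nat \<Rightarrow> 'a::super_banach_algebra \<Rightarrow> 'a" where
  "gpart p a = (1/2) *\<^sub>R (a + (-1::real) ^ p *\<^sub>R parity a)"

definition cscale :: "complex \<Rightarrow> 'a::super_banach_algebra \<Rightarrow> 'a" (infixr \<open>*\<^sub>C\<close> 75) where
  "c *\<^sub>C a = Re c *\<^sub>R a + Im c *\<^sub>R (im_unit * a)"


text \<open>Indices run over \<open>0, \<dots>, M + N - 1\<close>, as for the matrices of Jordan_Normal_Form, instead of
  \<open>1, \<dots>, M + N\<close>.\<close>

definition grade :: "nat \<Rightarrow> nat \<Rightarrow> nat" where
  "grade M j = (if j < M then 0 else 1)"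

definition homogeneous :: "nat \<Rightarrow> nat \<Rightarrow> nat \<Rightarrow> complex mat \<Rightarrow> bool" where
  "homogeneous M N p \<sigma> \<longleftrightarrow> \<sigma> \<in> carrier_mat (M + N) (M + N) \<and> p \<in> {0, 1} \<and>
     (\<forall>j<M+N. \<forall>k<M+N. \<sigma> $$ (j, k) \<noteq> 0 \<longrightarrow> (grade M j + grade M k) mod 2 = p)"

text \<open>Supercommutator of homogeneous matrices of grades \<open>p\<close> and \<open>q\<close>.\<close>

definition supercomm :: "nat \<Rightarrow> nat \<Rightarrow> complex mat \<Rightarrow> complex mat \<Rightarrow> complex mat" where
  "supercomm p q \<sigma> \<omega> = \<sigma> * \<omega> - (-1) ^ (p * q) \<cdot>\<^sub>m (\<omega> * \<sigma>)"


definition vderiv :: "(real \<Rightarrow> 'a::real_normed_vector) \<Rightarrow> real \<Rightarrow> 'a" where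
  "vderiv f = (\<lambda>x. vector_derivative f (at x))"

text \<open>Smooth and rapidly decreasing.\<close>

definition schwartz :: "(real \<Rightarrow> 'a::real_normed_vector) \<Rightarrow> bool" where
  "schwartz f \<longleftrightarrow>
     (\<forall>n x. (vderiv ^^ n) f differentiable (at x)) \<and>
     (\<forall>n k. bounded (range (\<lambda>x. x ^ k *\<^sub>R (vderiv ^^ n) f x)))"

type_synonym 'a fields = "nat \<Rightarrow> real \<Rightarrow> 'a"

text \<open>A functional depends on the fields \<open>\<phi>\<close> and, independently, on the fields \<open>\<phi>\<^sup>\<dagger>\<close>, which are
  called \<open>\<psi>\<close> throughout.\<close>

type_synonym 'a field_functional = "'a fields \<Rightarrow> 'a fields \<Rightarrow> 'a"

definition admissible :: "nat \<Rightarrow> nat \<Rightarrow> 'a::super_banach_algebra fields \<Rightarrow> bool" where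
  "admissible M N \<phi> \<longleftrightarrow>
     (\<forall>j<M+N. schwartz (\<phi> j) \<and> (\<forall>x. \<phi> j x \<in> graded (grade M j)))"

definition dx :: "'a::real_normed_vector fields \<Rightarrow> 'a fields" where
  "dx \<phi> = (\<lambda>j. vderiv (\<phi> j))"

definition pair :: "nat \<Rightarrow> 'a::super_banach_algebra fields \<Rightarrow> real \<Rightarrow> 'a fields \<Rightarrow> real \<Rightarrow> 'a" where
  "pair K \<psi> x \<phi> y = (\<Sum>j<K. \<psi> j x * \<phi> j y)"

definition mpair ::
  "nat \<Rightarrow> 'a::super_banach_algebra fields \<Rightarrow> real \<Rightarrow> complex mat \<Rightarrow> 'a fields \<Rightarrow> real \<Rightarrow> 'a" where
  "mpair K \<psi> x \<sigma> \<phi> y = (\<Sum>j<K. \<Sum>k<K. (\<sigma> $$ (j, k)) *\<^sub>C (\<psi> j x * \<phi> k y))"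


text \<open>
  Left functional derivative: the first variation in the \<open>\<ell>\<close>-th field is \<open>\<integral> h(x) D(x) dx\<close> with the
  variation \<open>h\<close> (of the same grade as the field) on the left. This is the convention for which the
  bracket below gives \<open>{\<phi>\<^sub>j(x), \<phi>\<^sub>k\<^sup>\<dagger>(y)} = i \<delta>\<^sub>j\<^sub>k \<delta>(x - y) = -(-1)\<^bsup>[j][k]\<^esup> {\<phi>\<^sub>k\<^sup>\<dagger>(y), \<phi>\<^sub>j(x)}\<close> together
  with the graded Leibniz rule. The fields other than the \<open>\<ell>\<close>-th one are kept fixed.
  The derivative is unique for fields of grade 0, and for fields of grade 1 if no nonzero element of
  the algebra is annihilated by the whole odd part, as in the Grassmann algebra on infinitely many
  (but not on finitely many) generators; the theorem assumes this when there are fields of grade 1.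
\<close>

definition has_functional_derivative ::
  "nat \<Rightarrow> ('a::super_banach_algebra fields \<Rightarrow> 'a) \<Rightarrow> 'a fields \<Rightarrow> nat \<Rightarrow> (real \<Rightarrow> 'a) \<Rightarrow> bool" where
  "has_functional_derivative M F \<phi> l D \<longleftrightarrow>
     continuous_on UNIV D \<and>
     (\<forall>h. schwartz h \<and> (\<forall>x. h x \<in> graded (grade M l)) \<longrightarrow>
        integrable lborel (\<lambda>x. h x * D x) \<and>
        ((\<lambda>\<epsilon>::real. F (\<phi>(l := \<lambda>x. \<phi> l x + \<epsilon> *\<^sub>R h x)))
           has_vector_derivative (\<integral>x. h x * D x \<partial>lborel)) (at 0))"

definition functional_derivative ::
  "nat \<Rightarrow> ('a::super_banach_algebra fields \<Rightarrow> 'a) \<Rightarrow> 'a fields \<Rightarrow> nat \<Rightarrow> real \<Rightarrow> 'a" where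
  "functional_derivative M F \<phi> l = (THE D. has_functional_derivative M F \<phi> l D)"

definition delta_phi ::
  "nat \<Rightarrow> 'a::super_banach_algebra field_functional \<Rightarrow> nat \<Rightarrow> 'a fields \<Rightarrow> 'a fields \<Rightarrow> real \<Rightarrow> 'a" where
  "delta_phi M F l \<phi> \<psi> = functional_derivative M (\<lambda>\<phi>'. F \<phi>' \<psi>) \<phi> l"

definition delta_psi ::
  "nat \<Rightarrow> 'a::super_banach_algebra field_functional \<Rightarrow> nat \<Rightarrow> 'a fields \<Rightarrow> 'a fields \<Rightarrow> real \<Rightarrow> 'a" where
  "delta_psi M F l \<phi> \<psi> = functional_derivative M (\<lambda>\<psi>'. F \<phi> \<psi>') \<psi> l"

definition functionally_differentiable ::
  "nat \<Rightarrow> nat \<Rightarrow> 'a::super_banach_algebra field_functional \<Rightarrow> bool" where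
  "functionally_differentiable M N F \<longleftrightarrow>
     (\<forall>\<phi> \<psi>. admissible M N \<phi> \<and> admissible M N \<psi> \<longrightarrow>
        (\<forall>l<M+N. (\<exists>D. has_functional_derivative M (\<lambda>\<phi>'. F \<phi>' \<psi>) \<phi> l D) \<and>
                 (\<exists>D. has_functional_derivative M (\<lambda>\<psi>'. F \<phi> \<psi>') \<psi> l D)))"

text \<open>
  Bracket of two functionals, the first being homogeneous of grade \<open>p\<close>, and its extension to an
  arbitrary first argument by additivity (for \<open>F\<close> homogeneous of grade \<open>p\<close>, the component of
  grade \<open>1 - p\<close> is zero). The sign in the bracket does not involve the grade of \<open>G\<close>.
\<close>

definition poisson_homogeneous ::
  "nat \<Rightarrow> nat \<Rightarrow> nat \<Rightarrow> 'a::super_banach_algebra field_functional \<Rightarrow> 'a field_functional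
     \<Rightarrow> 'a field_functional" where
  "poisson_homogeneous M N p F G \<phi> \<psi> = im_unit *
     (\<Sum>l<M+N. \<integral>x. (-1::real) ^ (p * grade M l) *\<^sub>R
         ((-1::real) ^ grade M l *\<^sub>R (delta_phi M F l \<phi> \<psi> x * delta_psi M G l \<phi> \<psi> x)
          - delta_psi M F l \<phi> \<psi> x * delta_phi M G l \<phi> \<psi> x) \<partial>lborel)"

definition poisson ::
  "nat \<Rightarrow> nat \<Rightarrow> 'a::super_banach_algebra field_functional \<Rightarrow> 'a field_functional
     \<Rightarrow> 'a field_functional" where
  "poisson M N F G \<phi> \<psi> =
     (\<Sum>p\<in>{0, 1}. poisson_homogeneous M N p (\<lambda>\<phi>' \<psi>'. gpart p (F \<phi>' \<psi>')) G \<phi> \<psi>)"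


definition hamiltonian :: "nat \<Rightarrow> real \<Rightarrow> 'a::super_banach_algebra field_functional" where
  "hamiltonian K g \<phi> \<psi> =
     (\<integral>x. pair K (dx \<psi>) x (dx \<phi>) x + g *\<^sub>R (pair K \<psi> x \<phi> x)\<^sup>2 \<partial>lborel)"

definition charge0 :: "nat \<Rightarrow> complex mat \<Rightarrow> 'a::super_banach_algebra field_functional" where
  "charge0 K \<sigma> \<phi> \<psi> = (\<integral>x. mpair K \<psi> x \<sigma> \<phi> x \<partial>lborel)"

definition charge1 :: "nat \<Rightarrow> real \<Rightarrow> complex mat \<Rightarrow> 'a::super_banach_algebra field_functional" where
  "charge1 K g \<sigma> \<phi> \<psi> =
     (\<integral>x. mpair K \<psi> x \<sigma> (dx \<phi>) x \<partial>lborel)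
     - (g / 2) *\<^sub>R (\<integral>(x, y). sgn (x - y) *\<^sub>R (mpair K \<psi> x \<sigma> \<phi> y * pair K \<psi> y \<phi> x)
         \<partial>(lborel :: (real \<times> real) measure))"

definition charge2 :: "nat \<Rightarrow> real \<Rightarrow> complex mat \<Rightarrow> 'a::super_banach_algebra field_functional" where
  "charge2 K g \<sigma> \<phi> \<psi> =
     (\<integral>x. mpair K \<psi> x \<sigma> (dx (dx \<phi>)) x \<partial>lborel)
     - (g / 2) *\<^sub>R (\<integral>(x, y). sgn (x - y) *\<^sub>R
           ((mpair K \<psi> x \<sigma> (dx \<phi>) y - mpair K (dx \<psi>) x \<sigma> \<phi> y) * pair K \<psi> y \<phi> x)
         \<partial>(lborel :: (real \<times> real) measure))
     + (g\<^sup>2 / 4) *\<^sub>R (\<integral>(x, y, z). (sgn (x - y) * sgn (y - z)) *\<^sub>R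
           (pair K \<psi> y \<phi> x * mpair K \<psi> x \<sigma> \<phi> z * pair K \<psi> z \<phi> y)
         \<partial>(lborel :: (real \<times> real \<times> real) measure))"

definition sign_kernel :: "real \<Rightarrow> real \<Rightarrow> real \<Rightarrow> real" where
  "sign_kernel x y t =
     sgn (t - x) * sgn (x - y) + sgn (x - y) * sgn (y - t) + sgn (y - t) * sgn (t - x)"


text \<open>
  Solutions of the nonlinear super-Schroedinger equation, together with the conjugate equation for
  \<open>\<phi>\<^sup>\<dagger>\<close>, on a time interval: the curves \<open>t \<mapsto> \<phi>\<^sub>j(t, \<cdot>)\<close> and \<open>t \<mapsto> \<phi>\<^sub>j\<^sup>\<dagger>(t, \<cdot>)\<close> are differentiable with
  respect to the topology of the space of rapidly decreasing functions.
\<close>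

definition has_schwartz_derivative ::
  "(real \<Rightarrow> real \<Rightarrow> 'a::real_normed_vector) \<Rightarrow> (real \<Rightarrow> 'a) \<Rightarrow> real \<Rightarrow> bool" where
  "has_schwartz_derivative f v t \<longleftrightarrow>
     (\<forall>n k. uniform_limit UNIV
        (\<lambda>s x. x ^ k *\<^sub>R (vderiv ^^ n) (\<lambda>y. (1 / (s - t)) *\<^sub>R (f s y - f t y) - v y) x)
        (\<lambda>x. 0) (at t))"

definition nlss_solution ::
  "nat \<Rightarrow> nat \<Rightarrow> real \<Rightarrow> real set \<Rightarrow> (real \<Rightarrow> 'a::super_banach_algebra fields)
     \<Rightarrow> (real \<Rightarrow> 'a fields) \<Rightarrow> bool" where
  "nlss_solution M N g T \<phi> \<psi> \<longleftrightarrow>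
     (\<forall>t\<in>T. admissible M N (\<phi> t) \<and> admissible M N (\<psi> t) \<and>
        (\<forall>j<M+N. \<exists>v w.
           has_schwartz_derivative (\<lambda>s. \<phi> s j) v t \<and>
           has_schwartz_derivative (\<lambda>s. \<psi> s j) w t \<and>
           (\<forall>x. im_unit * v x = - vderiv (vderiv (\<phi> t j)) x
                  + (2 * g) *\<^sub>R (pair (M + N) (\<psi> t) x (\<phi> t) x * \<phi> t j x)) \<and>
           (\<forall>x. - im_unit * w x = - vderiv (vderiv (\<psi> t j)) x
                  + (2 * g) *\<^sub>R (pair (M + N) (\<psi> t) x (\<phi> t) x * \<psi> t j x))))"

definition conserved_by_nlss ::
  "nat \<Rightarrow> nat \<Rightarrow> real \<Rightarrow> 'a::super_banach_algebra field_functional \<Rightarrow> bool" where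
  "conserved_by_nlss M N g Q \<longleftrightarrow>
     (\<forall>a b \<phi> \<psi>. nlss_solution M N g {a<..<b} \<phi> \<psi> \<longrightarrow>
        (\<forall>s\<in>{a<..<b}. \<forall>t\<in>{a<..<b}. Q (\<phi> s) (\<psi> s) = Q (\<phi> t) (\<psi> t)))"

end

theory Submission
  imports Defs "HOL-Library.Function_Algebras" "HOL-Probability.Sinc_Integral"
begin

text \<open>
  Write the fields \<open>\<psi>\<close> as a row \<open>r\<close> and the fields \<open>\<phi>\<close> as a column \<open>p\<close>, and let
  \<open>P(x) = 1/2 \<integral> sg(x - y) p(y) r(y) dy\<close>, so that \<open>P' = p r\<close>. The charges become
  \<open>\<integral> r \<sigma> p\<close>, \<open>\<integral> r \<sigma> p' - g \<integral> r \<sigma> P p\<close> and a similar expression for \<open>n = 2\<close>. As \<open>sg\<close> is odd and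
  products of a row with a column supercommute, a double integral over \<open>sg(x - y) a(x) b(y) c(y) d(x)\<close>
  changes only by a sign under the cyclic shift \<open>a, b, c, d \<mapsto> c, d, a, b\<close>. By this rule the first
  variation of each charge is \<open>\<integral> (Y \<delta>p + \<delta>r X)\<close> for an explicit row \<open>Y\<close> and column \<open>X\<close>, and for
  functionals of grades \<open>d\<close>, \<open>e\<close> the bracket is
  \<open>{F, G} = i \<integral> (Y\<^sub>F X\<^sub>G - (-1)\<^bsup>de\<^esup> Y\<^sub>G X\<^sub>F)\<close>. For the Hamiltonian the integrand is a total
  derivative, which gives \<open>{H, Q} = 0\<close> and the conservation of \<open>Q\<close>; the other brackets follow
  monomial by monomial from the cyclic rule and integration by parts, the three summands of \<open>S\<close>
  coming from three ways to arrange two factors \<open>P\<close>.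
\<close>

text \<open>Three obstacles shape the proof. The bracket is built from functional derivatives chosen
  by \<open>THE\<close>, so every one that occurs must exist and be unique; uniqueness is tested
  with Gaussians times constants of the right grade, and for odd fields this is where the
  faithfulness of the odd part enters. Differentiation under the integral sign is reduced to the
  product and chain rules in the Banach space of bounded continuous functions, after multiplication
  by 1 + x^2: integration and convolution with the sign are then bounded linear maps. One formula
  for the first variation along arbitrary curves of fields serves both straight lines, which give
  the functional derivatives, and solutions, which give conservation. Finally, Y stands to the left
  of the variation of \<phi>, whereas the functional derivative has the variation on the left;
  exchanging them costs a power of the parity automorphism, and this power cancels the grade signs
  in front of the first term of the bracket. The factor 1/2 in P turns the constants g/2 and g^2/4
  of the charges into g and g^2.\<close>

instantiation "fun" :: (type, scaleR) scaleR
begin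
definition "scaleR r f = (\<lambda>x. r *\<^sub>R f x)"
instance ..
end

lemma scaleR_fun_apply [simp]: "(r *\<^sub>R f) x = r *\<^sub>R f x"
  by (simp add: scaleR_fun_def)

text \<open>Matrix-valued functions are iterated functions; as elements of a real vector space their
  linear combinations of monomials can be compared by \<open>algebra_simps\<close>.\<close>

instance "fun" :: (type, real_vector) real_vector
  by standard (simp_all add: fun_eq_iff scaleR_add_right scaleR_add_left)

section \<open>Supercommutative algebras\<close>

lemma bounded_linear_parity: "bounded_linear (parity :: 'a::super_banach_algebra \<Rightarrow> 'a)"
proof -
  obtain B where "\<And>a::'a. norm (parity a) \<le> norm a * B" using parity_bounded by blast
  then show ?thesis by (intro bounded_linear_intro[of _ B]) (simp_all add: parity_add parity_scaleR)
qed

lemmas parity_zero = linear_0[OF bounded_linear.linear[OF bounded_linear_parity]]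
  and parity_diff = linear_diff[OF bounded_linear.linear[OF bounded_linear_parity]]

lemma graded_mult:
  "a \<in> graded p \<Longrightarrow> b \<in> graded q \<Longrightarrow> a * b \<in> graded (p + q)" for a b :: "'a::super_banach_algebra"
  by (simp add: graded_def parity_mult power_add)

lemma graded_zero [simp]: "0 \<in> graded p"
  and graded_add: "a \<in> graded p \<Longrightarrow> b \<in> graded p \<Longrightarrow> a + b \<in> graded p"
  and graded_diff: "a \<in> graded p \<Longrightarrow> b \<in> graded p \<Longrightarrow> a - b \<in> graded p"
  and graded_scaleR: "a \<in> graded p \<Longrightarrow> r *\<^sub>R a \<in> graded p"
  for a b :: "'a::super_banach_algebra"
  by (simp_all add: graded_def parity_zero parity_add parity_diff parity_scaleR algebra_simps)

lemma graded_sum: "(\<And>i. i \<in> I \<Longrightarrow> f i \<in> graded p) \<Longrightarrow> sum f I \<in> graded p"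
  for f :: "_ \<Rightarrow> 'a::super_banach_algebra"
  by (induction I rule: infinite_finite_induct) (auto intro: graded_add)

lemma graded_cong: "even (p + q) \<Longrightarrow> graded p = (graded q :: 'a::super_banach_algebra set)"
  by (auto simp: graded_def minus_one_power_iff)

lemma supercommute_graded:
  "a \<in> graded p \<Longrightarrow> b \<in> graded q \<Longrightarrow> a * b = (-1::real) ^ (p * q) *\<^sub>R (b * a)"
  for a b :: "'a::super_banach_algebra"
  by (rule supercommute) (simp_all add: graded_def)

lemma gpart_decomp: "a = gpart 0 a + gpart 1 (a :: 'a::super_banach_algebra)"
proof -
  have "gpart 0 a + gpart 1 a = (1/2) *\<^sub>R (a + a)"
    by (simp add: gpart_def flip: scaleR_add_right)
  then show ?thesis by simp
qed

lemma gpart_in: "gpart p a \<in> graded p" for a :: "'a::super_banach_algebra"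
  by (simp add: gpart_def graded_def parity_add parity_scaleR parity_parity minus_one_power_iff algebra_simps)

text \<open>Supercommutativity is assumed for homogeneous elements only; splitting \<open>b\<close>
  into its graded parts removes that restriction when the other factor is even.\<close>

lemma even_central: "a * b = b * a" if "a \<in> graded 0" for a b :: "'a::super_banach_algebra"
proof -
  have "a * gpart p b = gpart p b * a" for p
    using supercommute_graded[OF that gpart_in, of p b] by simp
  then show ?thesis
    by (subst (1 2) gpart_decomp[of b]) (simp add: algebra_simps)
qed

text \<open>Passing an element of grade \<open>p\<close> multiplies the odd part of \<open>b\<close>
  by (-1)^p, which is the effect of the \<open>p\<close>-th power of \<open>parity\<close>. This
  moves a variation from the right of a possibly inhomogeneous coefficient to its left.\<close>

lemma parity_twist:
  "a \<in> graded p \<Longrightarrow> b * a = a * (parity ^^ p) b" if "p \<le> 1" for a b :: "'a::super_banach_algebra"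
proof -
  assume a: "a \<in> graded p"
  have p: "p = 0 \<or> p = 1" using that by auto
  have "b * a = gpart 0 b * a + gpart 1 b * a"
    by (subst (1) gpart_decomp[of b]) (simp add: algebra_simps)
  also have "\<dots> = a * (gpart 0 b + (-1::real)^p *\<^sub>R gpart 1 b)"
    using supercommute_graded[OF gpart_in a, of 0 b] supercommute_graded[OF gpart_in a, of 1 b]
    by (simp add: algebra_simps)
  also have "gpart 0 b + (-1::real)^p *\<^sub>R gpart 1 b = (parity ^^ p) b"
  proof -
    have "gpart 0 b - gpart 1 b = (1/2) *\<^sub>R (parity b + parity b)"
      unfolding gpart_def by (simp flip: scaleR_diff_right)
    then have "gpart 0 b - gpart 1 b = parity b" by simp
    then show ?thesis using p gpart_decomp[of b] by auto
  qed
  finally show ?thesis .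
qed

lemma gpart_graded: "a \<in> graded p \<Longrightarrow> gpart q a = (if even (p + q) then a else 0)"
  for a :: "'a::super_banach_algebra"
  by (auto simp: graded_def gpart_def minus_one_power_iff)

section \<open>Decaying functions\<close>

definition bnd :: "(real \<Rightarrow> 'a::real_normed_vector) \<Rightarrow> bool" where
  "bnd f \<longleftrightarrow> continuous_on UNIV f \<and> bounded (range f)"

text \<open>The integrals need no more decay than this. The class is stable under multiplication by
  bounded continuous functions such as \<open>oI f\<close>, which in general has nonzero limits at
  both ends and is therefore not rapidly decreasing.\<close>

definition dec :: "(real \<Rightarrow> 'a::real_normed_vector) \<Rightarrow> bool" where
  "dec f \<longleftrightarrow> bnd (\<lambda>x. (1 + x\<^sup>2) *\<^sub>R f x)"

lemma bndI: "continuous_on UNIV f \<Longrightarrow> (\<And>x. norm (f x) \<le> C) \<Longrightarrow> bnd f"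
  by (auto simp: bnd_def bounded_iff)

lemma bndE:
  assumes "bnd f" obtains C where "continuous_on UNIV f" "C \<ge> 0" "\<And>x. norm (f x) \<le> C"
  using assms norm_ge_zero order_trans unfolding bnd_def bounded_iff by (metis rangeI)

lemma one_plus_sq_pos [simp]: "1 + x\<^sup>2 > (0::real)" "1 + x\<^sup>2 \<noteq> (0::real)"
  by (simp_all add: add_pos_nonneg less_imp_neq[symmetric])

lemma decE:
  assumes "dec f" obtains C where "continuous_on UNIV f" "C \<ge> 0" "\<And>x. norm (f x) \<le> C / (1 + x\<^sup>2)"
proof -
  obtain C where C: "continuous_on UNIV (\<lambda>x. (1 + x\<^sup>2) *\<^sub>R f x)" "C \<ge> 0"
    "\<And>x. norm ((1 + x\<^sup>2) *\<^sub>R f x) \<le> C" using assms unfolding dec_def by (rule bndE) (rule that)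
  have "continuous_on UNIV (\<lambda>x. (1 / (1 + x\<^sup>2)) *\<^sub>R (1 + x\<^sup>2) *\<^sub>R f x)"
    by (intro continuous_intros C) simp_all
  then have "continuous_on UNIV f" by simp
  moreover have "norm (f x) \<le> C / (1 + x\<^sup>2)" for x
    using C(3)[of x] by (simp only: norm_scaleR) (simp add: field_simps abs_of_pos)
  ultimately show ?thesis using that C by blast
qed

lemma dec_bnd: "dec f \<Longrightarrow> bnd f"
proof (elim decE)
  fix C assume "continuous_on UNIV f" "C \<ge> 0" and C: "\<And>x. norm (f x) \<le> C / (1 + x\<^sup>2)"
  moreover have "norm (f x) \<le> C" for x
    by (rule order_trans[OF C]) (use \<open>C \<ge> 0\<close> in \<open>simp add: divide_le_eq algebra_simps\<close>)
  ultimately show "bnd f" by (intro bndI)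
qed

lemma bnd_const [simp]: "bnd (\<lambda>x. c)"
  by (auto simp: bnd_def)

lemma bnd_add: "bnd f \<Longrightarrow> bnd g \<Longrightarrow> bnd (\<lambda>x. f x + g x)"
  by (auto simp: bnd_def intro!: continuous_intros bounded_plus_comp)

lemma bnd_scaleR: "bnd f \<Longrightarrow> bnd (\<lambda>x. r *\<^sub>R f x)"
  by (auto simp: bnd_def intro!: continuous_intros bounded_scaleR_comp)

lemma bnd_mult: "bnd f \<Longrightarrow> bnd g \<Longrightarrow> bnd (\<lambda>x. f x * g x)"
  for f g :: "real \<Rightarrow> 'a::real_normed_algebra"
proof (elim bndE)
  fix C D assume *: "continuous_on UNIV f" "continuous_on UNIV g"
    "C \<ge> 0" "D \<ge> 0" "\<And>x. norm (f x) \<le> C" "\<And>x. norm (g x) \<le> D"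
  have "norm (f x * g x) \<le> C * D" for x
    by (rule order_trans[OF norm_mult_ineq]) (simp add: * mult_mono)
  with * show ?thesis by (intro bndI continuous_intros) auto
qed

lemma dec_zero [simp]: "dec (\<lambda>x. 0)"
  by (simp add: dec_def)

lemma dec_add: "dec f \<Longrightarrow> dec g \<Longrightarrow> dec (\<lambda>x. f x + g x)"
  by (simp add: dec_def scaleR_add_right bnd_add)

lemma dec_scaleR: "dec f \<Longrightarrow> dec (\<lambda>x. r *\<^sub>R f x)"
  using bnd_scaleR[of "\<lambda>x. (1 + x\<^sup>2) *\<^sub>R f x" r] by (simp add: dec_def mult.commute)

lemma dec_mult_bnd: "dec f \<Longrightarrow> bnd g \<Longrightarrow> dec (\<lambda>x. f x * g x)"
  for f g :: "real \<Rightarrow> 'a::real_normed_algebra"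
  unfolding dec_def using bnd_mult by fastforce

lemma bnd_mult_dec: "bnd f \<Longrightarrow> dec g \<Longrightarrow> dec (\<lambda>x. f x * g x)"
  for f g :: "real \<Rightarrow> 'a::real_normed_algebra"
  unfolding dec_def using bnd_mult by fastforce

lemma dec_sum: "(\<And>i. i \<in> I \<Longrightarrow> dec (f i)) \<Longrightarrow> dec (\<lambda>x. \<Sum>i\<in>I. f i x)"
  by (induction I rule: infinite_finite_induct) (auto intro: dec_add)

lemma bnd_sum: "(\<And>i. i \<in> I \<Longrightarrow> bnd (f i)) \<Longrightarrow> bnd (\<lambda>x. \<Sum>i\<in>I. f i x)"
  by (induction I rule: infinite_finite_induct) (auto intro: bnd_add)

lemma integrable_weight: "integrable lborel (\<lambda>x::real. 1 / (1 + x\<^sup>2))"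
  using integrable_inverse_1_plus_square
  by (simp add: set_integrable_def inverse_eq_divide einterval_def)

lemma bnd_measurable: "bnd f \<Longrightarrow> f \<in> borel_measurable borel"
  by (auto simp: bnd_def borel_measurable_continuous_onI)

lemma dec_measurable: "dec f \<Longrightarrow> f \<in> borel_measurable borel"
  by (simp add: bnd_measurable dec_bnd)

lemma dec_integrable: "dec f \<Longrightarrow> integrable lborel f"
  for f :: "real \<Rightarrow> 'a::{banach, second_countable_topology}"
proof -
  assume f: "dec f"
  then obtain C where C: "continuous_on UNIV f" "C \<ge> 0" "\<And>x. norm (f x) \<le> C / (1 + x\<^sup>2)"
    by (rule decE) (rule that)
  have "integrable lborel (\<lambda>x::real. C * (1 / (1 + x\<^sup>2)))"
    by (intro integrable_mult_right integrable_weight)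
  then show ?thesis
    by (rule Bochner_Integration.integrable_bound)
       (use C dec_measurable[OF f] in \<open>auto simp: abs_of_pos\<close>)
qed

section \<open>Convolution with the sign function\<close>

text \<open>The sign jumps by 2, so the factor 1/2 makes this an antiderivative of \<open>f\<close>
  without a further constant.\<close>

definition oI :: "(real \<Rightarrow> 'a::{banach, second_countable_topology}) \<Rightarrow> real \<Rightarrow> 'a" where
  "oI f x = (\<integral>y. (sgn (x - y) / 2) *\<^sub>R f y \<partial>lborel)"

lemma abs_sgn_le: "\<bar>sgn (x::real)\<bar> \<le> 1"
  by (simp add: sgn_real_def)

lemma kernel_integrable:
  fixes f :: "'b \<Rightarrow> 'a::{banach, second_countable_topology}"
  assumes "integrable M f" "k \<in> borel_measurable M" "\<And>y. \<bar>k y\<bar> \<le> (1::real)"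
  shows "integrable M (\<lambda>y. k y *\<^sub>R f y)"
proof (rule Bochner_Integration.integrable_bound[OF assms(1)])
  show "(\<lambda>y. k y *\<^sub>R f y) \<in> borel_measurable M"
    using assms(1,2) by auto
  show "AE y in M. norm (k y *\<^sub>R f y) \<le> norm (f y)"
    using assms(3) by (auto intro!: AE_I2 mult_left_le_one_le)
qed

lemma oI_integrable: "dec f \<Longrightarrow> integrable lborel (\<lambda>y. (sgn (x - y) / 2) *\<^sub>R f y)"
  for f :: "real \<Rightarrow> 'a::{banach, second_countable_topology}"
  by (intro kernel_integrable dec_integrable) (auto simp: sgn_real_def)

lemma integral_mult_both:
  fixes f :: "'b \<Rightarrow> 'a::{banach, second_countable_topology, real_normed_algebra}"
  assumes "integrable M f" shows "(\<integral>x. c * f x * d \<partial>M) = c * (\<integral>x. f x \<partial>M) * d"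
  using assms by simp

lemma integral_kernel_mult:
  fixes f :: "'b \<Rightarrow> 'a::{banach, second_countable_topology, real_normed_algebra}"
  assumes "integrable M (\<lambda>x. k x *\<^sub>R f x)"
  shows "(\<integral>x. k x *\<^sub>R (c * f x) \<partial>M) = c * (\<integral>x. k x *\<^sub>R f x \<partial>M)"
    and "(\<integral>x. k x *\<^sub>R (f x * c) \<partial>M) = (\<integral>x. k x *\<^sub>R f x \<partial>M) * c"
  using Bochner_Integration.integral_mult_right[OF assms, of c]
    Bochner_Integration.integral_mult_left[OF assms, of c] by simp_all

lemma norm_oI_le:
  fixes f :: "real \<Rightarrow> 'a::{banach, second_countable_topology}"
  assumes "dec f" shows "norm (oI f x) \<le> (\<integral>y. norm (f y) \<partial>lborel)"
  unfolding oI_def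
proof (rule order_trans[OF integral_norm_bound integral_mono])
  show "integrable lborel (\<lambda>y. norm ((sgn (x - y) / 2) *\<^sub>R f y))" "integrable lborel (\<lambda>y. norm (f y))"
    by (intro integrable_norm oI_integrable dec_integrable assms)+
qed (auto simp: sgn_real_def)

lemma oI_add: "dec f \<Longrightarrow> dec g \<Longrightarrow> oI (\<lambda>y. f y + g y) x = oI f x + oI g x"
  for f g :: "real \<Rightarrow> 'a::{banach, second_countable_topology}"
  using oI_integrable[of f x] oI_integrable[of g x]
  by (simp add: oI_def scaleR_add_right)

lemma oI_scaleR: "oI (\<lambda>y. r *\<^sub>R f y) x = r *\<^sub>R oI f x"
  for f :: "real \<Rightarrow> 'a::{banach, second_countable_topology}"
proof -
  have "(\<lambda>y. (sgn (x - y) / 2) *\<^sub>R (r *\<^sub>R f y)) = (\<lambda>y. r *\<^sub>R ((sgn (x - y) / 2) *\<^sub>R f y))"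
    by (simp add: mult.commute)
  then show ?thesis unfolding oI_def by (simp only: integral_scaleR_right)
qed

lemma oI_deriv:
  fixes f :: "real \<Rightarrow> 'a::{banach, second_countable_topology}"
  assumes f: "dec f" shows "(oI f has_vector_derivative f x) (at x)"
  unfolding has_vector_derivative_def has_derivative_at_alt
proof (intro conjI allI impI)
  show "bounded_linear (\<lambda>h. h *\<^sub>R f x)" by (rule bounded_linear_scaleR_left)
next
  fix e :: real assume "e > 0"
  have "isCont f x" using dec_bnd[OF f] by (simp add: bnd_def continuous_on_eq_continuous_at)
  then obtain d where d: "d > 0" "\<And>y. \<bar>y - x\<bar> < d \<Longrightarrow> norm (f y - f x) < e"
    using \<open>e > 0\<close> unfolding continuous_at_eps_delta dist_norm by (auto simp: dist_norm)
  have "norm (oI f u - oI f x - (u - x) *\<^sub>R f x) \<le> e * norm (u - x)" if u: "norm (u - x) < d" for u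
  proof -
    define k where "k y = (sgn (u - y) - sgn (x - y)) / 2" for y
    define j where "j y = (if x \<le> u then indicator {x..u} y else - indicator {u..x} y :: real)" for y
    \<comment> \<open>Up to its endpoints, the difference of the two sign kernels is the signed
      indicator of the interval between \<open>x\<close> and \<open>u\<close>; the increment of
      \<open>oI f\<close> is thus the integral of \<open>f\<close> over that interval.\<close>
    have "AE y in lborel. y \<noteq> x \<and> y \<noteq> u" by (simp add: AE_lborel_singleton)
    then have kj: "AE y in lborel. k y = j y"
      by (rule AE_mp) (auto intro!: AE_I2 simp: k_def j_def indicator_def sgn_real_def)
    have kM [measurable]: "k \<in> borel_measurable borel" unfolding k_def by measurable
    have jM [measurable]: "j \<in> borel_measurable borel" unfolding j_def by measurable
    have jint: "integrable lborel j" unfolding j_def by (cases "x \<le> u") auto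
    have jval: "(\<integral>y. j y \<partial>lborel) = u - x" unfolding j_def by (cases "x \<le> u") auto
    have jabs: "integrable lborel (\<lambda>y. \<bar>j y\<bar>)" using jint by auto
    have "(\<lambda>y. \<bar>j y\<bar>) = (if x \<le> u then indicator {x..u} else indicator {u..x})"
      by (auto simp: j_def indicator_def)
    then have jabsval: "(\<integral>y. \<bar>j y\<bar> \<partial>lborel) = \<bar>u - x\<bar>" by (cases "x \<le> u") auto
    have kint: "integrable lborel k"
      by (rule integrable_cong_AE_imp[OF jint]) (use kj in \<open>auto elim: eventually_mono\<close>)
    have kval: "(\<integral>y. k y \<partial>lborel) = u - x"
      using integral_cong_AE[of k lborel j] kj jval by simp
    have kf: "integrable lborel (\<lambda>y. k y *\<^sub>R f y)"
      by (intro kernel_integrable dec_integrable f) (auto simp: k_def sgn_real_def)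
    have "oI f u - oI f x = (\<integral>y. k y *\<^sub>R f y \<partial>lborel)"
      unfolding oI_def k_def
      by (subst Bochner_Integration.integral_diff[symmetric])
         (auto intro: oI_integrable f simp: diff_divide_distrib scaleR_diff_left)
    moreover have "(u - x) *\<^sub>R f x = (\<integral>y. k y *\<^sub>R f x \<partial>lborel)"
      using kint kval by simp
    ultimately have "oI f u - oI f x - (u - x) *\<^sub>R f x = (\<integral>y. k y *\<^sub>R (f y - f x) \<partial>lborel)"
      using kf kint by (simp add: scaleR_diff_right)
    moreover have "norm (\<integral>y. k y *\<^sub>R (f y - f x) \<partial>lborel) \<le> (\<integral>y. \<bar>j y\<bar> * e \<partial>lborel)"
    proof (rule order_trans[OF integral_norm_bound integral_mono_AE])
      have "integrable lborel (\<lambda>y. k y *\<^sub>R (f y - f x))" using kf kint by (simp add: scaleR_diff_right)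
      then show "integrable lborel (\<lambda>y. norm (k y *\<^sub>R (f y - f x)))" by (rule integrable_norm)
      show "integrable lborel (\<lambda>y. \<bar>j y\<bar> * e)" using jabs by simp
      have *: "norm (j y *\<^sub>R (f y - f x)) \<le> \<bar>j y\<bar> * e" for y
      proof (cases "j y = 0")
        case False
        then have "\<bar>y - x\<bar> < d" using u by (auto simp: j_def indicator_def split: if_splits)
        from d(2)[OF this] show ?thesis by (simp add: mult_left_mono)
      qed simp
      show "AE y in lborel. norm (k y *\<^sub>R (f y - f x)) \<le> \<bar>j y\<bar> * e"
        using kj by (rule AE_mp) (auto intro!: AE_I2 simp del: norm_scaleR intro: *)
    qed
    moreover have "(\<integral>y. \<bar>j y\<bar> * e \<partial>lborel) = e * norm (u - x)"
      using jabsval by (simp add: mult.commute)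
    ultimately show ?thesis by (simp only:)
  qed
  then show "\<exists>d>0. \<forall>y. norm (y - x) < d \<longrightarrow> norm (oI f y - oI f x - (y - x) *\<^sub>R f x) \<le> e * norm (y - x)"
    using d(1) by blast
qed

lemma has_vector_derivative_continuous_on_UNIV:
  "(\<And>x. (f has_vector_derivative f' x) (at x)) \<Longrightarrow> continuous_on UNIV f"
  by (meson continuous_at_imp_continuous_on has_vector_derivative_continuous)

lemma oI_bnd: "dec f \<Longrightarrow> bnd (oI f)"
  for f :: "real \<Rightarrow> 'a::{banach, second_countable_topology}"
  by (rule bndI[OF has_vector_derivative_continuous_on_UNIV[OF oI_deriv] norm_oI_le])

lemma oI_tendsto:
  fixes f :: "real \<Rightarrow> 'a::{banach, second_countable_topology}"
  assumes f: "dec f" and s: "\<bar>s\<bar> = 1"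
  shows "(\<lambda>n. oI f (s * real n)) \<longlonglongrightarrow> (\<integral>y. (s / 2) *\<^sub>R f y \<partial>lborel)"
  unfolding oI_def
proof (rule integral_dominated_convergence)
  note [measurable] = dec_measurable[OF f]
  show "(\<lambda>y. (s / 2) *\<^sub>R f y) \<in> borel_measurable lborel"
    "\<And>n. (\<lambda>y. (sgn (s * real n - y) / 2) *\<^sub>R f y) \<in> borel_measurable lborel" by measurable
  show "integrable lborel (\<lambda>y. norm (f y))" using dec_integrable[OF f] by simp
  show "AE y in lborel. (\<lambda>n. (sgn (s * real n - y) / 2) *\<^sub>R f y) \<longlonglongrightarrow> (s / 2) *\<^sub>R f y"
  proof (intro AE_I2 tendsto_eventually)
    fix y
    obtain N where N: "\<bar>y\<bar> < real N" using reals_Archimedean2 by blast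
    show "\<forall>\<^sub>F n in sequentially. (sgn (s * real n - y) / 2) *\<^sub>R f y = (s / 2) *\<^sub>R f y"
      using eventually_ge_at_top[of N]
    proof eventually_elim
      case (elim n)
      have "s = 1 \<or> s = -1" using s by linarith
      then have "sgn (s * real n - y) = s" using N elim by (auto simp: sgn_real_def)
      then show ?case by simp
    qed
  qed
  show "AE y in lborel. norm ((sgn (s * real n - y) / 2) *\<^sub>R f y) \<le> norm (f y)" for n
    by (auto simp: sgn_real_def)
qed

text \<open>The antiderivative differs by a constant from \<^term>\<open>oI f\<close>, whose limits at the two
  ends are opposite.\<close>

lemma integral_derivative_zero:
  fixes f :: "real \<Rightarrow> 'a::{banach, second_countable_topology}"
  assumes F: "dec F" and f: "dec f" and D: "\<And>x. (F has_vector_derivative f x) (at x)"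
  shows "(\<integral>x. f x \<partial>lborel) = 0"
proof -
  have "((\<lambda>x. oI f x - F x) has_vector_derivative 0) (at x within UNIV)" for x
    using has_vector_derivative_diff[OF oI_deriv[OF f] D] by simp
  then obtain c where c: "oI f x - F x = c" for x
    using has_vector_derivative_zero_constant[of UNIV "\<lambda>x. oI f x - F x"] by auto
  have lim: "(\<integral>y. (s / 2) *\<^sub>R f y \<partial>lborel) = c" if s: "\<bar>s\<bar> = 1" for s
  proof -
    obtain C where C: "continuous_on UNIV F" "C \<ge> 0" "\<And>x. norm (F x) \<le> C / (1 + x\<^sup>2)"
      using F by (rule decE) (rule that)
    have "(\<lambda>n. F (s * real n)) \<longlonglongrightarrow> 0"
    proof (rule Lim_null_comparison)
      have "s\<^sup>2 = 1" using s by (simp add: power2_eq_1_iff abs_eq_iff')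
      then show "\<forall>\<^sub>F n in sequentially. norm (F (s * real n)) \<le> C / (1 + (real n)\<^sup>2)"
        using C(3)[of "s * real n" for n] by (simp add: power_mult_distrib)
      show "(\<lambda>n. C / (1 + (real n)\<^sup>2)) \<longlonglongrightarrow> 0" by real_asymp
    qed
    from tendsto_diff[OF oI_tendsto[OF f s] this]
    have "(\<lambda>n. c) \<longlonglongrightarrow> (\<integral>y. (s / 2) *\<^sub>R f y \<partial>lborel)" by (simp add: c)
    then show ?thesis using LIMSEQ_unique tendsto_const by blast
  qed
  have "(\<integral>y. f y \<partial>lborel) = (1/2) *\<^sub>R (\<integral>y. f y \<partial>lborel) + (1/2) *\<^sub>R (\<integral>y. f y \<partial>lborel)"
    by (simp flip: scaleR_add_left)
  also have "(1/2) *\<^sub>R (\<integral>y. f y \<partial>lborel) + (1/2) *\<^sub>R (\<integral>y. f y \<partial>lborel) = c + - c"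
    using lim[of 1] lim[of "-1"] by simp
  finally show ?thesis by simp
qed

section \<open>Iterated integrals\<close>

abbreviation wt :: "real \<Rightarrow> real" where "wt x \<equiv> 1 / (1 + x\<^sup>2)"

lemma wt_nonneg: "wt x \<ge> 0" and wt_le_1: "wt x \<le> 1"
  by (simp_all add: divide_le_eq)

text \<open>Applied once or twice, this supplies the majorants for integrals over two and three
  variables.\<close>

lemma integrable_weight2:
  assumes "integrable (lborel :: 'b::euclidean_space measure) (v :: 'b \<Rightarrow> real)"
  shows "integrable (lborel :: (real \<times> 'b) measure) (\<lambda>(x, y). wt x * v y)"
proof -
  have [measurable]: "v \<in> borel_measurable borel" using assms by auto
  have "integrable (lborel \<Otimes>\<^sub>M lborel) (\<lambda>z :: real \<times> 'b. wt (fst z) * v (snd z))"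
  proof (rule lborel_pair.Fubini_integrable)
    have "(\<lambda>x. LINT y|lborel. norm (wt x * v y)) = (\<lambda>x. (LINT y|lborel. norm (v y)) * wt x)"
      by (simp add: abs_mult abs_of_pos)
    then show "integrable lborel (\<lambda>x. LINT y|lborel. norm (wt (fst (x, y)) * v (snd (x, y))))"
      using integrable_weight by (simp only: fst_conv snd_conv integrable_mult_right)
  qed (use assms in auto)
  then show ?thesis by (simp only: lborel_prod case_prod_unfold)
qed

text \<open>Two bounds, because in products such as \<open>a x * p y * f x\<close> the point
  \<open>x\<close> occurs twice: one factor supplies the weight, the other is merely estimated by a
  constant.\<close>

lemma dec_boundE:
  assumes "dec f" obtains C where "C \<ge> 0" "\<And>x. norm (f x) \<le> C * wt x" "\<And>x. norm (f x) \<le> C"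
proof (rule decE[OF assms])
  fix C assume *: "0 \<le> C" "\<And>x. norm (f x) \<le> C / (1 + x\<^sup>2)"
  then have 1: "norm (f x) \<le> C * wt x" for x by simp
  moreover have "norm (f x) \<le> C" for x
    by (rule order_trans[OF 1]) (use * wt_le_1 in \<open>simp add: mult_left_le del: times_divide_eq_right\<close>)
  ultimately show thesis using that * by blast
qed

lemma integrable_bound_weight:
  fixes F :: "'b::euclidean_space \<Rightarrow> 'a::{banach, second_countable_topology}"
  assumes "integrable lborel (v :: 'b \<Rightarrow> real)" "F \<in> borel_measurable borel"
    and "\<And>z. norm (F z) \<le> C * v z"
  shows "integrable lborel F"
  by (rule Bochner_Integration.integrable_bound[of _ "\<lambda>z. C * v z"])
     (use assms in \<open>auto intro!: order_trans[OF assms(3)]\<close>)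

lemma norm_mult3_le:
  fixes a b c :: "'a::real_normed_algebra"
  assumes "norm a \<le> A" "norm b \<le> B" "norm c \<le> C"
  shows "norm (a * b * c) \<le> A * B * C"
proof -
  have "0 \<le> A" "0 \<le> B" "0 \<le> C" using assms norm_ge_zero order_trans by blast+
  then show ?thesis
    using assms by (meson norm_mult_ineq mult_mono mult_nonneg_nonneg norm_ge_zero order_trans)
qed

lemma double_integrable:
  fixes a p f :: "real \<Rightarrow> 'a::{banach, second_countable_topology, real_normed_algebra}"
  assumes d: "dec a" "dec p" "dec f"
    and \<kappa>: "\<kappa> \<in> borel_measurable borel" "\<And>z. \<bar>\<kappa> z\<bar> \<le> 1"
  shows "integrable lborel (\<lambda>z::real \<times> real. \<kappa> z *\<^sub>R (a (fst z) * p (snd z) * f (fst z)))"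
proof (rule kernel_integrable)
  note [measurable] = d[THEN dec_measurable]
  obtain A where A: "A \<ge> 0" "\<And>x. norm (a x) \<le> A * wt x" "\<And>x. norm (a x) \<le> A" using d(1) by (rule dec_boundE) (rule that)
  obtain P where P: "P \<ge> 0" "\<And>x. norm (p x) \<le> P * wt x" "\<And>x. norm (p x) \<le> P" using d(2) by (rule dec_boundE) (rule that)
  obtain F where F: "F \<ge> 0" "\<And>x. norm (f x) \<le> F * wt x" "\<And>x. norm (f x) \<le> F" using d(3) by (rule dec_boundE) (rule that)
  show "integrable lborel (\<lambda>z. a (fst z) * p (snd z) * f (fst z))"
  proof (rule integrable_bound_weight[OF integrable_weight2[OF integrable_weight]])
    show "(\<lambda>z. a (fst z) * p (snd z) * f (fst z)) \<in> borel_measurable borel"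
      unfolding borel_prod[symmetric] by measurable
    show "norm (a (fst z) * p (snd z) * f (fst z)) \<le> A * P * F * (case z of (x, y) \<Rightarrow> wt x * wt y)" for z
      using norm_mult3_le[OF A(2)[of "fst z"] P(2)[of "snd z"] F(3)[of "fst z"]]
      by (simp add: case_prod_beta mult_ac)
  qed
qed (use \<kappa> in auto)

lemma double_integral:
  fixes a p f :: "real \<Rightarrow> 'a::{banach, second_countable_topology, real_normed_algebra}"
  assumes d: "dec a" "dec p" "dec f"
  shows "(\<integral>z. sgn (fst z - snd z) *\<^sub>R (a (fst z) * p (snd z) * f (fst z)) \<partial>(lborel :: (real \<times> real) measure))
    = 2 *\<^sub>R (\<integral>x. a x * oI p x * f x \<partial>lborel)"
proof -
  have "integrable (lborel :: (real \<times> real) measure) (\<lambda>z. sgn (fst z - snd z) *\<^sub>R (a (fst z) * p (snd z) * f (fst z)))"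
    by (rule double_integrable[OF d]) (auto simp: borel_prod[symmetric] abs_sgn_le)
  then have "(\<integral>z. sgn (fst z - snd z) *\<^sub>R (a (fst z) * p (snd z) * f (fst z)) \<partial>(lborel :: (real \<times> real) measure))
    = (\<integral>x. \<integral>y. sgn (x - y) *\<^sub>R (a x * p y * f x) \<partial>lborel \<partial>lborel)"
    using lborel_pair.integral_fst'[of "\<lambda>z. sgn (fst z - snd z) *\<^sub>R (a (fst z) * p (snd z) * f (fst z))"]
    by (simp add: lborel_prod)
  also have "\<dots> = (\<integral>x. 2 *\<^sub>R (a x * oI p x * f x) \<partial>lborel)"
  proof (rule Bochner_Integration.integral_cong[OF refl])
    fix x
    have i: "integrable lborel (\<lambda>y. (sgn (x - y) / 2) *\<^sub>R p y)" by (rule oI_integrable[OF d(2)])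
    have "(\<integral>y. sgn (x - y) *\<^sub>R (a x * p y * f x) \<partial>lborel)
      = (\<integral>y. 2 *\<^sub>R (a x * ((sgn (x - y) / 2) *\<^sub>R p y) * f x) \<partial>lborel)"
      by simp
    also have "\<dots> = 2 *\<^sub>R (a x * oI p x * f x)"
      unfolding oI_def using i
      by (simp only: integral_scaleR_right integral_mult_both)
    finally show "(\<integral>y. sgn (x - y) *\<^sub>R (a x * p y * f x) \<partial>lborel) = 2 *\<^sub>R (a x * oI p x * f x)" .
  qed
  finally show ?thesis by simp
qed

lemma triple_integrable:
  fixes a f :: "real \<Rightarrow> 'a::{banach, second_countable_topology, real_normed_algebra}"
  assumes d: "dec a" "dec f" and W [measurable]: "W \<in> borel_measurable borel"
    and W_le: "\<And>y z. norm (W (y, z)) \<le> C * (wt y * wt z)"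
    and \<kappa>: "\<kappa> \<in> borel_measurable borel" "\<And>z. \<bar>\<kappa> z\<bar> \<le> 1"
  shows "integrable lborel (\<lambda>z::real \<times> real \<times> real. \<kappa> z *\<^sub>R (a (fst z) * W (snd z) * f (fst z)))"
proof (rule kernel_integrable)
  note [measurable] = d[THEN dec_measurable]
  obtain A where A: "A \<ge> 0" "\<And>x. norm (a x) \<le> A * wt x" "\<And>x. norm (a x) \<le> A" using d(1) by (rule dec_boundE) (rule that)
  obtain F where F: "F \<ge> 0" "\<And>x. norm (f x) \<le> F * wt x" "\<And>x. norm (f x) \<le> F" using d(2) by (rule dec_boundE) (rule that)
  show "integrable lborel (\<lambda>z. a (fst z) * W (snd z) * f (fst z))"
  proof (rule integrable_bound_weight[OF integrable_weight2[OF integrable_weight2[OF integrable_weight]]])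
    show "(\<lambda>z. a (fst z) * W (snd z) * f (fst z)) \<in> borel_measurable borel"
      unfolding borel_prod[symmetric, where 'a = real and 'b = "real \<times> real"] by measurable
    show "norm (a (fst z) * W (snd z) * f (fst z))
        \<le> A * C * F * (case z of (x, y) \<Rightarrow> wt x * (case y of (x, y) \<Rightarrow> wt x * wt y))" for z
      using norm_mult3_le[OF A(2)[of "fst z"] W_le[of "fst (snd z)" "snd (snd z)"] F(3)[of "fst z"]]
      by (simp add: case_prod_beta mult_ac)
  qed
qed (use \<kappa> in auto)

lemma product_integrable:
  fixes W :: "real \<times> real \<Rightarrow> 'a::{banach, second_countable_topology}"
  assumes W: "W \<in> borel_measurable borel" "\<And>y z. norm (W (y, z)) \<le> C * (wt y * wt z)"
    and \<kappa>: "\<kappa> \<in> borel_measurable borel" "\<And>z. \<bar>\<kappa> z\<bar> \<le> 1"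
  shows "integrable lborel (\<lambda>w. \<kappa> w *\<^sub>R W w)"
  by (intro kernel_integrable integrable_bound_weight[OF integrable_weight2[OF integrable_weight], of _ C])
     (use assms in \<open>auto simp: case_prod_beta\<close>)

text \<open>The two inner variables stay together as one pair \<open>w\<close>, so Fubini is applied
  once here, and the inner integral can be evaluated separately for each arrangement of the
  signs.\<close>

lemma triple_integral:
  fixes a f :: "real \<Rightarrow> 'a::{banach, second_countable_topology, real_normed_algebra}"
  assumes d: "dec a" "dec f" and W: "W \<in> borel_measurable borel" "\<And>y z. norm (W (y, z)) \<le> C * (wt y * wt z)"
    and \<kappa>: "\<kappa> \<in> borel_measurable borel" "\<And>z. \<bar>\<kappa> z\<bar> \<le> 1"
  shows "(\<integral>z. \<kappa> z *\<^sub>R (a (fst z) * W (snd z) * f (fst z)) \<partial>(lborel :: (real \<times> real \<times> real) measure))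
    = (\<integral>x. a x * (\<integral>w. \<kappa> (x, w) *\<^sub>R W w \<partial>lborel) * f x \<partial>lborel)"
proof -
  note [measurable] = \<kappa>(1)
  have "(\<integral>z. \<kappa> z *\<^sub>R (a (fst z) * W (snd z) * f (fst z)) \<partial>(lborel :: (real \<times> real \<times> real) measure))
    = (\<integral>x. \<integral>w. \<kappa> (x, w) *\<^sub>R (a x * W w * f x) \<partial>lborel \<partial>lborel)"
    using lborel_pair.integral_fst'[of "\<lambda>z. \<kappa> z *\<^sub>R (a (fst z) * W (snd z) * f (fst z))"]
      triple_integrable[OF assms] by (simp add: lborel_prod)
  also have "\<dots> = (\<integral>x. a x * (\<integral>w. \<kappa> (x, w) *\<^sub>R W w \<partial>lborel) * f x \<partial>lborel)"
  proof (rule Bochner_Integration.integral_cong[OF refl])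
    fix x
    have i: "integrable lborel (\<lambda>w. \<kappa> (x, w) *\<^sub>R W w)"
      by (rule product_integrable[OF W]) (use \<kappa> in auto)
    have "(\<lambda>w. \<kappa> (x, w) *\<^sub>R (a x * W w * f x)) = (\<lambda>w. a x * (\<kappa> (x, w) *\<^sub>R W w) * f x)"
      by simp
    then show "(\<integral>w. \<kappa> (x, w) *\<^sub>R (a x * W w * f x) \<partial>lborel) = a x * (\<integral>w. \<kappa> (x, w) *\<^sub>R W w \<partial>lborel) * f x"
      using i by (simp only: integral_mult_both)
  qed
  finally show ?thesis .
qed

lemma product_bound:
  fixes p q :: "real \<Rightarrow> 'a::{banach, second_countable_topology, real_normed_algebra}"
  assumes "dec p" "dec q"
  obtains C where "\<And>y z. norm (p y * q z) \<le> C * (wt y * wt z)"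
proof -
  obtain P where P: "P \<ge> 0" "\<And>x. norm (p x) \<le> P * wt x" "\<And>x. norm (p x) \<le> P" using assms(1) by (rule dec_boundE) (rule that)
  obtain Q where Q: "Q \<ge> 0" "\<And>x. norm (q x) \<le> Q * wt x" "\<And>x. norm (q x) \<le> Q" using assms(2) by (rule dec_boundE) (rule that)
  show thesis
  proof (rule that)
    fix y z
    have "norm (p y * q z) \<le> (P * wt y) * (Q * wt z)"
      by (rule order_trans[OF norm_mult_ineq mult_mono[OF P(2) Q(2)]]) (use P(1) in auto)
    also have "\<dots> = P * Q * (wt y * wt z)" by simp
    finally show "norm (p y * q z) \<le> P * Q * (wt y * wt z)" .
  qed
qed

lemma fst_snd_measurable:
  fixes p q :: "real \<Rightarrow> 'a::{banach, second_countable_topology, real_normed_algebra}"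
  assumes "dec p" "dec q"
  shows "(\<lambda>w. p (fst w) * q (snd w)) \<in> borel_measurable borel" (is ?T1)
    "(\<lambda>w. p (snd w) * q (fst w)) \<in> borel_measurable borel" (is ?T2)
proof -
  note [measurable] = assms[THEN dec_measurable]
  show ?T1 ?T2
    unfolding borel_prod[symmetric] by measurable
qed

lemma abs_mult_sgn_le: "\<bar>sgn (x::real) * sgn (y::real)\<bar> \<le> 1"
  by (simp add: sgn_real_def)

lemma integral_sgn:
  fixes p :: "real \<Rightarrow> 'a::{banach, second_countable_topology}"
  shows "(\<integral>y. sgn (x - y) *\<^sub>R p y \<partial>lborel) = 2 *\<^sub>R oI p x" (is ?T1)
    and "(\<integral>y. sgn (y - x) *\<^sub>R p y \<partial>lborel) = - (2 *\<^sub>R oI p x)" (is ?T2)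
proof -
  have "2 *\<^sub>R oI p x = (\<integral>y. 2 *\<^sub>R ((sgn (x - y) / 2) *\<^sub>R p y) \<partial>lborel)"
    unfolding oI_def by (simp only: integral_scaleR_right)
  then show 1: ?T1 by simp
  have "(\<lambda>y. sgn (y - x) *\<^sub>R p y) = (\<lambda>y. - (sgn (x - y) *\<^sub>R p y))"
    by (auto simp: sgn_real_def)
  then show ?T2 by (simp add: 1)
qed

lemma integrable_sgn:
  fixes p :: "real \<Rightarrow> 'a::{banach, second_countable_topology}"
  assumes "dec p"
  shows "integrable lborel (\<lambda>y. sgn (x - y) *\<^sub>R p y)" "integrable lborel (\<lambda>y. sgn (y - x) *\<^sub>R p y)"
  by (intro kernel_integrable dec_integrable assms; auto simp: abs_sgn_le)+

text \<open>The two signs form a chain through three points. If the fixed point \<open>x\<close> is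
  an end of the chain, the result is a nested \<open>oI\<close>; if \<open>x\<close> is the middle,
  the integral factors. Each sign contributes a factor 2, and each sign that is reversed relative to
  \<open>oI\<close> a minus.\<close>

lemma inner_integral:
  fixes p q :: "real \<Rightarrow> 'a::{banach, second_countable_topology, real_normed_algebra}"
  assumes d: "dec p" "dec q"
  shows inner_integral_nested:
      "(\<integral>w. (sgn (x - fst w) * sgn (fst w - snd w)) *\<^sub>R (p (fst w) * q (snd w)) \<partial>lborel)
        = 4 *\<^sub>R oI (\<lambda>y. p y * oI q y) x" (is ?T1)
    and inner_integral_nested_swap:
      "(\<integral>w. (sgn (x - fst w) * sgn (fst w - snd w)) *\<^sub>R (p (snd w) * q (fst w)) \<partial>lborel)
        = 4 *\<^sub>R oI (\<lambda>y. oI p y * q y) x" (is ?T2)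
    and inner_integral_nested_left:
      "(\<integral>w. (sgn (fst w - snd w) * sgn (snd w - x)) *\<^sub>R (p (fst w) * q (snd w)) \<partial>lborel)
        = 4 *\<^sub>R oI (\<lambda>y. oI p y * q y) x" (is ?T3)
    and inner_integral_prod:
      "(\<integral>w. (sgn (snd w - x) * sgn (x - fst w)) *\<^sub>R (p (fst w) * q (snd w)) \<partial>lborel)
        = - (4 *\<^sub>R (oI p x * oI q x))" (is ?T4)
proof -
  obtain C where C: "\<And>y z. norm (p y * q z) \<le> C * (wt y * wt z)"
    using d by (rule product_bound) (rule that)
  have C': "norm (p z * q y) \<le> C * (wt y * wt z)" for y z
    using C[of z y] by (simp add: mult.commute)
  note meas = borel_prod[symmetric, where 'a = real and 'b = real]
  have i1: "integrable (lborel \<Otimes>\<^sub>M lborel) (\<lambda>w. (sgn (x - fst w) * sgn (fst w - snd w)) *\<^sub>R (p (fst w) * q (snd w)))"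
    unfolding lborel_prod
    by (rule product_integrable[where C = C, OF fst_snd_measurable(1)[OF d]]) (use C in \<open>auto simp: abs_mult_sgn_le meas\<close>)
  have "(\<integral>w. (sgn (x - fst w) * sgn (fst w - snd w)) *\<^sub>R (p (fst w) * q (snd w)) \<partial>lborel)
    = (\<integral>y. sgn (x - y) *\<^sub>R (p y * (\<integral>z. sgn (y - z) *\<^sub>R q z \<partial>lborel)) \<partial>lborel)"
    using lborel_pair.integral_fst'[OF i1] integrable_sgn[OF d(2)]
    by (simp add: lborel_prod integral_kernel_mult flip: scaleR_scaleR)
  also have "\<dots> = (\<integral>y. sgn (x - y) *\<^sub>R (2 *\<^sub>R (p y * oI q y)) \<partial>lborel)" by (simp add: integral_sgn)
  finally show ?T1
    by (simp only: integral_sgn oI_scaleR) simp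
  have i2: "integrable (lborel \<Otimes>\<^sub>M lborel) (\<lambda>w. (sgn (x - fst w) * sgn (fst w - snd w)) *\<^sub>R (p (snd w) * q (fst w)))"
    unfolding lborel_prod
    by (rule product_integrable[where C = C, OF fst_snd_measurable(2)[OF d]]) (use C' in \<open>auto simp: abs_mult_sgn_le meas\<close>)
  have "(\<integral>w. (sgn (x - fst w) * sgn (fst w - snd w)) *\<^sub>R (p (snd w) * q (fst w)) \<partial>lborel)
    = (\<integral>y. sgn (x - y) *\<^sub>R ((\<integral>z. sgn (y - z) *\<^sub>R p z \<partial>lborel) * q y) \<partial>lborel)"
    using lborel_pair.integral_fst'[OF i2] integrable_sgn[OF d(1)]
    by (simp add: lborel_prod integral_kernel_mult flip: scaleR_scaleR)
  also have "\<dots> = (\<integral>y. sgn (x - y) *\<^sub>R (2 *\<^sub>R (oI p y * q y)) \<partial>lborel)" by (simp add: integral_sgn)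
  finally show ?T2
    by (simp only: integral_sgn oI_scaleR) simp
  \<comment> \<open>Here \<open>z\<close> joins the two signs, so \<open>y\<close> is integrated
    first; both signs are reversed and the two minus signs cancel.\<close>
  have i3: "integrable (lborel \<Otimes>\<^sub>M lborel) (\<lambda>(y, z). (sgn (y - z) * sgn (z - x)) *\<^sub>R (p y * q z))"
    using product_integrable[OF fst_snd_measurable(1)[OF d], of C "\<lambda>w. sgn (fst w - snd w) * sgn (snd w - x)"]
    unfolding lborel_prod case_prod_unfold using C by (auto simp: abs_mult_sgn_le meas)
  have "(\<integral>w. (sgn (fst w - snd w) * sgn (snd w - x)) *\<^sub>R (p (fst w) * q (snd w)) \<partial>lborel)
    = (\<integral>z. sgn (z - x) *\<^sub>R ((\<integral>y. sgn (y - z) *\<^sub>R p y \<partial>lborel) * q z) \<partial>lborel)"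
    using lborel_pair.integral_snd[OF i3] integrable_sgn[OF d(1)]
    by (simp add: lborel_prod case_prod_unfold integral_kernel_mult mult.commute[of "sgn (_ - _)" "sgn (_ - x)"] flip: scaleR_scaleR)
  also have "\<dots> = (\<integral>z. sgn (z - x) *\<^sub>R ((-2) *\<^sub>R (oI p z * q z)) \<partial>lborel)" by (simp add: integral_sgn)
  finally show ?T3
    by (simp only: integral_sgn oI_scaleR) simp
  have i4: "integrable (lborel \<Otimes>\<^sub>M lborel) (\<lambda>w. (sgn (snd w - x) * sgn (x - fst w)) *\<^sub>R (p (fst w) * q (snd w)))"
    unfolding lborel_prod
    by (rule product_integrable[where C = C, OF fst_snd_measurable(1)[OF d]]) (use C in \<open>auto simp: abs_mult_sgn_le meas\<close>)
  have "(\<integral>w. (sgn (snd w - x) * sgn (x - fst w)) *\<^sub>R (p (fst w) * q (snd w)) \<partial>lborel)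
    = (\<integral>y. (sgn (x - y) *\<^sub>R p y) * (\<integral>z. sgn (z - x) *\<^sub>R q z \<partial>lborel) \<partial>lborel)"
    using lborel_pair.integral_fst'[OF i4] integrable_sgn[OF d(2)]
    by (simp add: lborel_prod integral_kernel_mult mult.commute[of "sgn (_ - x)" "sgn (x - _)"] flip: scaleR_scaleR)
  also have "\<dots> = (2 *\<^sub>R oI p x) * (- (2 *\<^sub>R oI q x))"
    using integrable_sgn[OF d(1)] by (simp only: Bochner_Integration.integral_mult_left integral_sgn)
  finally show ?T4
    by simp
qed

section \<open>Differentiable curves of bounded and of decaying functions\<close>

text \<open>The curve is lifted to the Banach space of bounded continuous functions and
  differentiated there in the sup norm. Pointwise products and integral operators become bounded
  bilinear and linear maps, so no dominated convergence argument is needed for the dependence on the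
  parameter.\<close>

definition bcurve :: "real set \<Rightarrow> (real \<Rightarrow> real \<Rightarrow> 'a::real_normed_vector) \<Rightarrow> (real \<Rightarrow> 'a) \<Rightarrow> real \<Rightarrow> bool" where
  "bcurve T F F' t \<longleftrightarrow> t \<in> T \<and>
     (\<exists>G G'. (\<forall>s\<in>T. F s = apply_bcontfun (G s)) \<and> F' = apply_bcontfun G' \<and>
        (G has_vector_derivative G') (at t within T))"

definition dcurve :: "real set \<Rightarrow> (real \<Rightarrow> real \<Rightarrow> 'a::real_normed_vector) \<Rightarrow> (real \<Rightarrow> 'a) \<Rightarrow> real \<Rightarrow> bool" where
  "dcurve T F F' t \<longleftrightarrow> bcurve T (\<lambda>s x. (1 + x\<^sup>2) *\<^sub>R F s x) (\<lambda>x. (1 + x\<^sup>2) *\<^sub>R F' x) t"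

lemma bnd_apply_bcontfun: "bnd (apply_bcontfun f)"
  using apply_bcontfun[of f] by (simp add: bnd_def bcontfun_def)

lemma apply_Bcontfun: "bnd f \<Longrightarrow> apply_bcontfun (Bcontfun f) = f"
  by (simp add: Bcontfun_inverse bnd_def bcontfun_def)

lemma bcurveE:
  assumes "bcurve T F F' t"
  obtains G G' where "t \<in> T" "\<And>s. s \<in> T \<Longrightarrow> F s = apply_bcontfun (G s)" "F' = apply_bcontfun G'"
    "(G has_vector_derivative G') (at t within T)"
  using assms unfolding bcurve_def by blast

lemma bcurve_bnd: "bcurve T F F' t \<Longrightarrow> s \<in> T \<Longrightarrow> bnd (F s)"
  and bcurve_bnd': "bcurve T F F' t \<Longrightarrow> bnd F'"
  by (elim bcurveE, simp add: bnd_apply_bcontfun)+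

lemma bcurveI:
  assumes "t \<in> T" "\<And>s. s \<in> T \<Longrightarrow> F s = apply_bcontfun (G s)" "F' = apply_bcontfun G'"
    "(G has_vector_derivative G') (at t within T)"
  shows "bcurve T F F' t"
  using assms unfolding bcurve_def by blast

lemma bcurve_const: "t \<in> T \<Longrightarrow> bnd f \<Longrightarrow> bcurve T (\<lambda>s. f) (\<lambda>x. 0) t"
  by (rule bcurveI[where G = "\<lambda>s. Bcontfun f" and G' = 0]) (simp_all add: apply_Bcontfun fun_eq_iff zero_bcontfun.rep_eq)

lemma bcurve_add: "bcurve T F F' t \<Longrightarrow> bcurve T G G' t \<Longrightarrow> bcurve T (\<lambda>s x. F s x + G s x) (\<lambda>x. F' x + G' x) t"
proof (elim bcurveE)
  fix f f' g g'
  assume *: "t \<in> T" "\<And>s. s \<in> T \<Longrightarrow> F s = apply_bcontfun (f s)" "F' = apply_bcontfun f'"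
    "\<And>s. s \<in> T \<Longrightarrow> G s = apply_bcontfun (g s)" "G' = apply_bcontfun g'"
    "(f has_vector_derivative f') (at t within T)" "(g has_vector_derivative g') (at t within T)"
  show ?thesis
    by (rule bcurveI[OF _ _ _ has_vector_derivative_add[OF *(6,7)]])
       (simp_all add: * fun_eq_iff plus_bcontfun.rep_eq)
qed

definition bmul :: "(real \<Rightarrow>\<^sub>C 'a::real_normed_algebra) \<Rightarrow> (real \<Rightarrow>\<^sub>C 'a) \<Rightarrow> (real \<Rightarrow>\<^sub>C 'a)" where
  "bmul f g = Bcontfun (\<lambda>x. f x * g x)"

lemma apply_bmul: "apply_bcontfun (bmul f g) = (\<lambda>x. f x * g x)"
  unfolding bmul_def by (intro apply_Bcontfun bnd_mult bnd_apply_bcontfun)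

lemma bounded_bilinear_bmul: "bounded_bilinear bmul"
proof
  fix a a' b b' :: "real \<Rightarrow>\<^sub>C 'a" and r
  show "bmul (a + a') b = bmul a b + bmul a' b" "bmul a (b + b') = bmul a b + bmul a b'"
    "bmul (r *\<^sub>R a) b = r *\<^sub>R bmul a b" "bmul a (r *\<^sub>R b) = r *\<^sub>R bmul a b"
    by (auto intro!: bcontfun_eqI simp: apply_bmul plus_bcontfun.rep_eq scaleR_bcontfun.rep_eq algebra_simps)
  show "\<exists>K. \<forall>a b :: real \<Rightarrow>\<^sub>C 'a. norm (bmul a b) \<le> norm a * norm b * K"
  proof (intro exI allI)
    fix a b :: "real \<Rightarrow>\<^sub>C 'a"
    show "norm (bmul a b) \<le> norm a * norm b * 1"
      by (rule norm_bound) (simp add: apply_bmul order_trans[OF norm_mult_ineq] mult_mono norm_bounded)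
  qed
qed

lemma bcurve_mult:
  fixes F G :: "real \<Rightarrow> real \<Rightarrow> 'a::real_normed_algebra"
  assumes "bcurve T F F' t" "bcurve T G G' t"
  shows "bcurve T (\<lambda>s x. F s x * G s x) (\<lambda>x. F' x * G t x + F t x * G' x) t"
  using assms
proof (elim bcurveE)
  fix f f' g g'
  assume *: "t \<in> T" "\<And>s. s \<in> T \<Longrightarrow> F s = apply_bcontfun (f s)" "F' = apply_bcontfun f'"
    "\<And>s. s \<in> T \<Longrightarrow> G s = apply_bcontfun (g s)" "G' = apply_bcontfun g'"
    "(f has_vector_derivative f') (at t within T)" "(g has_vector_derivative g') (at t within T)"
  show ?thesis
    by (rule bcurveI[OF _ _ _ bounded_bilinear.has_vector_derivative[OF bounded_bilinear_bmul *(6,7)]])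
       (simp_all add: * fun_eq_iff plus_bcontfun.rep_eq apply_bmul add.commute)
qed

text \<open>In the applications \<open>L\<close> is defined on all functions through an integral,
  but is linear only where the integrals converge. Lifting it through \<open>apply_bcontfun\<close>
  restricts it to a space on which it is a bounded linear map.\<close>

lemma bcurve_linear:
  fixes L :: "(real \<Rightarrow> 'a::real_normed_vector) \<Rightarrow> 'b::real_normed_vector"
  assumes L: "\<And>f g. bnd f \<Longrightarrow> bnd g \<Longrightarrow> L (\<lambda>x. f x + g x) = L f + L g"
    "\<And>f r. bnd f \<Longrightarrow> L (\<lambda>x. r *\<^sub>R f x) = r *\<^sub>R L f"
    "\<And>f c. bnd f \<Longrightarrow> (\<And>x. norm (f x) \<le> c) \<Longrightarrow> norm (L f) \<le> c * C"
    and F: "bcurve T F F' t"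
  shows "((\<lambda>s. L (F s)) has_vector_derivative L F') (at t within T)"
  using F
proof (elim bcurveE)
  fix f f'
  assume *: "t \<in> T" "\<And>s. s \<in> T \<Longrightarrow> F s = apply_bcontfun (f s)" "F' = apply_bcontfun f'"
    "(f has_vector_derivative f') (at t within T)"
  have "bounded_linear (\<lambda>f. L (apply_bcontfun f))"
  proof (rule bounded_linear_intro[of _ C])
    fix x y r
    show "L (apply_bcontfun (x + y)) = L (apply_bcontfun x) + L (apply_bcontfun y)"
      using L(1)[OF bnd_apply_bcontfun bnd_apply_bcontfun, of x y] by (simp add: plus_bcontfun.rep_eq)
    show "L (apply_bcontfun (r *\<^sub>R x)) = r *\<^sub>R L (apply_bcontfun x)"
      using L(2)[OF bnd_apply_bcontfun, of r x] by (simp add: scaleR_bcontfun.rep_eq)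
    show "norm (L (apply_bcontfun x)) \<le> norm x * C"
      by (rule L(3)[OF bnd_apply_bcontfun norm_bounded])
  qed
  from bounded_linear.has_vector_derivative[OF this *(4)]
  have "((\<lambda>s. L (apply_bcontfun (f s))) has_vector_derivative L F') (at t within T)" by (simp add: *)
  then show ?thesis
    by (rule has_vector_derivative_transform[OF *(1), rotated]) (simp add: *)
qed

lemma dcurve_bcurve: "dcurve T F F' t \<Longrightarrow> bcurve T F F' t"
  for F :: "real \<Rightarrow> real \<Rightarrow> 'a::real_normed_algebra_1"
proof -
  assume F: "dcurve T F F' t"
  then have "t \<in> T" by (auto simp: dcurve_def bcurve_def)
  have "continuous_on UNIV (\<lambda>x. of_real (wt x) :: 'a)"
    by (intro continuous_intros) simp_all
  then have "bnd (\<lambda>x. of_real (wt x) :: 'a)"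
    by (rule bndI[where C = 1]) (simp add: divide_le_eq abs_of_pos)
  from bcurve_mult[OF bcurve_const[OF \<open>t \<in> T\<close> this] F[unfolded dcurve_def]]
  show ?thesis by (simp add: of_real_def)
qed

lemma dcurve_add: "dcurve T F F' t \<Longrightarrow> dcurve T G G' t \<Longrightarrow> dcurve T (\<lambda>s x. F s x + G s x) (\<lambda>x. F' x + G' x) t"
  unfolding dcurve_def scaleR_add_right by (rule bcurve_add)

lemma dcurve_zero: "t \<in> T \<Longrightarrow> dcurve T (\<lambda>s x. 0) (\<lambda>x. 0) t"
  by (simp add: dcurve_def bcurve_const)

lemma dcurve_mult_bcurve:
  fixes F G :: "real \<Rightarrow> real \<Rightarrow> 'a::real_normed_algebra"
  assumes "dcurve T F F' t" "bcurve T G G' t"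
  shows "dcurve T (\<lambda>s x. F s x * G s x) (\<lambda>x. F' x * G t x + F t x * G' x) t"
  using bcurve_mult[OF assms(1)[unfolded dcurve_def] assms(2)]
  by (simp add: dcurve_def scaleR_add_right)

lemma bcurve_mult_dcurve:
  fixes F G :: "real \<Rightarrow> real \<Rightarrow> 'a::real_normed_algebra"
  assumes "bcurve T F F' t" "dcurve T G G' t"
  shows "dcurve T (\<lambda>s x. F s x * G s x) (\<lambda>x. F' x * G t x + F t x * G' x) t"
  using bcurve_mult[OF assms(1) assms(2)[unfolded dcurve_def]]
  by (simp add: dcurve_def scaleR_add_right)

lemma dcurve_sum:
  assumes "t \<in> T" "\<And>i. i \<in> I \<Longrightarrow> dcurve T (F i) (F' i) t"
  shows "dcurve T (\<lambda>s x. \<Sum>i\<in>I. F i s x) (\<lambda>x. \<Sum>i\<in>I. F' i x) t"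
  using assms(2) by (induction I rule: infinite_finite_induct) (auto intro: dcurve_add dcurve_zero assms(1))

lemma bcurve_sum:
  assumes "t \<in> T" "\<And>i. i \<in> I \<Longrightarrow> bcurve T (F i) (F' i) t"
  shows "bcurve T (\<lambda>s x. \<Sum>i\<in>I. F i s x) (\<lambda>x. \<Sum>i\<in>I. F' i x) t"
  using assms(2) by (induction I rule: infinite_finite_induct) (auto intro: bcurve_add bcurve_const assms(1))

lemma dec_weight: "bnd f \<Longrightarrow> dec (\<lambda>x. wt x *\<^sub>R f x)"
  by (simp add: dec_def)

lemma norm_integral_weight_le:
  fixes f :: "real \<Rightarrow> 'a::{banach, second_countable_topology}"
  assumes "bnd f" "\<And>x. norm (f x) \<le> c"
  shows "(\<integral>x. norm (wt x *\<^sub>R f x) \<partial>lborel) \<le> c * (\<integral>x. wt x \<partial>lborel)"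
proof -
  have "(\<integral>x. norm (wt x *\<^sub>R f x) \<partial>lborel) \<le> (\<integral>x. c * wt x \<partial>lborel)"
  proof (rule integral_mono)
    show "integrable lborel (\<lambda>x. norm (wt x *\<^sub>R f x))"
      by (intro integrable_norm dec_integrable dec_weight assms)
    show "integrable lborel (\<lambda>x. c * wt x)" by (intro integrable_mult_right integrable_weight)
    show "norm (wt x *\<^sub>R f x) \<le> c * wt x" for x
      unfolding norm_scaleR using assms(2)[of x] wt_nonneg[of x]
      by (subst mult.commute) (intro mult_mono; simp)
  qed
  also have "\<dots> = c * (\<integral>x. wt x \<partial>lborel)" by (intro Bochner_Integration.integral_mult_right integrable_weight)
  finally show ?thesis .
qed

text \<open>In terms of the weighted curve, integration becomes integration against
  \<open>wt\<close>, and this is bounded for the sup norm because \<open>wt\<close> is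
  integrable.\<close>

lemma dcurve_integral:
  fixes F :: "real \<Rightarrow> real \<Rightarrow> 'a::{banach, second_countable_topology}"
  assumes F: "dcurve T F F' t"
  shows "((\<lambda>s. \<integral>x. F s x \<partial>lborel) has_vector_derivative (\<integral>x. F' x \<partial>lborel)) (at t within T)"
proof -
  define L where "L f = (\<integral>x. wt x *\<^sub>R f x \<partial>lborel)" for f :: "real \<Rightarrow> 'a"
  have int: "integrable lborel (\<lambda>x. wt x *\<^sub>R f x)" if "bnd f" for f :: "real \<Rightarrow> 'a"
    using dec_integrable[OF dec_weight[OF that]] .
  have "((\<lambda>s. L (\<lambda>x. (1 + x\<^sup>2) *\<^sub>R F s x)) has_vector_derivative L (\<lambda>x. (1 + x\<^sup>2) *\<^sub>R F' x)) (at t within T)"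
  proof (rule bcurve_linear[OF _ _ _ F[unfolded dcurve_def], of L])
    fix f g :: "real \<Rightarrow> 'a" and r c :: real
    assume f: "bnd f"
    show "bnd g \<Longrightarrow> L (\<lambda>x. f x + g x) = L f + L g"
      unfolding L_def scaleR_add_right using int[OF f] int[of g] by (rule Bochner_Integration.integral_add)
    have "(\<lambda>x. wt x *\<^sub>R r *\<^sub>R f x) = (\<lambda>x. r *\<^sub>R wt x *\<^sub>R f x)" by (simp add: mult.commute)
    then show "L (\<lambda>x. r *\<^sub>R f x) = r *\<^sub>R L f"
      unfolding L_def by (simp only: integral_scaleR_right)
    show "(\<And>x. norm (f x) \<le> c) \<Longrightarrow> norm (L f) \<le> c * (\<integral>x. wt x \<partial>lborel)"
      unfolding L_def by (rule order_trans[OF integral_norm_bound norm_integral_weight_le[OF f]])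
  qed
  then show ?thesis by (simp add: L_def)
qed

text \<open>The sup norm of \<open>oI\<close> is at most the integral of the norm, which the sup
  norm of the weighted function controls. The result is a curve of bounded functions only; the decay
  is lost.\<close>

lemma dcurve_oI:
  fixes F :: "real \<Rightarrow> real \<Rightarrow> 'a::{banach, second_countable_topology}"
  assumes F: "dcurve T F F' t"
  shows "bcurve T (\<lambda>s. oI (F s)) (oI F') t"
proof (rule bcurveI)
  define L where "L f = Bcontfun (oI (\<lambda>x. wt x *\<^sub>R f x))" for f :: "real \<Rightarrow> 'a"
  have ap: "apply_bcontfun (L f) = oI (\<lambda>x. wt x *\<^sub>R f x)" if "bnd f" for f
    unfolding L_def by (intro apply_Bcontfun oI_bnd dec_weight that)
  show "t \<in> T" using F by (auto simp: dcurve_def bcurve_def)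
  show "((\<lambda>s. L (\<lambda>x. (1 + x\<^sup>2) *\<^sub>R F s x)) has_vector_derivative L (\<lambda>x. (1 + x\<^sup>2) *\<^sub>R F' x)) (at t within T)"
  proof (rule bcurve_linear[OF _ _ _ F[unfolded dcurve_def], of L])
    fix f g :: "real \<Rightarrow> 'a" and r c :: real
    assume f: "bnd f"
    show "L (\<lambda>x. f x + g x) = L f + L g" if g: "bnd g"
      by (rule bcontfun_eqI) (simp add: ap f g bnd_add plus_bcontfun.rep_eq scaleR_add_right oI_add dec_weight)
    have "(\<lambda>x. wt x *\<^sub>R r *\<^sub>R f x) = (\<lambda>x. r *\<^sub>R wt x *\<^sub>R f x)" by (simp add: mult.commute)
    then show "L (\<lambda>x. r *\<^sub>R f x) = r *\<^sub>R L f"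
      by (intro bcontfun_eqI) (simp only: ap f bnd_scaleR scaleR_bcontfun.rep_eq oI_scaleR)
    show "norm (L f) \<le> c * (\<integral>x. wt x \<partial>lborel)" if c: "\<And>x. norm (f x) \<le> c"
    proof (rule norm_bound)
      fix x
      show "norm (L f x) \<le> c * (\<integral>x. wt x \<partial>lborel)"
        unfolding ap[OF f]
        by (rule order_trans[OF norm_oI_le[OF dec_weight[OF f]] norm_integral_weight_le[OF f c]])
    qed
  qed
  show "oI F' = apply_bcontfun (L (\<lambda>x. (1 + x\<^sup>2) *\<^sub>R F' x))"
    using bcurve_bnd'[OF F[unfolded dcurve_def]] by (simp add: ap)
  show "oI (F s) = apply_bcontfun (L (\<lambda>x. (1 + x\<^sup>2) *\<^sub>R F s x))" if "s \<in> T" for s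
    using bcurve_bnd[OF F[unfolded dcurve_def] that] by (simp add: ap)
qed

lemma bcurve_uniform_limitI:
  fixes F :: "real \<Rightarrow> real \<Rightarrow> 'a::real_normed_vector"
  assumes "t \<in> T" and b: "\<And>s. s \<in> T \<Longrightarrow> bnd (F s)" "bnd F'"
    and u: "uniform_limit UNIV (\<lambda>s x. (1 / (s - t)) *\<^sub>R (F s x - F t x) - F' x) (\<lambda>x. 0) (at t within T)"
  shows "bcurve T F F' t"
proof (rule bcurveI[where G = "\<lambda>s. Bcontfun (F s)" and G' = "Bcontfun F'"])
  show "((\<lambda>s. Bcontfun (F s)) has_vector_derivative Bcontfun F') (at t within T)"
    unfolding has_vector_derivative_def has_derivative_within
  proof
    show "bounded_linear (\<lambda>x. x *\<^sub>R Bcontfun F')" by (rule bounded_linear_scaleR_left)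
    show "((\<lambda>s. (1 / norm (s - t)) *\<^sub>R (Bcontfun (F s) - (Bcontfun (F t) + (s - t) *\<^sub>R Bcontfun F'))) \<longlongrightarrow> 0) (at t within T)"
    proof (rule uniform_limit_tendsto_bcontfun, rule uniform_limitI)
      fix e :: real assume "e > 0"
      from uniform_limitD[OF u this] have "\<forall>\<^sub>F s in at t within T. s \<in> T \<and> s \<noteq> t \<and>
          (\<forall>x\<in>UNIV. dist ((1 / (s - t)) *\<^sub>R (F s x - F t x) - F' x) 0 < e)"
        by (auto simp: eventually_at_filter elim: eventually_mono)
      then show "\<forall>\<^sub>F s in at t within T. \<forall>x\<in>UNIV.
          dist (((1 / norm (s - t)) *\<^sub>R (Bcontfun (F s) - (Bcontfun (F t) + (s - t) *\<^sub>R Bcontfun F'))) x)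
            ((0 :: real \<Rightarrow>\<^sub>C 'a) x) < e"
      proof eventually_elim
        case (elim s)
        show ?case
        proof
          fix x
          \<comment> \<open>The derivative in a normed space divides by the norm of
            \<open>s - t\<close>, the hypothesis by \<open>s - t\<close> itself; the ratio of the
            two has absolute value 1.\<close>
          have "(1 / norm (s - t)) *\<^sub>R (F s x - (F t x + (s - t) *\<^sub>R F' x)) =
            ((s - t) / norm (s - t)) *\<^sub>R ((1 / (s - t)) *\<^sub>R (F s x - F t x) - F' x)"
            using elim by (simp add: scaleR_diff_right scaleR_add_right)
          then have "norm ((1 / norm (s - t)) *\<^sub>R (F s x - (F t x + (s - t) *\<^sub>R F' x))) =
            norm ((1 / (s - t)) *\<^sub>R (F s x - F t x) - F' x)"
            using elim by (simp only: norm_scaleR) simp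
          then show "dist (((1 / norm (s - t)) *\<^sub>R (Bcontfun (F s) - (Bcontfun (F t) + (s - t) *\<^sub>R Bcontfun F'))) x)
            ((0 :: real \<Rightarrow>\<^sub>C 'a) x) < e"
            using elim \<open>t \<in> T\<close>
            by (simp add: scaleR_bcontfun.rep_eq minus_bcontfun.rep_eq plus_bcontfun.rep_eq
                zero_bcontfun.rep_eq apply_Bcontfun b dist_norm del: norm_scaleR)
        qed
      qed
    qed
  qed
qed (use assms in \<open>simp_all add: apply_Bcontfun\<close>)

section \<open>Matrix-valued functions\<close>

type_synonym 'a mfun = "real \<Rightarrow> nat \<Rightarrow> nat \<Rightarrow> 'a"

definition mdec :: "'a::real_normed_vector mfun \<Rightarrow> bool" where
  "mdec F \<longleftrightarrow> (\<forall>i j. dec (\<lambda>x. F x i j))"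

definition mbnd :: "'a::real_normed_vector mfun \<Rightarrow> bool" where
  "mbnd F \<longleftrightarrow> (\<forall>i j. bnd (\<lambda>x. F x i j))"

definition mderiv :: "'a::real_normed_vector mfun \<Rightarrow> 'a mfun \<Rightarrow> bool" where
  "mderiv F F' \<longleftrightarrow> (\<forall>x i j. ((\<lambda>x. F x i j) has_vector_derivative F' x i j) (at x))"

definition mdcurve :: "real set \<Rightarrow> (real \<Rightarrow> 'a::real_normed_vector mfun) \<Rightarrow> 'a mfun \<Rightarrow> real \<Rightarrow> bool" where
  "mdcurve T F F' t \<longleftrightarrow> (\<forall>i j. dcurve T (\<lambda>s x. F s x i j) (\<lambda>x. F' x i j) t)"

definition mbcurve :: "real set \<Rightarrow> (real \<Rightarrow> 'a::real_normed_vector mfun) \<Rightarrow> 'a mfun \<Rightarrow> real \<Rightarrow> bool" where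
  "mbcurve T F F' t \<longleftrightarrow> (\<forall>i j. bcurve T (\<lambda>s x. F s x i j) (\<lambda>x. F' x i j) t)"

definition moI :: "'a::{banach, second_countable_topology} mfun \<Rightarrow> 'a mfun" where
  "moI F = (\<lambda>x i j. oI (\<lambda>y. F y i j) x)"

text \<open>Index 0 is the auxiliary index outside the range of the fields: a row times a column has
  its scalar value in the entry 0, 0.\<close>

definition cint :: "'a::{banach, second_countable_topology} mfun \<Rightarrow> 'a" where
  "cint F = (\<integral>x. F x 0 0 \<partial>lborel)"

lemma mdec_mbnd: "mdec F \<Longrightarrow> mbnd F"
  by (simp add: mdec_def mbnd_def dec_bnd)

lemma mdec_linear [simp]:
  fixes F G :: "'a::real_normed_vector mfun"
  shows "mdec F \<Longrightarrow> mdec G \<Longrightarrow> mdec (F + G)" "mdec F \<Longrightarrow> mdec (r *\<^sub>R F)"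
  "mdec F \<Longrightarrow> mdec (- F)" "mdec F \<Longrightarrow> mdec G \<Longrightarrow> mdec (F - G)" "mdec (0 :: 'a mfun)"
proof -
  show 1: "mdec (F + G)" if "mdec F" "mdec G" for F G :: "'a mfun" using that by (simp add: mdec_def dec_add)
  show 2: "mdec (r *\<^sub>R F)" if "mdec F" for F :: "'a mfun" and r using that by (simp add: mdec_def dec_scaleR)
  show 3: "mdec (- F)" if "mdec F" for F :: "'a mfun" using 2[OF that, of "-1"] by simp
  show "mdec (F - G)" if "mdec F" "mdec G" for F G :: "'a mfun" using 1[OF that(1) 3[OF that(2)]] by simp
  show "mdec (0 :: 'a mfun)" by (simp add: mdec_def)
qed

lemma mbnd_linear [simp]:
  fixes F G :: "'a::real_normed_vector mfun"
  shows "mbnd F \<Longrightarrow> mbnd G \<Longrightarrow> mbnd (F + G)" "mbnd F \<Longrightarrow> mbnd (r *\<^sub>R F)"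
  "mbnd F \<Longrightarrow> mbnd (- F)" "mbnd F \<Longrightarrow> mbnd G \<Longrightarrow> mbnd (F - G)" "mbnd (0 :: 'a mfun)"
proof -
  show 1: "mbnd (F + G)" if "mbnd F" "mbnd G" for F G :: "'a mfun" using that by (simp add: mbnd_def bnd_add)
  show 2: "mbnd (r *\<^sub>R F)" if "mbnd F" for F :: "'a mfun" and r using that by (simp add: mbnd_def bnd_scaleR)
  show 3: "mbnd (- F)" if "mbnd F" for F :: "'a mfun" using 2[OF that, of "-1"] by simp
  show "mbnd (F - G)" if "mbnd F" "mbnd G" for F G :: "'a mfun" using 1[OF that(1) 3[OF that(2)]] by simp
  show "mbnd (0 :: 'a mfun)" by (simp add: mbnd_def)
qed

lemma mbnd_const: "mbnd (\<lambda>x. S)"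
  by (simp add: mbnd_def)

lemma mderiv_linear [simp]:
  "mderiv F F' \<Longrightarrow> mderiv G G' \<Longrightarrow> mderiv (F + G) (F' + G')" "mderiv F F' \<Longrightarrow> mderiv (r *\<^sub>R F) (r *\<^sub>R F')"
  "mderiv F F' \<Longrightarrow> mderiv (- F) (- F')" "mderiv F F' \<Longrightarrow> mderiv G G' \<Longrightarrow> mderiv (F - G) (F' - G')"
  by (auto simp: mderiv_def intro!: derivative_intros
      bounded_linear.has_vector_derivative[OF bounded_linear_scaleR_right])

lemma mderiv_const: "mderiv (\<lambda>x. S) 0"
  by (simp add: mderiv_def)

lemma mderiv_moI: "mdec F \<Longrightarrow> mderiv (moI F) F"
  unfolding mderiv_def
proof (intro allI)
  fix x i j assume "mdec F"
  then show "((\<lambda>y. moI F y i j) has_vector_derivative F x i j) (at x)"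
    using oI_deriv[of "\<lambda>y. F y i j" x] by (simp add: moI_def mdec_def)
qed

lemma mbnd_moI: "mdec F \<Longrightarrow> mbnd (moI F)"
  using oI_bnd by (auto simp: mbnd_def moI_def mdec_def)

lemma moI_add: "mdec F \<Longrightarrow> mdec G \<Longrightarrow> moI (F + G) = moI F + moI G"
  by (simp add: moI_def mdec_def oI_add fun_eq_iff)

lemma mdec_int: "mdec F \<Longrightarrow> integrable lborel (\<lambda>x. F x i j)"
  for F :: "'a::{banach, second_countable_topology} mfun"
  by (simp add: mdec_def dec_integrable)

lemma cint_linear [simp]:
  fixes F G :: "'a::{banach, second_countable_topology} mfun"
  shows "mdec F \<Longrightarrow> mdec G \<Longrightarrow> cint (F + G) = cint F + cint G"
    "mdec F \<Longrightarrow> mdec G \<Longrightarrow> cint (F - G) = cint F - cint G"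
    "cint (r *\<^sub>R F) = r *\<^sub>R cint F" "cint (- F) = - cint F" "cint (0 :: 'a mfun) = 0"
  using mdec_int[of F 0 0] mdec_int[of G 0 0] by (simp_all add: cint_def)

lemma cint_mderiv: "mdec F \<Longrightarrow> mdec F' \<Longrightarrow> mderiv F F' \<Longrightarrow> cint F' = 0"
  unfolding cint_def by (rule integral_derivative_zero[of "\<lambda>x. F x 0 0"]) (simp_all add: mdec_def mderiv_def)

lemma mdcurve_cint:
  fixes F :: "real \<Rightarrow> 'a::{banach, second_countable_topology} mfun"
  shows "mdcurve T F F' t \<Longrightarrow> ((\<lambda>s. cint (F s)) has_vector_derivative cint F') (at t within T)"
  unfolding cint_def mdcurve_def by (rule dcurve_integral) blast

lemma mbcurve_moI:
  fixes F :: "real \<Rightarrow> 'a::{banach, second_countable_topology} mfun"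
  shows "mdcurve T F F' t \<Longrightarrow> mbcurve T (\<lambda>s. moI (F s)) (moI F') t"
  unfolding mbcurve_def
proof (intro allI)
  fix i j assume "mdcurve T F F' t"
  then show "bcurve T (\<lambda>s x. moI (F s) x i j) (\<lambda>x. moI F' x i j) t"
    using dcurve_oI[of T "\<lambda>s x. F s x i j" "\<lambda>x. F' x i j" t] by (simp add: mdcurve_def moI_def)
qed

lemma mdcurve_mbcurve: "mdcurve T F F' t \<Longrightarrow> mbcurve T F F' t"
  for F :: "real \<Rightarrow> 'a::real_normed_algebra_1 mfun"
  by (simp add: mdcurve_def mbcurve_def dcurve_bcurve)

section \<open>Products of matrix-valued functions and their multiple integrals\<close>

locale matrix_size = fixes n :: nat
begin

definition mprod :: "(nat \<Rightarrow> nat \<Rightarrow> 'a) \<Rightarrow> (nat \<Rightarrow> nat \<Rightarrow> 'a) \<Rightarrow> nat \<Rightarrow> nat \<Rightarrow> 'a::real_algebra" (infixr "\<boxdot>" 70)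
  where "A \<boxdot> B = (\<lambda>i j. \<Sum>k<n. A i k * B k j)"

definition mmult :: "'a mfun \<Rightarrow> 'a mfun \<Rightarrow> 'a::real_algebra mfun" (infixr "\<cdot>" 70)
  where "F \<cdot> G = (\<lambda>x. F x \<boxdot> G x)"

lemma mprod_assoc: "(A \<boxdot> B) \<boxdot> C = A \<boxdot> B \<boxdot> C"
proof (intro ext)
  fix i j
  have "(\<Sum>k<n. \<Sum>l<n. A i l * B l k * C k j) = (\<Sum>l<n. \<Sum>k<n. A i l * B l k * C k j)"
    by (rule sum.swap)
  then show "((A \<boxdot> B) \<boxdot> C) i j = (A \<boxdot> B \<boxdot> C) i j"
    by (simp add: mprod_def sum_distrib_left sum_distrib_right mult.assoc)
qed

lemma mprod_add: "(A + B) \<boxdot> C = A \<boxdot> C + B \<boxdot> C" "C \<boxdot> (A + B) = C \<boxdot> A + C \<boxdot> B"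
  and mprod_diff: "(A - B) \<boxdot> C = A \<boxdot> C - B \<boxdot> C" "C \<boxdot> (A - B) = C \<boxdot> A - C \<boxdot> B"
  and mprod_minus: "(- A) \<boxdot> C = - (A \<boxdot> C)" "C \<boxdot> (- A) = - (C \<boxdot> A)"
  and mprod_scaleR: "(r *\<^sub>R A) \<boxdot> C = r *\<^sub>R (A \<boxdot> C)" "C \<boxdot> (r *\<^sub>R A) = r *\<^sub>R (C \<boxdot> A)"
  and mprod_zero: "0 \<boxdot> A = 0" "A \<boxdot> 0 = 0"
  by (simp_all add: mprod_def fun_eq_iff sum.distrib sum_subtractf sum_negf scaleR_sum_right algebra_simps)

lemma mmult_assoc: "(F \<cdot> G) \<cdot> H = F \<cdot> G \<cdot> H"
  by (simp add: mmult_def mprod_assoc)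

lemma mmult_linear:
  "(F + G) \<cdot> H = F \<cdot> H + G \<cdot> H" "H \<cdot> (F + G) = H \<cdot> F + H \<cdot> G"
  "(F - G) \<cdot> H = F \<cdot> H - G \<cdot> H" "H \<cdot> (F - G) = H \<cdot> F - H \<cdot> G"
  "(- F) \<cdot> H = - (F \<cdot> H)" "H \<cdot> (- F) = - (H \<cdot> F)"
  "(r *\<^sub>R F) \<cdot> H = r *\<^sub>R (F \<cdot> H)" "H \<cdot> (r *\<^sub>R F) = r *\<^sub>R (H \<cdot> F)"
  "0 \<cdot> H = 0" "H \<cdot> 0 = 0"
  by (simp_all add: mmult_def fun_eq_iff mprod_add mprod_diff mprod_minus mprod_scaleR mprod_zero)

lemmas mmult_simps = mmult_assoc mmult_linear

lemma mdec_mult1: "mdec F \<Longrightarrow> mbnd G \<Longrightarrow> mdec (F \<cdot> G)"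
  for F G :: "'a::real_normed_algebra mfun"
  unfolding mdec_def mbnd_def mmult_def mprod_def by (auto intro!: dec_sum dec_mult_bnd)

lemma mdec_mult2: "mbnd F \<Longrightarrow> mdec G \<Longrightarrow> mdec (F \<cdot> G)"
  for F G :: "'a::real_normed_algebra mfun"
  unfolding mdec_def mbnd_def mmult_def mprod_def by (auto intro!: dec_sum bnd_mult_dec)

lemma mbnd_mult: "mbnd F \<Longrightarrow> mbnd G \<Longrightarrow> mbnd (F \<cdot> G)"
  for F G :: "'a::real_normed_algebra mfun"
  unfolding mbnd_def mmult_def mprod_def by (auto intro!: bnd_sum bnd_mult)

lemma mderiv_mult: "mderiv F F' \<Longrightarrow> mderiv G G' \<Longrightarrow> mderiv (F \<cdot> G) (F' \<cdot> G + F \<cdot> G')"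
  for F G :: "'a::real_normed_algebra mfun"
  unfolding mderiv_def mmult_def mprod_def plus_fun_apply sum.distrib[symmetric]
  by (intro allI has_vector_derivative_sum has_vector_derivative_eq_rhs[OF has_vector_derivative_mult])
     (auto simp: add.commute)

lemma mdcurve_mult1:
  fixes F G :: "real \<Rightarrow> 'a::real_normed_algebra mfun"
  assumes "t \<in> T" "mdcurve T F F' t" "mbcurve T G G' t"
  shows "mdcurve T (\<lambda>s. F s \<cdot> G s) (F' \<cdot> G t + F t \<cdot> G') t"
  using assms unfolding mdcurve_def mbcurve_def mmult_def mprod_def plus_fun_apply sum.distrib[symmetric]
  by (auto intro!: dcurve_sum dcurve_mult_bcurve)

lemma mdcurve_mult2:
  fixes F G :: "real \<Rightarrow> 'a::real_normed_algebra mfun"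
  assumes "t \<in> T" "mbcurve T F F' t" "mdcurve T G G' t"
  shows "mdcurve T (\<lambda>s. F s \<cdot> G s) (F' \<cdot> G t + F t \<cdot> G') t"
  using assms unfolding mdcurve_def mbcurve_def mmult_def mprod_def plus_fun_apply sum.distrib[symmetric]
  by (auto intro!: dcurve_sum bcurve_mult_dcurve)

lemma mbcurve_mult:
  fixes F G :: "real \<Rightarrow> 'a::real_normed_algebra mfun"
  assumes "t \<in> T" "mbcurve T F F' t" "mbcurve T G G' t"
  shows "mbcurve T (\<lambda>s. F s \<cdot> G s) (F' \<cdot> G t + F t \<cdot> G') t"
  using assms unfolding mbcurve_def mmult_def mprod_def plus_fun_apply sum.distrib[symmetric]
  by (auto intro!: bcurve_sum bcurve_mult)

text \<open>Decay is asked of \<open>F\<close> alone, so that \<open>G\<close> may contain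
  antiderivatives \<open>moI\<close>; the boundary terms vanish because the product decays.\<close>

lemma cint_by_parts:
  fixes F G :: "'a::{banach, second_countable_topology, real_normed_algebra_1} mfun"
  assumes "mdec F" "mdec F'" "mderiv F F'" "mbnd G" "mbnd G'" "mderiv G G'"
  shows "cint (F' \<cdot> G) = - cint (F \<cdot> G')"
proof -
  have "cint (F' \<cdot> G + F \<cdot> G') = 0"
    using assms by (intro cint_mderiv[OF _ _ mderiv_mult] mdec_linear(1) mdec_mult1) (auto simp: mdec_mbnd)
  moreover have "cint (F' \<cdot> G + F \<cdot> G') = cint (F' \<cdot> G) + cint (F \<cdot> G')"
    using assms by (intro cint_linear) (auto intro: mdec_mult1)
  ultimately show ?thesis by (simp add: eq_neg_iff_add_eq_0)
qed

lemma mprod_corner3: "(A \<boxdot> B \<boxdot> C) i j = (\<Sum>k<n. \<Sum>l<n. A i k * B k l * C l j)"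
  by (simp add: mprod_def sum_distrib_left mult.assoc)

lemma mprod_corner4: "(A \<boxdot> B \<boxdot> C \<boxdot> D) i j = (\<Sum>k<n. \<Sum>l<n. \<Sum>m<n. A i k * (B k l * C l m) * D m j)"
  by (simp add: mprod_def sum_distrib_left mult.assoc)

lemma double_mintegral:
  fixes a p f :: "'a::{banach, second_countable_topology, real_normed_algebra_1} mfun"
  assumes d: "mdec a" "mdec p" "mdec f"
  shows "integrable (lborel :: (real \<times> real) measure)
      (\<lambda>z. sgn (fst z - snd z) *\<^sub>R (a (fst z) \<boxdot> p (snd z) \<boxdot> f (fst z)) 0 0)" (is ?T1)
    and "(\<integral>z. sgn (fst z - snd z) *\<^sub>R (a (fst z) \<boxdot> p (snd z) \<boxdot> f (fst z)) 0 0 \<partial>(lborel :: (real \<times> real) measure))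
      = 2 *\<^sub>R cint (a \<cdot> moI p \<cdot> f)" (is ?T2)
proof -
  have d': "dec (\<lambda>x. a x i j)" "dec (\<lambda>x. p x i j)" "dec (\<lambda>x. f x i j)" for i j
    using d by (simp_all add: mdec_def)
  have i: "integrable (lborel :: (real \<times> real) measure)
      (\<lambda>z. sgn (fst z - snd z) *\<^sub>R (a (fst z) 0 k * p (snd z) k l * f (fst z) l 0))" for k l
    by (rule double_integrable[OF d']) (auto simp: borel_prod[symmetric] abs_sgn_le)
  show ?T1
    unfolding mprod_corner3 scaleR_sum_right by (intro Bochner_Integration.integrable_sum i)
  have d2: "integrable lborel (\<lambda>x. a x 0 k * oI (\<lambda>y. p y k l) x * f x l 0)" for k l
    by (intro dec_integrable dec_mult_bnd d' oI_bnd dec_bnd[OF d'(3)])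
  show ?T2
    unfolding mprod_corner3 scaleR_sum_right cint_def mmult_def moI_def
    by (simp add: Bochner_Integration.integral_sum i d2 double_integral[OF d'] scaleR_sum_right
        Bochner_Integration.integrable_sum)
qed

text \<open>Entry by entry this is the scalar computation: the point that joins the two signs
  decides between a nested \<open>moI\<close> and a product of two. In the swapped form the matrix
  factors stand in the opposite order to the variables, as in the \<open>g\<^sup>2\<close> term of
  the charge with n = 2.\<close>

lemma triple_mintegral:
  fixes a f :: "'a::{banach, second_countable_topology, real_normed_algebra_1} mfun"
  assumes d: "mdec a" "mdec p" "mdec q" "mdec f"
  shows triple_mintegral_nested:
    "(\<integral>(x, y, z). (sgn (x - y) * sgn (y - z)) *\<^sub>R (a x \<boxdot> p y \<boxdot> q z \<boxdot> f x) 0 0 \<partial>(lborel :: (real \<times> real \<times> real) measure))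
      = 4 *\<^sub>R cint (a \<cdot> moI (p \<cdot> moI q) \<cdot> f)" (is ?T1)
    "integrable (lborel :: (real \<times> real \<times> real) measure)
      (\<lambda>(x, y, z). (sgn (x - y) * sgn (y - z)) *\<^sub>R (a x \<boxdot> p y \<boxdot> q z \<boxdot> f x) 0 0)" (is ?T2)
  and triple_mintegral_swap:
    "(\<integral>(x, y, z). (sgn (x - y) * sgn (y - z)) *\<^sub>R (a x \<boxdot> p z \<boxdot> q y \<boxdot> f x) 0 0 \<partial>(lborel :: (real \<times> real \<times> real) measure))
      = 4 *\<^sub>R cint (a \<cdot> moI (moI p \<cdot> q) \<cdot> f)" (is ?T3)
  and triple_mintegral_left:
    "(\<integral>(x, y, z). (sgn (y - z) * sgn (z - x)) *\<^sub>R (a x \<boxdot> p y \<boxdot> q z \<boxdot> f x) 0 0 \<partial>(lborel :: (real \<times> real \<times> real) measure))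
      = 4 *\<^sub>R cint (a \<cdot> moI (moI p \<cdot> q) \<cdot> f)" (is ?T4)
    "integrable (lborel :: (real \<times> real \<times> real) measure)
      (\<lambda>(x, y, z). (sgn (y - z) * sgn (z - x)) *\<^sub>R (a x \<boxdot> p y \<boxdot> q z \<boxdot> f x) 0 0)" (is ?T5)
  and triple_mintegral_prod:
    "(\<integral>(x, y, z). (sgn (z - x) * sgn (x - y)) *\<^sub>R (a x \<boxdot> p y \<boxdot> q z \<boxdot> f x) 0 0 \<partial>(lborel :: (real \<times> real \<times> real) measure))
      = - (4 *\<^sub>R cint (a \<cdot> moI p \<cdot> moI q \<cdot> f))" (is ?T6)
    "integrable (lborel :: (real \<times> real \<times> real) measure)
      (\<lambda>(x, y, z). (sgn (z - x) * sgn (x - y)) *\<^sub>R (a x \<boxdot> p y \<boxdot> q z \<boxdot> f x) 0 0)" (is ?T7)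
proof -
  have d': "dec (\<lambda>x. a x i j)" "dec (\<lambda>x. p x i j)" "dec (\<lambda>x. q x i j)" "dec (\<lambda>x. f x i j)" for i j
    using d by (simp_all add: mdec_def)
  \<comment> \<open>The arrangements differ only in the kernel \<open>\<kappa>\<close> and in the
    factor \<open>W\<close> of the two inner variables; the outer integral is treated for all of
    them at once.\<close>
  have main: "integrable lborel (\<lambda>z. \<kappa> z *\<^sub>R (\<Sum>k<n. \<Sum>l<n. \<Sum>m<n. a (fst z) 0 k * W k l m (snd z) * f (fst z) m 0)) \<and>
      (\<integral>z. \<kappa> z *\<^sub>R (\<Sum>k<n. \<Sum>l<n. \<Sum>m<n. a (fst z) 0 k * W k l m (snd z) * f (fst z) m 0) \<partial>lborel)
      = (\<Sum>k<n. \<Sum>l<n. \<Sum>m<n. \<integral>x. a x 0 k * (\<integral>w. \<kappa> (x, w) *\<^sub>R W k l m w \<partial>lborel) * f x m 0 \<partial>lborel)"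
    if W: "\<And>k l m. W k l m \<in> borel_measurable borel" "\<And>k l m. \<exists>C. \<forall>y z. norm (W k l m (y, z)) \<le> C * (wt y * wt z)"
      and \<kappa>: "\<kappa> \<in> borel_measurable borel" "\<And>z. \<bar>\<kappa> z\<bar> \<le> 1" for \<kappa> and W :: "nat \<Rightarrow> nat \<Rightarrow> nat \<Rightarrow> real \<times> real \<Rightarrow> 'a"
  proof -
    have i: "integrable lborel (\<lambda>z. \<kappa> z *\<^sub>R (a (fst z) 0 k * W k l m (snd z) * f (fst z) m 0)) \<and>
      (\<integral>z. \<kappa> z *\<^sub>R (a (fst z) 0 k * W k l m (snd z) * f (fst z) m 0) \<partial>lborel)
      = (\<integral>x. a x 0 k * (\<integral>w. \<kappa> (x, w) *\<^sub>R W k l m w \<partial>lborel) * f x m 0 \<partial>lborel)" for k l m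
    proof -
      obtain C where C: "\<And>y z. norm (W k l m (y, z)) \<le> C * (wt y * wt z)" using W(2) by blast
      show ?thesis
        using triple_integrable[OF d'(1,4) W(1) C \<kappa>] triple_integral[OF d'(1,4) W(1) C \<kappa>] by blast
    qed
    show ?thesis
      unfolding scaleR_sum_right
      by (simp add: Bochner_Integration.integral_sum Bochner_Integration.integrable_sum i)
  qed
  define V where "V k l m w = p (fst w) k l * q (snd w) l m" for k l m w
  define V' where "V' k l m w = p (snd w) k l * q (fst w) l m" for k l m w
  have VC: "\<exists>C. \<forall>y z. norm (p y k l * q z l m) \<le> C * (wt y * wt z)" for k l m
    using product_bound[OF d'(2)[of k l] d'(3)[of l m]] by metis
  have V: "V k l m \<in> borel_measurable borel" "\<exists>C. \<forall>y z. norm (V k l m (y, z)) \<le> C * (wt y * wt z)" for k l m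
    unfolding V_def fst_conv snd_conv by (rule fst_snd_measurable(1)[OF d'(2,3)], rule VC)
  have V': "V' k l m \<in> borel_measurable borel" "\<exists>C. \<forall>y z. norm (V' k l m (y, z)) \<le> C * (wt y * wt z)" for k l m
    unfolding V'_def fst_conv snd_conv
    by (rule fst_snd_measurable(2)[OF d'(2,3)]) (use VC[of k l m] in \<open>metis mult.commute\<close>)
  have rhs: "cint (a \<cdot> moI p' \<cdot> f) = (\<Sum>k<n. \<Sum>m<n. \<integral>x. a x 0 k * oI (\<lambda>y. p' y k m) x * f x m 0 \<partial>lborel)"
    if "mdec p'" for p'
  proof -
    have "integrable lborel (\<lambda>x. a x 0 k * oI (\<lambda>y. p' y k m) x * f x m 0)" for k m
      using that by (intro dec_integrable dec_mult_bnd d' oI_bnd dec_bnd[OF d'(4)]) (simp add: mdec_def)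
    then show ?thesis
      unfolding cint_def mmult_def moI_def mprod_corner3
      by (simp add: Bochner_Integration.integral_sum Bochner_Integration.integrable_sum)
  qed
  have oI_sum: "oI (\<lambda>y. \<Sum>l<n. h l y) x = (\<Sum>l<n. oI (h l) x)" if "\<And>l. dec (h l)" for h :: "nat \<Rightarrow> real \<Rightarrow> 'a" and x
    unfolding oI_def scaleR_sum_right by (intro Bochner_Integration.integral_sum oI_integrable that)
  have expand: "(\<Sum>k<n. \<Sum>m<n. \<integral>x. a x 0 k * oI (\<lambda>y. \<Sum>l<n. h k l m y) x * f x m 0 \<partial>lborel)
      = (\<Sum>k<n. \<Sum>l<n. \<Sum>m<n. \<integral>x. a x 0 k * oI (h k l m) x * f x m 0 \<partial>lborel)" if h: "\<And>k l m. dec (h k l m)" for h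
  proof -
    have "integrable lborel (\<lambda>x. a x 0 k * oI (h k l m) x * f x m 0)" for k l m
      by (intro dec_integrable dec_mult_bnd d' oI_bnd dec_bnd[OF d'(4)] h)
    then have "(\<Sum>k<n. \<Sum>m<n. \<integral>x. a x 0 k * oI (\<lambda>y. \<Sum>l<n. h k l m y) x * f x m 0 \<partial>lborel)
      = (\<Sum>k<n. \<Sum>m<n. \<Sum>l<n. \<integral>x. a x 0 k * oI (h k l m) x * f x m 0 \<partial>lborel)"
      using h by (simp add: oI_sum sum_distrib_left sum_distrib_right Bochner_Integration.integral_sum)
    also have "\<dots> = (\<Sum>k<n. \<Sum>l<n. \<Sum>m<n. \<integral>x. a x 0 k * oI (h k l m) x * f x m 0 \<partial>lborel)"
      by (intro sum.cong refl sum.swap)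
    finally show ?thesis .
  qed
  note meas = borel_prod[symmetric, where 'b = "real \<times> real"] borel_prod[symmetric, where 'a = real and 'b = real]
  have k1: "(\<lambda>z::real \<times> real \<times> real. sgn (fst z - fst (snd z)) * sgn (fst (snd z) - snd (snd z))) \<in> borel_measurable borel"
    and k2: "(\<lambda>z::real \<times> real \<times> real. sgn (fst (snd z) - snd (snd z)) * sgn (snd (snd z) - fst z)) \<in> borel_measurable borel"
    and k3: "(\<lambda>z::real \<times> real \<times> real. sgn (snd (snd z) - fst z) * sgn (fst z - fst (snd z))) \<in> borel_measurable borel"
    unfolding meas by measurable
  note bnds = mdec_mult1 mdec_mult2 mbnd_moI d
  note m1 = main[of V, OF V k1 abs_mult_sgn_le] and m2 = main[of V, OF V k2 abs_mult_sgn_le]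
    and m3 = main[of V, OF V k3 abs_mult_sgn_le] and m4 = main[of V', OF V' k1 abs_mult_sgn_le]
  have fold: "(a x \<boxdot> p y \<boxdot> q z \<boxdot> f x) 0 0 = (\<Sum>k<n. \<Sum>l<n. \<Sum>m<n. a x 0 k * V k l m (y, z) * f x m 0)"
    "(a x \<boxdot> p z \<boxdot> q y \<boxdot> f x) 0 0 = (\<Sum>k<n. \<Sum>l<n. \<Sum>m<n. a x 0 k * V' k l m (y, z) * f x m 0)" for x y z
    by (simp_all add: mprod_corner4 V_def V'_def)
  show ?T2 ?T5 ?T7
    using m1 m2 m3 unfolding fold(1) case_prod_unfold prod.collapse by blast+
  have r: "cint (a \<cdot> moI (p \<cdot> moI q) \<cdot> f) = (\<Sum>k<n. \<Sum>l<n. \<Sum>m<n. \<integral>x. a x 0 k * oI (\<lambda>y. p y k l * oI (\<lambda>z. q z l m) y) x * f x m 0 \<partial>lborel)"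
    "cint (a \<cdot> moI (moI p \<cdot> q) \<cdot> f) = (\<Sum>k<n. \<Sum>l<n. \<Sum>m<n. \<integral>x. a x 0 k * oI (\<lambda>y. oI (\<lambda>z. p z k l) y * q y l m) x * f x m 0 \<partial>lborel)"
    using d by (simp_all add: rhs mdec_mult1 mdec_mult2 mbnd_moI)
      (simp_all add: mmult_def mprod_def moI_def expand dec_mult_bnd bnd_mult_dec oI_bnd d')
  have r3: "cint (a \<cdot> moI p \<cdot> moI q \<cdot> f) = (\<Sum>k<n. \<Sum>l<n. \<Sum>m<n. \<integral>x. a x 0 k * (oI (\<lambda>z. p z k l) x * oI (\<lambda>z. q z l m) x) * f x m 0 \<partial>lborel)"
  proof -
    have "integrable lborel (\<lambda>x. a x 0 k * (oI (\<lambda>z. p z k l) x * oI (\<lambda>z. q z l m) x) * f x m 0)" for k l m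
      by (intro dec_integrable dec_mult_bnd bnd_mult d' oI_bnd dec_bnd[OF d'(4)])
    then show ?thesis
      unfolding cint_def mmult_def moI_def mprod_corner4
      by (simp add: Bochner_Integration.integral_sum Bochner_Integration.integrable_sum)
  qed
  show ?T1
    unfolding fold(1) case_prod_unfold prod.collapse m1[THEN conjunct2] r
    by (simp add: V_def inner_integral_nested[OF d'(2,3)] scaleR_sum_right)
  show ?T3
    unfolding fold(2) case_prod_unfold prod.collapse m4[THEN conjunct2] r
    by (simp add: V'_def inner_integral_nested_swap[OF d'(2,3)] scaleR_sum_right)
  show ?T4
    unfolding fold(1) case_prod_unfold prod.collapse m2[THEN conjunct2] r
    by (simp add: V_def inner_integral_nested_left[OF d'(2,3)] scaleR_sum_right)
  show ?T6
    unfolding fold(1) case_prod_unfold prod.collapse m3[THEN conjunct2] r3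
    by (simp add: V_def inner_integral_prod[OF d'(2,3)] scaleR_sum_right sum_negf)
qed

text \<open>Exchanging the two integration variables turns the sign kernel into its negative.\<close>

lemma cint_cyclic:
  fixes a b c d :: "'a::{banach, second_countable_topology, real_normed_algebra_1} mfun"
  assumes "mdec a" "mdec b" "mdec c" "mdec d"
    and comm: "\<And>x y. ((a x \<boxdot> b y) \<boxdot> (c y \<boxdot> d x)) 0 0 = s *\<^sub>R ((c y \<boxdot> d x) \<boxdot> (a x \<boxdot> b y)) 0 0"
  shows "cint (a \<cdot> moI (b \<cdot> c) \<cdot> d) = - (s *\<^sub>R cint (c \<cdot> moI (d \<cdot> a) \<cdot> b))"
proof -
  have bc: "mdec (b \<cdot> c)" "mdec (d \<cdot> a)" using assms by (auto intro!: mdec_mult1 mdec_mbnd)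
  let ?L = "\<lambda>z. sgn (fst z - snd z) *\<^sub>R (a (fst z) \<boxdot> (b \<cdot> c) (snd z) \<boxdot> d (fst z)) 0 0"
  let ?R = "\<lambda>z. sgn (fst z - snd z) *\<^sub>R (c (fst z) \<boxdot> (d \<cdot> a) (snd z) \<boxdot> b (fst z)) 0 0"
  have i: "integrable (lborel \<Otimes>\<^sub>M lborel) ?R"
    unfolding lborel_prod by (rule double_mintegral(1)) (use bc assms in auto)
  have "2 *\<^sub>R cint (a \<cdot> moI (b \<cdot> c) \<cdot> d) = (\<integral>z. ?L z \<partial>lborel)"
    using assms bc by (simp add: double_mintegral(2))
  also have "?L = (\<lambda>z. - (s *\<^sub>R ?R (snd z, fst z)))"
  proof
    fix z :: "real \<times> real"
    have "(a (fst z) \<boxdot> (b \<cdot> c) (snd z) \<boxdot> d (fst z)) 0 0 = s *\<^sub>R (c (snd z) \<boxdot> (d \<cdot> a) (fst z) \<boxdot> b (snd z)) 0 0"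
      using comm[of "fst z" "snd z"] by (simp add: mmult_def mprod_assoc)
    moreover have "sgn (fst z - snd z) = - sgn (snd z - fst z)" by (simp add: sgn_real_def)
    ultimately show "?L z = - (s *\<^sub>R ?R (snd z, fst z))" by simp
  qed
  also have "(\<integral>z. - (s *\<^sub>R ?R (snd z, fst z)) \<partial>lborel) = - (s *\<^sub>R (\<integral>z. ?R (snd z, fst z) \<partial>lborel))"
    by (simp only: Bochner_Integration.integral_minus integral_scaleR_right)
  also have "(\<integral>z. ?R (snd z, fst z) \<partial>lborel) = (\<integral>z. ?R z \<partial>lborel)"
    using lborel_pair.integral_product_swap[OF borel_measurable_integrable[OF i]]
    by (simp add: lborel_prod case_prod_unfold)
  also have "\<dots> = 2 *\<^sub>R cint (c \<cdot> moI (d \<cdot> a) \<cdot> b)"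
    using assms bc by (simp add: double_mintegral(2))
  finally have "2 *\<^sub>R cint (a \<cdot> moI (b \<cdot> c) \<cdot> d) = 2 *\<^sub>R (- (s *\<^sub>R cint (c \<cdot> moI (d \<cdot> a) \<cdot> b)))"
    by (simp add: mult.commute)
  then show ?thesis unfolding scaleR_cancel_left by simp
qed

end

section \<open>Graded matrices\<close>

lemma mbcurve_const_fun: "t \<in> T \<Longrightarrow> mbnd S \<Longrightarrow> mbcurve T (\<lambda>s. S) 0 t"
  by (simp add: mbcurve_def mbnd_def bcurve_const)

definition const_mfun :: "'a mfun \<Rightarrow> bool" where
  "const_mfun S \<longleftrightarrow> (\<exists>s. S = (\<lambda>x. s))"

lemma const_mfun_simps [simp]:
  "const_mfun S \<Longrightarrow> mbnd S" "const_mfun S \<Longrightarrow> mderiv S 0"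
  for S :: "'a::real_normed_vector mfun"
  by (auto simp: const_mfun_def mbnd_const mderiv_const)

context matrix_size
begin

lemma const_mfun_mult [simp]: "const_mfun S \<Longrightarrow> const_mfun S' \<Longrightarrow> const_mfun (S \<cdot> S')"
  by (auto simp: const_mfun_def mmult_def)

lemma moI_mult_const:
  fixes F S :: "'a::{banach, second_countable_topology, real_normed_algebra_1} mfun"
  assumes S: "const_mfun S" and F: "mdec F"
  shows "moI (F \<cdot> S) = moI F \<cdot> S" "moI (S \<cdot> F) = S \<cdot> moI F"
proof -
  obtain s where s: "S = (\<lambda>x. s)" using S by (auto simp: const_mfun_def)
  have i: "integrable lborel (\<lambda>y. (sgn (x - y) / 2) *\<^sub>R F y i j)" for x i j
    using oI_integrable[of "\<lambda>y. F y i j"] F by (simp add: mdec_def)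
  have "oI (\<lambda>y. \<Sum>k<n. F y i k * s k j) x = (\<Sum>k<n. oI (\<lambda>y. F y i k) x * s k j)"
    and "oI (\<lambda>y. \<Sum>k<n. s i k * F y k j) x = (\<Sum>k<n. s i k * oI (\<lambda>y. F y k j) x)" for i j x
  proof -
    have "integrable lborel (\<lambda>y. (sgn (x - y) / 2) *\<^sub>R (F y i k * s k j))"
      "integrable lborel (\<lambda>y. (sgn (x - y) / 2) *\<^sub>R (s i k * F y k j))" for k
      using integrable_mult_left[of "s k j", OF i[of x i k]] integrable_mult_right[of "s i k", OF i[of x k j]] by simp_all
    then show "oI (\<lambda>y. \<Sum>k<n. F y i k * s k j) x = (\<Sum>k<n. oI (\<lambda>y. F y i k) x * s k j)"
      "oI (\<lambda>y. \<Sum>k<n. s i k * F y k j) x = (\<Sum>k<n. s i k * oI (\<lambda>y. F y k j) x)"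
      unfolding oI_def scaleR_sum_right
      by (simp_all add: Bochner_Integration.integral_sum integral_kernel_mult i)
  qed
  then show "moI (F \<cdot> S) = moI F \<cdot> S" "moI (S \<cdot> F) = S \<cdot> moI F"
    by (simp_all add: moI_def mmult_def mprod_def s fun_eq_iff)
qed

end

locale graded_matrices = matrix_size +
  fixes \<gamma> :: "nat \<Rightarrow> nat"
  assumes n_pos: "n > 0" and \<gamma>_0: "\<gamma> 0 = 0"
begin

text \<open>The grades of the two indices are included, so rows and columns of fields all have grade
  0 although their components may be odd. Matrix multiplication adds grades, since a summation index
  contributes its own grade twice. Signs then depend on the grades of the matrices only.\<close>

definition gr :: "nat \<Rightarrow> 'a::super_banach_algebra mfun \<Rightarrow> bool" where
  "gr p F \<longleftrightarrow> (\<forall>x i j. F x i j \<in> graded (p + \<gamma> i + \<gamma> j))"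

definition is_row :: "'a::super_banach_algebra mfun \<Rightarrow> bool" where
  "is_row F \<longleftrightarrow> (\<forall>x i j. i \<noteq> 0 \<longrightarrow> F x i j = 0)"

definition is_col :: "'a::super_banach_algebra mfun \<Rightarrow> bool" where
  "is_col F \<longleftrightarrow> (\<forall>x i j. j \<noteq> 0 \<longrightarrow> F x i j = 0)"

lemma is_row_mult [simp]: "is_row F \<Longrightarrow> is_row (F \<cdot> G)"
  and is_col_mult [simp]: "is_col G \<Longrightarrow> is_col (F \<cdot> G)"
  by (simp_all add: is_row_def is_col_def mmult_def mprod_def)

lemma gr_two_point:
  assumes "gr p F" "gr q G" shows "(F x \<boxdot> G y) i j \<in> graded (p + q + \<gamma> i + \<gamma> j)"
  unfolding mprod_def
proof (rule graded_sum)
  fix k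
  have "F x i k * G y k j \<in> graded ((p + \<gamma> i + \<gamma> k) + (q + \<gamma> k + \<gamma> j))"
    using assms by (intro graded_mult) (auto simp: gr_def)
  also have "graded ((p + \<gamma> i + \<gamma> k) + (q + \<gamma> k + \<gamma> j)) = (graded (p + q + \<gamma> i + \<gamma> j) :: 'a set)"
    by (rule graded_cong) presburger
  finally show "F x i k * G y k j \<in> graded (p + q + \<gamma> i + \<gamma> j)" .
qed

lemma gr_mult: "gr p F \<Longrightarrow> gr q G \<Longrightarrow> gr (p + q) (F \<cdot> G)"
  using gr_two_point unfolding gr_def[of "p + q"] mmult_def by blast

lemma gr_mult0 [simp]: "gr 0 F \<Longrightarrow> gr 0 G \<Longrightarrow> gr 0 (F \<cdot> G)"
  "gr p F \<Longrightarrow> gr 0 G \<Longrightarrow> gr p (F \<cdot> G)" "gr 0 F \<Longrightarrow> gr p G \<Longrightarrow> gr p (F \<cdot> G)"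
  using gr_mult[of 0 F 0 G] gr_mult[of p F 0 G] gr_mult[of 0 F p G] by simp_all

lemma gr_moI [simp]:
  assumes "gr p F" "mdec F" shows "gr p (moI F)"
  unfolding gr_def moI_def oI_def graded_def mem_Collect_eq
proof (intro allI)
  fix x i j
  have i: "integrable lborel (\<lambda>y. (sgn (x - y) / 2) *\<^sub>R F y i j)"
    using oI_integrable[of "\<lambda>y. F y i j"] assms by (simp add: mdec_def)
  have "parity (\<integral>y. (sgn (x - y) / 2) *\<^sub>R F y i j \<partial>lborel) = (\<integral>y. parity ((sgn (x - y) / 2) *\<^sub>R F y i j) \<partial>lborel)"
    using i by (rule integral_bounded_linear[OF bounded_linear_parity, symmetric])
  also have "\<dots> = (\<integral>y. (-1) ^ (p + \<gamma> i + \<gamma> j) *\<^sub>R ((sgn (x - y) / 2) *\<^sub>R F y i j) \<partial>lborel)"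
    using assms(1) by (simp add: parity_scaleR gr_def graded_def mult.commute)
  finally show "parity (\<integral>y. (sgn (x - y) / 2) *\<^sub>R F y i j \<partial>lborel)
      = (-1) ^ (p + \<gamma> i + \<gamma> j) *\<^sub>R (\<integral>y. (sgn (x - y) / 2) *\<^sub>R F y i j \<partial>lborel)"
    by (simp only: integral_scaleR_right)
qed

lemma corner_entry:
  assumes "is_row F" "is_col G" "i \<noteq> 0 \<or> j \<noteq> 0" shows "(F x \<boxdot> G y) i j = 0"
  using assms by (auto simp: is_row_def is_col_def mprod_def)

lemma corner_prod:
  assumes "is_row a" "is_col b" "is_row c" "is_col d"
  shows "((a x \<boxdot> b y) \<boxdot> (c z \<boxdot> d w)) i j = (if i = 0 \<and> j = 0 then (a x \<boxdot> b y) 0 0 * (c z \<boxdot> d w) 0 0 else 0)"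
proof -
  have "((a x \<boxdot> b y) \<boxdot> (c z \<boxdot> d w)) i j = (\<Sum>k<n. if k = 0 then (a x \<boxdot> b y) i 0 * (c z \<boxdot> d w) 0 j else 0)"
    unfolding mprod_def[of "a x \<boxdot> b y"]
    using corner_entry[OF assms(1,2)] by (intro sum.cong) auto
  then show ?thesis
    using n_pos corner_entry[OF assms(1,2)] corner_entry[OF assms(3,4)] by auto
qed

text \<open>A row times a column is one scalar, of the sum of the two grades; supercommutativity of
  the algebra is applied to such scalars and never to single components.\<close>

lemma corner_supercommute:
  assumes "is_row a" "is_col b" "is_row c" "is_col d" "gr p1 a" "gr p2 b" "gr q1 c" "gr q2 d"
  shows "(a x \<boxdot> b y) \<boxdot> (c z \<boxdot> d w) = (-1) ^ ((p1 + p2) * (q1 + q2)) *\<^sub>R ((c z \<boxdot> d w) \<boxdot> (a x \<boxdot> b y))"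
proof -
  have "(a x \<boxdot> b y) 0 0 \<in> graded (p1 + p2)" "(c z \<boxdot> d w) 0 0 \<in> graded (q1 + q2)"
    using gr_two_point[OF assms(5,6), of x y 0 0] gr_two_point[OF assms(7,8), of z w 0 0] by (simp_all add: \<gamma>_0)
  from supercommute_graded[OF this] show ?thesis
    using assms by (auto simp: fun_eq_iff corner_prod)
qed

text \<open>Even scalars are central, so evenness of the second pair is enough, whatever the first
  one contains. This makes the even cyclic rule valid for matrices that are not homogeneous.\<close>

lemma corner_commute:
  assumes "is_row a" "is_col b" "is_row c" "is_col d" "gr 0 c" "gr 0 d"
  shows "(a x \<boxdot> b y) \<boxdot> (c z \<boxdot> d w) = (c z \<boxdot> d w) \<boxdot> (a x \<boxdot> b y)"
proof -
  have "(c z \<boxdot> d w) 0 0 \<in> graded 0"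
    using gr_two_point[OF assms(5,6), of z w 0 0] by (simp add: \<gamma>_0)
  from even_central[OF this, of "(a x \<boxdot> b y) 0 0"] show ?thesis
    using assms by (auto simp: fun_eq_iff corner_prod)
qed

lemma commute_even:
  assumes "is_row a" "is_col b" "is_row c" "is_col d" "gr 0 c" "gr 0 d"
  shows "a \<cdot> b \<cdot> c \<cdot> d = c \<cdot> d \<cdot> a \<cdot> b"
  using corner_commute[OF assms] by (simp add: mmult_def mprod_assoc fun_eq_iff)

lemma commute_even_rules:
  assumes "is_row a" "is_col b" "is_row c" "is_col d" "gr 0 c" "gr 0 d"
  shows "a \<cdot> k \<cdot> b \<cdot> c \<cdot> d = c \<cdot> d \<cdot> a \<cdot> k \<cdot> b"
    "a \<cdot> k \<cdot> l \<cdot> b \<cdot> c \<cdot> d = c \<cdot> d \<cdot> a \<cdot> k \<cdot> l \<cdot> b"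
    "a \<cdot> k \<cdot> l \<cdot> m \<cdot> b \<cdot> c \<cdot> d = c \<cdot> d \<cdot> a \<cdot> k \<cdot> l \<cdot> m \<cdot> b"
  using commute_even[of "a \<cdot> k" b c d] commute_even[of "a \<cdot> k \<cdot> l" b c d]
    commute_even[of "a \<cdot> k \<cdot> l \<cdot> m" b c d] assms
  by (simp_all add: mmult_assoc)

definition row :: "'a::super_banach_algebra mfun \<Rightarrow> bool" where
  "row F \<longleftrightarrow> mdec F \<and> is_row F"

definition col :: "'a::super_banach_algebra mfun \<Rightarrow> bool" where
  "col F \<longleftrightarrow> mdec F \<and> is_col F"

lemma rowD [simp]: "row F \<Longrightarrow> mdec F" "row F \<Longrightarrow> is_row F"
  and colD [simp]: "col F \<Longrightarrow> mdec F" "col F \<Longrightarrow> is_col F"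
  by (simp_all add: row_def col_def)

lemma row_mult [simp]: "row F \<Longrightarrow> mbnd X \<Longrightarrow> row (F \<cdot> X)"
  and col_mult [simp]: "col F \<Longrightarrow> mbnd X \<Longrightarrow> col (X \<cdot> F)"
  unfolding row_def col_def by (auto intro: mdec_mult1 mdec_mult2)

lemma cyclic_even:
  fixes a b c d :: "'a::super_banach_algebra mfun"
  assumes "row a" "col b" "row c" "col d" "gr 0 c" "gr 0 d"
  shows "cint (a \<cdot> moI (b \<cdot> c) \<cdot> d) = - cint (c \<cdot> moI (d \<cdot> a) \<cdot> b)"
  using cint_cyclic[of a b c d 1] corner_commute[of a b c d] assms by simp

lemma cyclic_graded:
  fixes a b c d :: "'a::super_banach_algebra mfun"
  assumes "row a" "col b" "row c" "col d" "gr p1 a" "gr p2 b" "gr q1 c" "gr q2 d"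
  shows "cint (a \<cdot> moI (b \<cdot> c) \<cdot> d) = - ((-1) ^ ((p1 + p2) * (q1 + q2)) *\<^sub>R cint (c \<cdot> moI (d \<cdot> a) \<cdot> b))"
proof (rule cint_cyclic)
  fix x y
  show "((a x \<boxdot> b y) \<boxdot> c y \<boxdot> d x) 0 0 = (-1) ^ ((p1 + p2) * (q1 + q2)) *\<^sub>R ((c y \<boxdot> d x) \<boxdot> a x \<boxdot> b y) 0 0"
    using corner_supercommute[of a b c d p1 p2 q1 q2 x y y x] assms by simp
qed (use assms in auto)

end

lemma const_mfun_zero: "const_mfun (0 :: 'a::zero mfun)"
  by (auto simp: const_mfun_def zero_fun_def)

lemma scaleR_two_mult: "(2 * g) *\<^sub>R x = g *\<^sub>R x + g *\<^sub>R x" for x :: "'a::real_vector"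
  by (metis mult_2 scaleR_add_left)

section \<open>Abstract charges and their first variation\<close>

context matrix_size
begin

definition abs_charge0 :: "'a::super_banach_algebra mfun \<Rightarrow> 'a mfun \<Rightarrow> 'a mfun \<Rightarrow> 'a" where
  "abs_charge0 S r p = cint (r \<cdot> S \<cdot> p)"

definition abs_charge1 :: "real \<Rightarrow> 'a::super_banach_algebra mfun \<Rightarrow> 'a mfun \<Rightarrow> 'a mfun \<Rightarrow> 'a mfun \<Rightarrow> 'a" where
  "abs_charge1 g S r p p1 = cint (r \<cdot> S \<cdot> p1) - g *\<^sub>R cint (r \<cdot> S \<cdot> moI (p \<cdot> r) \<cdot> p)"

text \<open>Moving the even scalar that joins y to x to the end, the \<open>g\<^sup>2\<close>
  integrand passes through the points x, z, y, x, with signs for x - y and y - z. Integration over z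
  gives the inner \<open>moI\<close>, integration over y the outer one. The factors 2 and 4 of the
  multiple integrals have been absorbed in the coefficients. Space derivatives are separate
  arguments so that each can be varied along its own curve.\<close>

definition abs_charge2 :: "real \<Rightarrow> 'a::super_banach_algebra mfun \<Rightarrow> 'a mfun \<Rightarrow> 'a mfun \<Rightarrow> 'a mfun \<Rightarrow> 'a mfun \<Rightarrow> 'a mfun \<Rightarrow> 'a" where
  "abs_charge2 g S r r1 p p1 p2 = cint (r \<cdot> S \<cdot> p2) - g *\<^sub>R cint (r \<cdot> S \<cdot> moI (p1 \<cdot> r) \<cdot> p)
     + g *\<^sub>R cint (r1 \<cdot> S \<cdot> moI (p \<cdot> r) \<cdot> p) + g\<^sup>2 *\<^sub>R cint (r \<cdot> S \<cdot> moI (moI (p \<cdot> r) \<cdot> p \<cdot> r) \<cdot> p)"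

definition abs_hamiltonian :: "real \<Rightarrow> 'a::super_banach_algebra mfun \<Rightarrow> 'a mfun \<Rightarrow> 'a mfun \<Rightarrow> 'a mfun \<Rightarrow> 'a" where
  "abs_hamiltonian g r r1 p p1 = cint (r1 \<cdot> p1) + g *\<^sub>R cint (r \<cdot> p \<cdot> r \<cdot> p)"

lemma curve_cint2:
  fixes R C :: "real \<Rightarrow> 'a::super_banach_algebra mfun"
  assumes t: "t \<in> T" and S: "mbnd S" and R: "mdcurve T R v t" and C: "mdcurve T C u t"
    and d: "mdec (R t)" "mdec (C t)" "mdec v" "mdec u"
  shows "((\<lambda>s. cint (R s \<cdot> S \<cdot> C s)) has_vector_derivative (cint (v \<cdot> S \<cdot> C t) + cint (R t \<cdot> S \<cdot> u))) (at t within T)"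
proof -
  have "mdcurve T (\<lambda>s. R s \<cdot> S \<cdot> C s) (v \<cdot> S \<cdot> C t + R t \<cdot> (0 \<cdot> C t + S \<cdot> u)) t"
    by (intro mdcurve_mult1 mbcurve_mult mbcurve_const_fun mdcurve_mbcurve t S R C)
  from mdcurve_cint[OF this] show ?thesis
    using d S by (simp add: mmult_linear mdec_mult1 mdec_mult2 mbnd_mult mdec_mbnd)
qed

lemma curve_cint3:
  fixes R C P :: "real \<Rightarrow> 'a::super_banach_algebra mfun"
  assumes t: "t \<in> T" and S: "mbnd S" and R: "mdcurve T R v t" and C: "mdcurve T C u t"
    and P: "mbcurve T P P' t"
    and d: "mdec (R t)" "mdec (C t)" "mdec v" "mdec u" "mbnd (P t)" "mbnd P'"
  shows "((\<lambda>s. cint (R s \<cdot> S \<cdot> P s \<cdot> C s)) has_vector_derivative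
    (cint (v \<cdot> S \<cdot> P t \<cdot> C t) + cint (R t \<cdot> S \<cdot> P' \<cdot> C t) + cint (R t \<cdot> S \<cdot> P t \<cdot> u))) (at t within T)"
proof -
  have "mdcurve T (\<lambda>s. R s \<cdot> S \<cdot> P s \<cdot> C s) (v \<cdot> S \<cdot> P t \<cdot> C t + R t \<cdot> (0 \<cdot> P t \<cdot> C t + S \<cdot> (P' \<cdot> C t + P t \<cdot> u))) t"
    by (intro mdcurve_mult1 mbcurve_mult mbcurve_const_fun mdcurve_mbcurve t S R C P)
  from mdcurve_cint[OF this] show ?thesis
    using d S by (simp add: mmult_linear mdec_mult1 mdec_mult2 mbnd_mult mdec_mbnd add.assoc)
qed

end

locale field_pair = graded_matrices n \<gamma> for n \<gamma> +
  fixes r r1 r2 p p1 p2 :: "'a::super_banach_algebra mfun" and g :: real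
  assumes rows [simp]: "row r" "row r1" "row r2" and cols [simp]: "col p" "col p1" "col p2"
    and even [simp]: "gr 0 r" "gr 0 r1" "gr 0 r2" "gr 0 p" "gr 0 p1" "gr 0 p2"
    and derivs [simp]: "mderiv r r1" "mderiv r1 r2" "mderiv p p1" "mderiv p1 p2"
begin

definition "P = moI (p \<cdot> r)"
definition "A = moI (p1 \<cdot> r)"
definition "A' = moI (p \<cdot> r1)"
definition "B = moI (P \<cdot> p \<cdot> r)"
definition "B' = moI (p \<cdot> r \<cdot> P)"

lemmas mdec_rules [simp] = mdec_mult1 mdec_mult2 mbnd_mult mdec_mbnd

lemma bounds [simp]: "mbnd P" "mbnd A" "mbnd A'" "mbnd B" "mbnd B'"
proof -
  show P: "mbnd P" by (simp add: P_def mbnd_moI)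
  show "mbnd A" "mbnd A'" "mbnd B" "mbnd B'" by (simp_all add: A_def A'_def B_def B'_def P mbnd_moI)
qed

lemma P_derivs [simp]: "mderiv P (p \<cdot> r)" "mderiv A (p1 \<cdot> r)" "mderiv A' (p \<cdot> r1)"
  "mderiv B (P \<cdot> p \<cdot> r)" "mderiv B' (p \<cdot> r \<cdot> P)"
  unfolding P_def[of] A_def A'_def B_def B'_def by (rule mderiv_moI; simp add: mbnd_moI)+

lemma evens [simp]: "gr 0 P" "gr 0 A" "gr 0 A'" "gr 0 B" "gr 0 B'"
proof -
  show P: "gr 0 P" by (simp add: P_def)
  show "gr 0 A" "gr 0 A'" "gr 0 B" "gr 0 B'" by (simp_all add: A_def A'_def B_def B'_def P)
qed

text \<open>The first variation of the \<open>k\<close>-th charge is \<open>\<integral> (Yk u + v Xk)\<close> for variations \<open>u\<close>, \<open>v\<close> of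
  \<open>p\<close>, \<open>r\<close>: thus \<open>Xk\<close> and \<open>Yk\<close> are, up to signs, the functional derivatives.\<close>

definition "X0 S = S \<cdot> p"
definition "Y0 S = r \<cdot> S"
definition "X1 S = S \<cdot> p1 - g *\<^sub>R (S \<cdot> P \<cdot> p) + g *\<^sub>R (P \<cdot> S \<cdot> p)"
definition "Y1 S = - (r1 \<cdot> S) - g *\<^sub>R (r \<cdot> S \<cdot> P) + g *\<^sub>R (r \<cdot> P \<cdot> S)"
definition "X2 S = S \<cdot> p2 - g *\<^sub>R (S \<cdot> A \<cdot> p) + g *\<^sub>R (P \<cdot> S \<cdot> p1) - g *\<^sub>R (S \<cdot> p \<cdot> r \<cdot> p) - g *\<^sub>R (S \<cdot> P \<cdot> p1)
   - g *\<^sub>R (A' \<cdot> S \<cdot> p) + g\<^sup>2 *\<^sub>R (S \<cdot> B \<cdot> p) - g\<^sup>2 *\<^sub>R (P \<cdot> S \<cdot> P \<cdot> p) + g\<^sup>2 *\<^sub>R (B' \<cdot> S \<cdot> p)"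
definition "Y2 S = r2 \<cdot> S - g *\<^sub>R (r \<cdot> S \<cdot> A) - g *\<^sub>R (r1 \<cdot> P \<cdot> S) - g *\<^sub>R (r \<cdot> p \<cdot> r \<cdot> S) + g *\<^sub>R (r1 \<cdot> S \<cdot> P)
   - g *\<^sub>R (r \<cdot> A' \<cdot> S) + g\<^sup>2 *\<^sub>R (r \<cdot> S \<cdot> B) - g\<^sup>2 *\<^sub>R (r \<cdot> P \<cdot> S \<cdot> P) + g\<^sup>2 *\<^sub>R (r \<cdot> B' \<cdot> S)"
definition "XH = - p2 + (2 * g) *\<^sub>R (p \<cdot> r \<cdot> p)"
definition "YH = - r2 + (2 * g) *\<^sub>R (r \<cdot> p \<cdot> r)"

text \<open>A cyclic shift brings \<open>S\<close> into the argument of \<open>moI\<close>, at its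
  right end; being constant it leaves again, and the remaining antiderivative is one of the five
  named ones.\<close>

lemma moI_fold:
  assumes S: "const_mfun S"
  shows "moI (p \<cdot> r \<cdot> S) = P \<cdot> S" "moI (p \<cdot> r1 \<cdot> S) = A' \<cdot> S" "moI (p1 \<cdot> r \<cdot> S) = A \<cdot> S" "moI (p \<cdot> r \<cdot> P \<cdot> S) = B' \<cdot> S"
    "moI (P \<cdot> p \<cdot> r \<cdot> S) = B \<cdot> S"
  using moI_mult_const[OF S, of "p \<cdot> r"] moI_mult_const[OF S, of "p \<cdot> r1"] moI_mult_const[OF S, of "p1 \<cdot> r"]
    moI_mult_const[OF S, of "p \<cdot> r \<cdot> P"] moI_mult_const[OF S, of "P \<cdot> p \<cdot> r"]
  by (simp_all add: P_def A_def A'_def B_def B'_def mmult_assoc mbnd_moI)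

end

text \<open>\<open>u\<close>, \<open>v\<close> are the velocities at \<open>t\<close> of the curves
  \<open>C\<close>, \<open>R\<close>. That the velocity of the differentiated curve is the space
  derivative of the velocity is what permits integration by parts in the first variation.\<close>

locale field_variation = field_pair +
  fixes T t and R R1 C C1 C2 :: "real \<Rightarrow> 'a mfun" and u u1 u2 v v1
  assumes t [simp]: "t \<in> T" and at_t: "R t = r" "R1 t = r1" "C t = p" "C1 t = p1" "C2 t = p2"
    and curves: "mdcurve T R v t" "mdcurve T R1 v1 t" "mdcurve T C u t" "mdcurve T C1 u1 t" "mdcurve T C2 u2 t"
    and vrows [simp]: "row v" "row v1" and ucols [simp]: "col u" "col u1" "col u2"
    and veven [simp]: "gr 0 v" "gr 0 u"
    and vderivs [simp]: "mderiv v v1" "mderiv u u1" "mderiv u1 u2"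
begin

lemma curve_P: "mbcurve T (\<lambda>s. moI (C s \<cdot> R s)) (moI (u \<cdot> r) + moI (p \<cdot> v)) t"
proof -
  have "mdcurve T (\<lambda>s. C s \<cdot> R s) (u \<cdot> R t + C t \<cdot> v) t"
    by (intro mdcurve_mult1 mdcurve_mbcurve curves t)
  from mbcurve_moI[OF this] show ?thesis by (simp add: at_t moI_add)
qed

lemma charge0_variation:
  assumes "mbnd S"
  shows "((\<lambda>s. abs_charge0 S (R s) (C s)) has_vector_derivative cint (Y0 S \<cdot> u + v \<cdot> X0 S)) (at t within T)"
  using curve_cint2[OF t assms curves(1,3)] assms
  by (simp add: abs_charge0_def X0_def Y0_def at_t mmult_simps add.commute)

lemma by_parts_S:
  assumes S: "const_mfun S"
  shows "cint (r \<cdot> S \<cdot> u1) = - cint (r1 \<cdot> S \<cdot> u)" (is ?T1) "cint (r \<cdot> S \<cdot> u2) = cint (r2 \<cdot> S \<cdot> u)" (is ?T2)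
    "cint (r \<cdot> P \<cdot> S \<cdot> u1) = - cint (r1 \<cdot> P \<cdot> S \<cdot> u) - cint (r \<cdot> p \<cdot> r \<cdot> S \<cdot> u)" (is ?T3)
    "cint (v1 \<cdot> S \<cdot> P \<cdot> p) = - cint (v \<cdot> S \<cdot> p \<cdot> r \<cdot> p) - cint (v \<cdot> S \<cdot> P \<cdot> p1)" (is ?T4)
    "cint (v1 \<cdot> p1) = - cint (v \<cdot> p2)" "cint (r1 \<cdot> u1) = - cint (r2 \<cdot> u)"
proof -
  have *: "mderiv (S \<cdot> f) (S \<cdot> f')" if "mderiv f f'" for f f'
    using mderiv_mult[OF const_mfun_simps(2)[OF S] that] by (simp add: mmult_linear)
  show ?T1
    using cint_by_parts[of r r1 "S \<cdot> u" "S \<cdot> u1"] S by (simp add: *)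
  have "cint (r1 \<cdot> S \<cdot> u1) = - cint (r2 \<cdot> S \<cdot> u)" "cint (r \<cdot> S \<cdot> u2) = - cint (r1 \<cdot> S \<cdot> u1)"
    using cint_by_parts[of r1 r2 "S \<cdot> u" "S \<cdot> u1"] cint_by_parts[of r r1 "S \<cdot> u1" "S \<cdot> u2"] S by (simp_all add: *)
  then show ?T2 by simp
  show ?T3
    using cint_by_parts[of "r \<cdot> P" "r1 \<cdot> P + r \<cdot> p \<cdot> r" "S \<cdot> u" "S \<cdot> u1"] S
    by (simp add: * mderiv_mult mmult_simps) (simp add: eq_diff_eq eq_neg_iff_add_eq_0 add_ac)
  show ?T4
    using cint_by_parts[of v v1 "S \<cdot> P \<cdot> p" "S \<cdot> (p \<cdot> r \<cdot> p + P \<cdot> p1)"] S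
      *[OF mderiv_mult[OF P_derivs(1) derivs(3)]]
    by (simp add: mmult_simps)
  show "cint (v1 \<cdot> p1) = - cint (v \<cdot> p2)" "cint (r1 \<cdot> u1) = - cint (r2 \<cdot> u)"
    using cint_by_parts[of v v1 p1 p2] cint_by_parts[of r1 r2 u u1] by simp_all
qed

text \<open>Varying \<open>P\<close> leaves the variation inside \<open>moI\<close>. A cyclic shift
  carries it to the left or right end of the product, where its coefficient can be read off; this is
  the origin of the terms with \<open>P\<close> on the other side of \<open>S\<close> in
  \<open>X1\<close> and \<open>Y1\<close>.\<close>

lemma charge1_variation:
  assumes S: "const_mfun S"
  shows "((\<lambda>s. abs_charge1 g S (R s) (C s) (C1 s)) has_vector_derivative cint (Y1 S \<cdot> u + v \<cdot> X1 S)) (at t within T)"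
proof -
  have c: "cint (r \<cdot> S \<cdot> moI (u \<cdot> r) \<cdot> p) = - cint (r \<cdot> P \<cdot> S \<cdot> u)"
    "cint (r \<cdot> S \<cdot> moI (p \<cdot> v) \<cdot> p) = - cint (v \<cdot> P \<cdot> S \<cdot> p)"
    using cyclic_even[of "r \<cdot> S" u r p] cyclic_even[of "r \<cdot> S" p v p] S by (simp_all add: mmult_assoc moI_fold)
  have "((\<lambda>s. abs_charge1 g S (R s) (C s) (C1 s)) has_vector_derivative
    cint (v \<cdot> S \<cdot> C1 t) + cint (R t \<cdot> S \<cdot> u1) - g *\<^sub>R (cint (v \<cdot> S \<cdot> moI (C t \<cdot> R t) \<cdot> C t) +
     cint (R t \<cdot> S \<cdot> (moI (u \<cdot> r) + moI (p \<cdot> v)) \<cdot> C t) + cint (R t \<cdot> S \<cdot> moI (C t \<cdot> R t) \<cdot> u))) (at t within T)"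
    unfolding abs_charge1_def
    by (intro has_vector_derivative_diff bounded_linear.has_vector_derivative[OF bounded_linear_scaleR_right]
        curve_cint2 curve_cint3 curves t curve_P) (use S in \<open>simp_all add: at_t mbnd_moI\<close>)
  also have "cint (v \<cdot> S \<cdot> C1 t) + cint (R t \<cdot> S \<cdot> u1) - g *\<^sub>R (cint (v \<cdot> S \<cdot> moI (C t \<cdot> R t) \<cdot> C t) +
     cint (R t \<cdot> S \<cdot> (moI (u \<cdot> r) + moI (p \<cdot> v)) \<cdot> C t) + cint (R t \<cdot> S \<cdot> moI (C t \<cdot> R t) \<cdot> u))
    = cint (Y1 S \<cdot> u + v \<cdot> X1 S)"
    using S by (simp add: at_t X1_def Y1_def mmult_simps by_parts_S c mbnd_moI flip: P_def) (simp add: algebra_simps)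
  finally show ?thesis .
qed

lemma charge2_variation:
  assumes S: "const_mfun S"
  shows "((\<lambda>s. abs_charge2 g S (R s) (R1 s) (C s) (C1 s) (C2 s)) has_vector_derivative cint (Y2 S \<cdot> u + v \<cdot> X2 S)) (at t within T)"
proof -
  have [simp]: "mbnd (moI (u \<cdot> r))" "mbnd (moI (p \<cdot> v))" by (simp_all add: mbnd_moI)
  have c: "cint (r \<cdot> S \<cdot> moI (u1 \<cdot> r) \<cdot> p) = cint (r1 \<cdot> P \<cdot> S \<cdot> u) + cint (r \<cdot> p \<cdot> r \<cdot> S \<cdot> u)"
    "cint (r \<cdot> S \<cdot> moI (p1 \<cdot> v) \<cdot> p) = - cint (v \<cdot> P \<cdot> S \<cdot> p1)"
    "cint (r1 \<cdot> S \<cdot> moI (u \<cdot> r) \<cdot> p) = - cint (r \<cdot> A' \<cdot> S \<cdot> u)"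
    "cint (r1 \<cdot> S \<cdot> moI (p \<cdot> v) \<cdot> p) = - cint (v \<cdot> A' \<cdot> S \<cdot> p)"
    using cyclic_even[of "r \<cdot> S" u1 r p] cyclic_even[of "r \<cdot> S" p1 v p]
      cyclic_even[of "r1 \<cdot> S" u r p] cyclic_even[of "r1 \<cdot> S" p v p] S
    by (simp_all add: mmult_assoc moI_fold by_parts_S)
  \<comment> \<open>A variation inside the inner antiderivative needs two cyclic shifts, so the sign
    is plus and \<open>B'\<close> appears; a variation in the outer one needs a single
    shift.\<close>
  have c2: "cint (r \<cdot> S \<cdot> moI (moI (u \<cdot> r) \<cdot> p \<cdot> r) \<cdot> p) = cint (r \<cdot> B' \<cdot> S \<cdot> u)"
    "cint (r \<cdot> S \<cdot> moI (moI (p \<cdot> v) \<cdot> p \<cdot> r) \<cdot> p) = cint (v \<cdot> B' \<cdot> S \<cdot> p)"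
    "cint (r \<cdot> S \<cdot> moI (P \<cdot> u \<cdot> r) \<cdot> p) = - cint (r \<cdot> P \<cdot> S \<cdot> P \<cdot> u)"
    "cint (r \<cdot> S \<cdot> moI (P \<cdot> p \<cdot> v) \<cdot> p) = - cint (v \<cdot> P \<cdot> S \<cdot> P \<cdot> p)"
    using cyclic_even[of "r \<cdot> S" "moI (u \<cdot> r) \<cdot> p" r p] cyclic_even[of "r \<cdot> P \<cdot> S" u r p]
      cyclic_even[of "r \<cdot> S" "moI (p \<cdot> v) \<cdot> p" r p] cyclic_even[of "r \<cdot> P \<cdot> S" p v p]
      cyclic_even[of "r \<cdot> S" "P \<cdot> u" r p] cyclic_even[of "r \<cdot> S" "P \<cdot> p" v p] S
    by (simp_all add: mmult_assoc moI_fold)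
  have "mdcurve T (\<lambda>s. C1 s \<cdot> R s) (u1 \<cdot> R t + C1 t \<cdot> v) t"
    by (intro mdcurve_mult1 mdcurve_mbcurve curves t)
  from mbcurve_moI[OF this]
  have cA: "mbcurve T (\<lambda>s. moI (C1 s \<cdot> R s)) (moI (u1 \<cdot> r) + moI (p1 \<cdot> v)) t" by (simp add: at_t moI_add)
  have "mdcurve T (\<lambda>s. moI (C s \<cdot> R s) \<cdot> C s \<cdot> R s)
      ((moI (u \<cdot> r) + moI (p \<cdot> v)) \<cdot> C t \<cdot> R t + moI (C t \<cdot> R t) \<cdot> (u \<cdot> R t + C t \<cdot> v)) t"
    by (intro mdcurve_mult2 curve_P t mdcurve_mult1 mdcurve_mbcurve curves)
  from mbcurve_moI[OF this]
  have cB: "mbcurve T (\<lambda>s. moI (moI (C s \<cdot> R s) \<cdot> C s \<cdot> R s)) (moI (moI (u \<cdot> r) \<cdot> p \<cdot> r) + moI (moI (p \<cdot> v) \<cdot> p \<cdot> r)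
      + (moI (P \<cdot> u \<cdot> r) + moI (P \<cdot> p \<cdot> v))) t" by (simp add: at_t mmult_linear moI_add flip: P_def)
  let ?D = "cint (v \<cdot> S \<cdot> C2 t) + cint (R t \<cdot> S \<cdot> u2)
    - g *\<^sub>R (cint (v \<cdot> S \<cdot> moI (C1 t \<cdot> R t) \<cdot> C t) + cint (R t \<cdot> S \<cdot> (moI (u1 \<cdot> r) + moI (p1 \<cdot> v)) \<cdot> C t) + cint (R t \<cdot> S \<cdot> moI (C1 t \<cdot> R t) \<cdot> u))
    + g *\<^sub>R (cint (v1 \<cdot> S \<cdot> moI (C t \<cdot> R t) \<cdot> C t) + cint (R1 t \<cdot> S \<cdot> (moI (u \<cdot> r) + moI (p \<cdot> v)) \<cdot> C t) + cint (R1 t \<cdot> S \<cdot> moI (C t \<cdot> R t) \<cdot> u))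
    + g\<^sup>2 *\<^sub>R (cint (v \<cdot> S \<cdot> moI (moI (C t \<cdot> R t) \<cdot> C t \<cdot> R t) \<cdot> C t)
      + cint (R t \<cdot> S \<cdot> (moI (moI (u \<cdot> r) \<cdot> p \<cdot> r) + moI (moI (p \<cdot> v) \<cdot> p \<cdot> r)
      + (moI (P \<cdot> u \<cdot> r) + moI (P \<cdot> p \<cdot> v))) \<cdot> C t) + cint (R t \<cdot> S \<cdot> moI (moI (C t \<cdot> R t) \<cdot> C t \<cdot> R t) \<cdot> u))"
  have "((\<lambda>s. abs_charge2 g S (R s) (R1 s) (C s) (C1 s) (C2 s)) has_vector_derivative ?D) (at t within T)"
    unfolding abs_charge2_def
    by (intro has_vector_derivative_diff has_vector_derivative_add bounded_linear.has_vector_derivative[OF bounded_linear_scaleR_right]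
        curve_cint2 curve_cint3 curves t curve_P cA cB) (use S in \<open>simp_all add: at_t mbnd_moI\<close>)
  also have "?D = cint (Y2 S \<cdot> u + v \<cdot> X2 S)"
    using S by (simp add: at_t X2_def Y2_def mmult_simps by_parts_S c c2 mbnd_moI flip: P_def A_def B_def) (simp add: algebra_simps)
  finally show ?thesis .
qed

lemma hamiltonian_variation:
  shows "((\<lambda>s. abs_hamiltonian g (R s) (R1 s) (C s) (C1 s)) has_vector_derivative cint (YH \<cdot> u + v \<cdot> XH)) (at t within T)"
proof -
  have "mdcurve T (\<lambda>s. R1 s \<cdot> C1 s) (v1 \<cdot> C1 t + R1 t \<cdot> u1) t"
    "mdcurve T (\<lambda>s. R s \<cdot> C s \<cdot> R s \<cdot> C s)
      (v \<cdot> C t \<cdot> R t \<cdot> C t + R t \<cdot> (u \<cdot> R t \<cdot> C t + C t \<cdot> (v \<cdot> C t + R t \<cdot> u))) t"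
    by (intro mdcurve_mult1 mdcurve_mbcurve curves t)+
  note d = this[THEN mdcurve_cint]
  \<comment> \<open>Commuting even scalars carries the variation of an inner factor to an end, so
    each of the two monomials occurs twice; hence the coefficient \<open>2 * g\<close> in
    \<open>XH\<close> and \<open>YH\<close>.\<close>
  have c: "r \<cdot> u \<cdot> r \<cdot> p = r \<cdot> p \<cdot> r \<cdot> u" "r \<cdot> p \<cdot> v \<cdot> p = v \<cdot> p \<cdot> r \<cdot> p"
    using commute_even[of r u r p] commute_even[of r p v p] by simp_all
  have "((\<lambda>s. abs_hamiltonian g (R s) (R1 s) (C s) (C1 s)) has_vector_derivative
     cint (v1 \<cdot> C1 t + R1 t \<cdot> u1) + g *\<^sub>R cint (v \<cdot> C t \<cdot> R t \<cdot> C t + R t \<cdot> (u \<cdot> R t \<cdot> C t + C t \<cdot> (v \<cdot> C t + R t \<cdot> u)))) (at t within T)"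
    unfolding abs_hamiltonian_def
    by (intro has_vector_derivative_add bounded_linear.has_vector_derivative[OF bounded_linear_scaleR_right] d)
  also have "cint (v1 \<cdot> C1 t + R1 t \<cdot> u1) + g *\<^sub>R cint (v \<cdot> C t \<cdot> R t \<cdot> C t + R t \<cdot> (u \<cdot> R t \<cdot> C t + C t \<cdot> (v \<cdot> C t + R t \<cdot> u)))
    = cint (YH \<cdot> u + v \<cdot> XH)"
    by (simp add: at_t XH_def YH_def mmult_simps c by_parts_S(5,6)[OF const_mfun_zero] scaleR_two_mult scaleR_add_right add_ac)
  finally show ?thesis .
qed

end

section \<open>Conservation\<close>

context field_pair
begin

lemma cint_total_derivative:
  assumes "mderiv E E'" "mdec E" "mdec E'" "E' = F" shows "cint F = 0"
  using cint_mderiv[of E E'] assms by simp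

text \<open>\<open>im_unit\<close> times \<open>u0\<close> and \<open>v0\<close> are the velocities
  of \<phi> and \<psi> prescribed by the equation and its conjugate.\<close>

definition "u0 = p2 - (2 * g) *\<^sub>R (p \<cdot> r \<cdot> p)"
definition "v0 = - r2 + (2 * g) *\<^sub>R (r \<cdot> p \<cdot> r)"

lemma u0_v0: "u0 = - XH" "v0 = YH"
  by (simp_all add: u0_def v0_def XH_def YH_def)

text \<open>Rewrite rules carrying a trailing even scalar to the front. In the resulting normal form
  the derivatives of the currents below agree with the integrands monomial by monomial.\<close>

lemma commutes:
  assumes "is_row a" "is_col b"
  shows "a \<cdot> b \<cdot> r \<cdot> p = r \<cdot> p \<cdot> a \<cdot> b"
    "a \<cdot> k \<cdot> b \<cdot> r \<cdot> p = r \<cdot> p \<cdot> a \<cdot> k \<cdot> b"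
    "a \<cdot> k \<cdot> l \<cdot> b \<cdot> r \<cdot> p = r \<cdot> p \<cdot> a \<cdot> k \<cdot> l \<cdot> b"
    "a \<cdot> k \<cdot> l \<cdot> m \<cdot> b \<cdot> r \<cdot> p = r \<cdot> p \<cdot> a \<cdot> k \<cdot> l \<cdot> m \<cdot> b"
    "a \<cdot> b \<cdot> r1 \<cdot> p = r1 \<cdot> p \<cdot> a \<cdot> b"
    "a \<cdot> k \<cdot> b \<cdot> r1 \<cdot> p = r1 \<cdot> p \<cdot> a \<cdot> k \<cdot> b"
    "a \<cdot> k \<cdot> l \<cdot> b \<cdot> r1 \<cdot> p = r1 \<cdot> p \<cdot> a \<cdot> k \<cdot> l \<cdot> b"
    "a \<cdot> b \<cdot> r \<cdot> p1 = r \<cdot> p1 \<cdot> a \<cdot> b"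
    "a \<cdot> k \<cdot> b \<cdot> r \<cdot> p1 = r \<cdot> p1 \<cdot> a \<cdot> k \<cdot> b"
    "a \<cdot> k \<cdot> l \<cdot> b \<cdot> r \<cdot> p1 = r \<cdot> p1 \<cdot> a \<cdot> k \<cdot> l \<cdot> b"
  by (rule commute_even commute_even_rules; simp add: assms)+

lemma mderiv_const_mult:
  fixes S F :: "'a mfun"
  assumes S: "const_mfun S" and F: "mderiv F F'" shows "mderiv (S \<cdot> F) (S \<cdot> F')"
  using mderiv_mult[OF const_mfun_simps(2)[OF S] F] by (simp add: mmult_linear)

lemma conserved0:
  assumes S: "const_mfun S" shows "cint (Y0 S \<cdot> u0 + v0 \<cdot> X0 S) = 0"
  by (rule cint_total_derivative[where E = "r \<cdot> S \<cdot> p1 - r1 \<cdot> S \<cdot> p"],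
      (rule mderiv_linear mderiv_const_mult[OF S] mderiv_mult derivs)+)
     (use S in \<open>simp_all add: X0_def Y0_def u0_def v0_def mmult_simps commutes algebra_simps\<close>)

lemma conserved1:
  assumes S: "const_mfun S" shows "cint (Y1 S \<cdot> u0 + v0 \<cdot> X1 S) = 0"
  \<comment> \<open>The first term is the current of the free equation. Each nonlocal monomial
    \<open>r \<cdot> Z \<cdot> p\<close> enters through a Wronskian
    \<open>r1 \<cdot> Z \<cdot> p - r \<cdot> Z \<cdot> p1\<close>, which produces its second
    derivatives; the last term takes up the local quartic terms that come from differentiating
    \<open>P\<close>. At order g^2 everything cancels by commuting scalars.\<close>
  by (rule cint_total_derivative[where E = "- (r1 \<cdot> S \<cdot> p1)
        + g *\<^sub>R (r1 \<cdot> S \<cdot> P \<cdot> p - r \<cdot> S \<cdot> P \<cdot> p1 + r \<cdot> P \<cdot> S \<cdot> p1 - r1 \<cdot> P \<cdot> S \<cdot> p + r \<cdot> p \<cdot> r \<cdot> S \<cdot> p)"],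
      (rule mderiv_linear mderiv_const_mult[OF S] mderiv_mult derivs P_derivs)+)
     (use S in \<open>simp_all add: X1_def Y1_def u0_def v0_def scaleR_two_mult mmult_simps commutes
        scaleR_add_right scaleR_diff_right\<close>)

lemma conserved2:
  assumes S: "const_mfun S" shows "cint (Y2 S \<cdot> u0 + v0 \<cdot> X2 S) = 0"
  \<comment> \<open>The free contributions \<open>r2 \<cdot> S \<cdot> p2\<close> cancel, so the
    current starts at order g. Again the terms with \<open>A\<close>, \<open>A'\<close>,
    \<open>B\<close>, \<open>B'\<close> and \<open>P \<cdot> S \<cdot> P\<close> come as Wronskians,
    and those beginning with \<open>r \<cdot> p\<close> compensate the local terms.\<close>
  by (rule cint_total_derivative[where E = "g *\<^sub>R (r1 \<cdot> S \<cdot> A \<cdot> p - r \<cdot> S \<cdot> A \<cdot> p1 + r1 \<cdot> A' \<cdot> S \<cdot> p - r \<cdot> A' \<cdot> S \<cdot> p1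
          - r1 \<cdot> P \<cdot> S \<cdot> p1 + r1 \<cdot> S \<cdot> P \<cdot> p1 + r \<cdot> p \<cdot> (r \<cdot> S \<cdot> p1 - r1 \<cdot> S \<cdot> p))
        + g\<^sup>2 *\<^sub>R (r \<cdot> S \<cdot> B \<cdot> p1 - r1 \<cdot> S \<cdot> B \<cdot> p + r \<cdot> B' \<cdot> S \<cdot> p1 - r1 \<cdot> B' \<cdot> S \<cdot> p
          + r1 \<cdot> P \<cdot> S \<cdot> P \<cdot> p - r \<cdot> P \<cdot> S \<cdot> P \<cdot> p1 + r \<cdot> p \<cdot> (r \<cdot> P \<cdot> S \<cdot> p - r \<cdot> S \<cdot> P \<cdot> p))"],
      (rule mderiv_linear mderiv_const_mult[OF S] mderiv_mult derivs P_derivs)+)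
     (use S in \<open>simp_all add: X2_def Y2_def u0_def[unfolded scaleR_two_mult] v0_def[unfolded scaleR_two_mult] power2_eq_square mmult_simps commutes
        scaleR_add_right scaleR_diff_right algebra_simps\<close>)

end

section \<open>Brackets of the abstract charges\<close>

locale charge_pair = field_pair n \<gamma> r r1 r2 p p1 p2 g for n \<gamma> and r :: "'a::super_banach_algebra mfun" and r1 r2 p p1 p2 g +
  fixes \<sigma> \<omega> :: "'a mfun" and d e :: nat
  assumes sconst [simp]: "const_mfun \<sigma>" "const_mfun \<omega>" and grades [simp]: "gr d \<sigma>" "gr e \<omega>"
begin

abbreviation sg :: real where "sg \<equiv> (-1) ^ (d * e)"

abbreviation supercomm_mfun :: "'a mfun" where "supercomm_mfun \<equiv> \<sigma> \<cdot> \<omega> - sg *\<^sub>R (\<omega> \<cdot> \<sigma>)"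

lemma bracket00: "cint (Y0 \<sigma> \<cdot> X0 \<omega>) - sg *\<^sub>R cint (Y0 \<omega> \<cdot> X0 \<sigma>) = abs_charge0 supercomm_mfun r p"
  by (simp add: X0_def Y0_def abs_charge0_def mmult_simps)

lemma left_fold:
  assumes S: "const_mfun S" and S': "const_mfun S'"
  shows "moI (S \<cdot> p \<cdot> r \<cdot> S') = S \<cdot> P \<cdot> S'" "moI (S \<cdot> p1 \<cdot> r \<cdot> S') = S \<cdot> A \<cdot> S'" "moI (S \<cdot> p \<cdot> r) = S \<cdot> P"
  using moI_mult_const(2)[OF S, of "p \<cdot> r \<cdot> S'"] moI_mult_const(2)[OF S, of "p1 \<cdot> r \<cdot> S'"]
    moI_mult_const(2)[OF S, of "p \<cdot> r"] S'
  by (simp_all add: moI_fold P_def[symmetric])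

lemma even_cycles:
  assumes S: "const_mfun S"
  shows "cint (r \<cdot> S \<cdot> P \<cdot> p) = - cint (r \<cdot> P \<cdot> S \<cdot> p)"
    "cint (r \<cdot> S \<cdot> A \<cdot> p) = - cint (r \<cdot> P \<cdot> S \<cdot> p1)"
    "cint (r \<cdot> A' \<cdot> S \<cdot> p) = - cint (r1 \<cdot> S \<cdot> P \<cdot> p)"
    "cint (r \<cdot> S \<cdot> B \<cdot> p) = - cint (r \<cdot> P \<cdot> S \<cdot> P \<cdot> p)"
    "cint (r \<cdot> B' \<cdot> S \<cdot> p) = - cint (r \<cdot> P \<cdot> S \<cdot> P \<cdot> p)"
  using cyclic_even[of "r \<cdot> S" p r p] cyclic_even[of "r \<cdot> S" p1 r p] cyclic_even[of "r1 \<cdot> S" p r p]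
    cyclic_even[of "r \<cdot> S" "P \<cdot> p" r p] cyclic_even[of "r \<cdot> P" "S \<cdot> p" r p] S
  by (simp_all add: mmult_assoc moI_fold left_fold flip: P_def A_def A'_def B_def B'_def)

text \<open>Each shift cuts the cyclic product into two scalars, one containing
  \<open>\<sigma>\<close> and the other \<open>\<omega>\<close>; exchanging them gives
  \<open>sg\<close>. The last identity has both scalars at the same point, so there is no sign
  kernel and no extra minus.\<close>

lemma graded_cycles:
  "cint (r \<cdot> \<sigma> \<cdot> P \<cdot> \<omega> \<cdot> p) = - (sg *\<^sub>R cint (r \<cdot> \<omega> \<cdot> P \<cdot> \<sigma> \<cdot> p))" (is ?T1)
  "cint (r \<cdot> \<sigma> \<cdot> P \<cdot> \<omega> \<cdot> p1) = - (sg *\<^sub>R cint (r \<cdot> \<omega> \<cdot> A \<cdot> \<sigma> \<cdot> p))" (is ?T2)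
  "cint (r \<cdot> \<sigma> \<cdot> A' \<cdot> \<omega> \<cdot> p) = - (sg *\<^sub>R cint (r1 \<cdot> \<omega> \<cdot> P \<cdot> \<sigma> \<cdot> p))" (is ?T3)
  "cint (r \<cdot> \<omega> \<cdot> B \<cdot> \<sigma> \<cdot> p) = - (sg *\<^sub>R cint (r \<cdot> \<sigma> \<cdot> P \<cdot> \<omega> \<cdot> P \<cdot> p))" (is ?T4)
  "cint (r \<cdot> \<sigma> \<cdot> B' \<cdot> \<omega> \<cdot> p) = - (sg *\<^sub>R cint (r \<cdot> P \<cdot> \<omega> \<cdot> P \<cdot> \<sigma> \<cdot> p))" (is ?T5)
  "cint (r \<cdot> \<sigma> \<cdot> p \<cdot> r \<cdot> \<omega> \<cdot> p) = sg *\<^sub>R cint (r \<cdot> \<omega> \<cdot> p \<cdot> r \<cdot> \<sigma> \<cdot> p)" (is ?T6)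
proof -
  note fold = mmult_assoc moI_fold left_fold mult.commute[of e d]
  show ?T1
    using cyclic_graded[of "r \<cdot> \<sigma>" p r "\<omega> \<cdot> p" d 0 0 e] by (simp add: fold flip: P_def)
  show ?T2
    using cyclic_graded[of "r \<cdot> \<sigma>" p r "\<omega> \<cdot> p1" d 0 0 e] by (simp add: fold flip: P_def)
  show ?T3
    using cyclic_graded[of "r \<cdot> \<sigma>" p r1 "\<omega> \<cdot> p" d 0 0 e] by (simp add: fold flip: A'_def)
  show ?T4
    using cyclic_graded[of "r \<cdot> \<omega>" "P \<cdot> p" r "\<sigma> \<cdot> p" e 0 0 d] by (simp add: fold flip: B_def)
  show ?T5
    using cyclic_graded[of "r \<cdot> \<sigma>" p "r \<cdot> P" "\<omega> \<cdot> p" d 0 0 e] by (simp add: fold flip: B'_def)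
  have "((r \<cdot> \<sigma>) x \<boxdot> p x) \<boxdot> (r \<cdot> \<omega>) x \<boxdot> p x = sg *\<^sub>R (((r \<cdot> \<omega>) x \<boxdot> p x) \<boxdot> (r \<cdot> \<sigma>) x \<boxdot> p x)" for x
    using corner_supercommute[of "r \<cdot> \<sigma>" p "r \<cdot> \<omega>" p d 0 e 0 x x x x] by simp
  then have "(r \<cdot> \<sigma> \<cdot> p) \<cdot> r \<cdot> \<omega> \<cdot> p = sg *\<^sub>R ((r \<cdot> \<omega> \<cdot> p) \<cdot> r \<cdot> \<sigma> \<cdot> p)"
    by (simp add: mmult_def mprod_assoc fun_eq_iff)
  then show ?T6
    by (simp add: mmult_assoc)
qed

lemma by_parts:
  assumes S: "const_mfun S"
  shows "cint (r1 \<cdot> S \<cdot> p) = - cint (r \<cdot> S \<cdot> p1)" (is ?T1)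
    "cint (r2 \<cdot> S \<cdot> p) = cint (r \<cdot> S \<cdot> p2)" (is ?T2) "cint (r1 \<cdot> S \<cdot> p1) = - cint (r \<cdot> S \<cdot> p2)" (is ?T3)
    "cint (r \<cdot> S \<cdot> p \<cdot> r \<cdot> p) = - cint (r1 \<cdot> S \<cdot> P \<cdot> p) - cint (r \<cdot> S \<cdot> P \<cdot> p1)" (is ?T4)
    "cint (r \<cdot> p \<cdot> r \<cdot> S \<cdot> p) = - cint (r1 \<cdot> P \<cdot> S \<cdot> p) - cint (r \<cdot> P \<cdot> S \<cdot> p1)" (is ?T5)
proof -
  note [simp] = mderiv_const_mult[OF S]
  show ?T1
    using cint_by_parts[of r r1 "S \<cdot> p" "S \<cdot> p1"] S by simp
  show 1: ?T3
    using cint_by_parts[of r r1 "S \<cdot> p1" "S \<cdot> p2"] S by simp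
  show ?T2
    using cint_by_parts[of r1 r2 "S \<cdot> p" "S \<cdot> p1"] S 1 by simp
  show ?T4
    using cint_by_parts[of r r1 "S \<cdot> P \<cdot> p" "S \<cdot> (p \<cdot> r \<cdot> p + P \<cdot> p1)"] S
      mderiv_const_mult[OF S mderiv_mult[OF P_derivs(1) derivs(3)]]
    by (simp add: mmult_simps)
  show ?T5
    using cint_by_parts[of "r \<cdot> P" "r1 \<cdot> P + r \<cdot> p \<cdot> r" "S \<cdot> p" "S \<cdot> p1"] S
    by (simp add: mderiv_mult mmult_simps) (simp add: eq_diff_eq eq_neg_iff_add_eq_0 add_ac)
qed

lemma by_parts_pair:
  "cint (r \<cdot> \<sigma> \<cdot> p \<cdot> r \<cdot> \<omega> \<cdot> p) = - cint (r1 \<cdot> \<sigma> \<cdot> P \<cdot> \<omega> \<cdot> p) - cint (r \<cdot> \<sigma> \<cdot> P \<cdot> \<omega> \<cdot> p1)"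
  using cint_by_parts[of r r1 "\<sigma> \<cdot> P \<cdot> \<omega> \<cdot> p" "\<sigma> \<cdot> ((p \<cdot> r) \<cdot> \<omega> \<cdot> p + P \<cdot> \<omega> \<cdot> p1)"]
    mderiv_const_mult[OF sconst(1) mderiv_mult[OF P_derivs(1) mderiv_const_mult[OF sconst(2) derivs(3)]]]
  by (simp add: mmult_simps)

lemma swapped: "charge_pair n \<gamma> r r1 r2 p p1 p2 \<omega> \<sigma> e d"
  by unfold_locales simp_all

lemma const_prods [simp]: "const_mfun (\<sigma> \<cdot> \<omega>)" "const_mfun (\<omega> \<cdot> \<sigma>)"
  by simp_all

text \<open>The two monomials with \<open>P\<close> between the matrices cancel by the graded cyclic
  rule. In the others \<open>\<sigma>\<close> and \<open>\<omega>\<close> are adjacent, and an even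
  shift with one integration by parts gives them the shape of the charge.\<close>

lemma bracket01: "cint (Y0 \<sigma> \<cdot> X1 \<omega>) - sg *\<^sub>R cint (Y1 \<omega> \<cdot> X0 \<sigma>) = abs_charge1 g supercomm_mfun r p p1"
  using even_cycles(1)[OF const_prods(2)] by_parts(1)[OF const_prods(2)] graded_cycles(1)
  by (simp add: X0_def X1_def Y0_def Y1_def abs_charge1_def mmult_simps flip: P_def) (simp add: algebra_simps)

lemma bracket02: "cint (Y0 \<sigma> \<cdot> X2 \<omega>) - sg *\<^sub>R cint (Y2 \<omega> \<cdot> X0 \<sigma>) = abs_charge2 g supercomm_mfun r r1 p p1 p2"
  using even_cycles[OF const_prods(2)] by_parts[OF const_prods(2)] by_parts(4)[OF const_prods(1)] graded_cycles
  by (simp add: X0_def X2_def Y0_def Y2_def abs_charge2_def mmult_simps flip: P_def A_def B_def) (simp add: algebra_simps)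

text \<open>One quarter of the integral with kernel \<open>S(x, y, t)\<close>, one summand for each of the three products
  of sign functions.\<close>

definition kernel_term :: "'a mfun \<Rightarrow> 'a mfun \<Rightarrow> 'a" where
  "kernel_term S S' = cint (r \<cdot> S \<cdot> moI (p \<cdot> r \<cdot> S' \<cdot> P) \<cdot> p) + cint (r \<cdot> S \<cdot> moI (P \<cdot> S' \<cdot> p \<cdot> r) \<cdot> p)
    - cint (r \<cdot> S \<cdot> P \<cdot> S' \<cdot> P \<cdot> p)"

text \<open>The shift of the first summand separates the two matrices and costs \<open>sg\<close>;
  the shift of the second keeps both in one scalar and costs nothing but the sign of the
  kernel.\<close>

lemma kernel_term_eq: "kernel_term \<sigma> \<omega> = - (sg *\<^sub>R cint (r \<cdot> \<omega> \<cdot> P \<cdot> P \<cdot> \<sigma> \<cdot> p))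
    - cint (r \<cdot> P \<cdot> \<sigma> \<cdot> P \<cdot> \<omega> \<cdot> p) - cint (r \<cdot> \<sigma> \<cdot> P \<cdot> \<omega> \<cdot> P \<cdot> p)"
proof -
  have "cint (r \<cdot> \<sigma> \<cdot> moI (p \<cdot> r \<cdot> \<omega> \<cdot> P) \<cdot> p) = - (sg *\<^sub>R cint (r \<cdot> \<omega> \<cdot> P \<cdot> P \<cdot> \<sigma> \<cdot> p))"
    using cyclic_graded[of "r \<cdot> \<sigma>" p "r \<cdot> \<omega> \<cdot> P" p d 0 e 0] by (simp add: mmult_assoc moI_fold)
  moreover have "cint (r \<cdot> \<sigma> \<cdot> moI (P \<cdot> \<omega> \<cdot> p \<cdot> r) \<cdot> p) = - cint (r \<cdot> P \<cdot> \<sigma> \<cdot> P \<cdot> \<omega> \<cdot> p)"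
    using cyclic_even[of "r \<cdot> \<sigma>" "P \<cdot> \<omega> \<cdot> p" r p] by (simp add: mmult_assoc moI_fold)
  ultimately show ?thesis by (simp add: kernel_term_def)
qed

text \<open>At order g^2 the product of \<open>Y1\<close> and \<open>X1\<close> has four monomials.
  The one with adjacent matrices, \<open>r \<cdot> P \<cdot> \<sigma> \<cdot> \<omega> \<cdot> P
  \<cdot> p\<close>, belongs to the charge. The three with a \<open>P\<close> between the matrices
  form the kernel terms, the one with \<open>\<sigma> \<cdot> P \<cdot> P \<cdot> \<omega>\<close>
  coming from \<open>kernel_term \<omega> \<sigma>\<close>.\<close>

lemma bracket11: "cint (Y1 \<sigma> \<cdot> X1 \<omega>) - sg *\<^sub>R cint (Y1 \<omega> \<cdot> X1 \<sigma>)
  = abs_charge2 g supercomm_mfun r r1 p p1 p2 - g\<^sup>2 *\<^sub>R (kernel_term \<sigma> \<omega> - sg *\<^sub>R kernel_term \<omega> \<sigma>)"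
proof -
  interpret sw: charge_pair n \<gamma> r r1 r2 p p1 p2 g \<omega> \<sigma> e d by (rule swapped)
  have k: "sg *\<^sub>R kernel_term \<omega> \<sigma> = - cint (r \<cdot> \<sigma> \<cdot> P \<cdot> P \<cdot> \<omega> \<cdot> p)
    - sg *\<^sub>R cint (r \<cdot> P \<cdot> \<omega> \<cdot> P \<cdot> \<sigma> \<cdot> p) - sg *\<^sub>R cint (r \<cdot> \<omega> \<cdot> P \<cdot> \<sigma> \<cdot> P \<cdot> p)"
    unfolding sw.kernel_term_eq by (simp add: scaleR_diff_right mult.commute[of e d])
  have bp: "cint (r1 \<cdot> \<sigma> \<cdot> P \<cdot> \<omega> \<cdot> p) = - cint (r \<cdot> \<sigma> \<cdot> P \<cdot> \<omega> \<cdot> p1) - sg *\<^sub>R cint (r \<cdot> \<omega> \<cdot> p \<cdot> r \<cdot> \<sigma> \<cdot> p)"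
    "cint (r1 \<cdot> \<omega> \<cdot> P \<cdot> \<sigma> \<cdot> p) = - cint (r \<cdot> \<omega> \<cdot> P \<cdot> \<sigma> \<cdot> p1) - cint (r \<cdot> \<omega> \<cdot> p \<cdot> r \<cdot> \<sigma> \<cdot> p)"
    unfolding graded_cycles(6)[symmetric] by (simp_all add: by_parts_pair sw.by_parts_pair)
  show ?thesis
    unfolding k kernel_term_eq
    using even_cycles[OF const_prods(2)] even_cycles[OF const_prods(1)] by_parts(3)[OF const_prods(2)] by_parts(3)[OF const_prods(1)]
    by (simp add: X1_def Y1_def abs_charge2_def mmult_simps bp power2_eq_square flip: P_def A_def B_def) (simp add: algebra_simps)
qed

end

section \<open>Rapidly decreasing functions\<close>

text \<open>A truncation of \<open>schwartz\<close> to finitely many derivatives; closure properties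
  follow by induction on the order through \<open>sch_Suc\<close>, generalised over the
  functions.\<close>

definition sch :: "nat \<Rightarrow> (real \<Rightarrow> 'a::real_normed_vector) \<Rightarrow> bool" where
  "sch n f \<longleftrightarrow> (\<forall>m\<le>n. (\<forall>x. (vderiv ^^ m) f differentiable (at x)) \<and>
     (\<forall>k. bounded (range (\<lambda>x. x ^ k *\<^sub>R (vderiv ^^ m) f x))))"

lemma schwartz_iff_sch: "schwartz f \<longleftrightarrow> (\<forall>n. sch n f)"
  unfolding schwartz_def sch_def by blast

lemma sch_0: "sch 0 f \<longleftrightarrow> (\<forall>x. f differentiable (at x)) \<and> (\<forall>k. bounded (range (\<lambda>x. x ^ k *\<^sub>R f x)))"
  by (simp add: sch_def)

lemma sch_mono: "sch n f \<Longrightarrow> m \<le> n \<Longrightarrow> sch m f"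
  by (simp add: sch_def)

lemma sch_Suc: "sch (Suc n) f \<longleftrightarrow> sch 0 f \<and> sch n (vderiv f)"
proof -
  have *: "(\<forall>m\<le>Suc n. Q ((vderiv ^^ m) f)) \<longleftrightarrow> Q f \<and> (\<forall>m\<le>n. Q ((vderiv ^^ m) (vderiv f)))" for Q
  proof -
    have "(vderiv ^^ m) (vderiv f) = (vderiv ^^ Suc m) f" for m by (simp add: funpow_swap1)
    then show ?thesis by (metis Suc_le_mono funpow_0 le0 not0_implies_Suc)
  qed
  show ?thesis
    unfolding sch_0 unfolding sch_def
    using *[of "\<lambda>f. (\<forall>x. f differentiable at x) \<and> (\<forall>k. bounded (range (\<lambda>x. x ^ k *\<^sub>R f x)))"] by blast
qed

lemma vderiv_works: "f differentiable (at x) \<Longrightarrow> (f has_vector_derivative vderiv f x) (at x)"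
  by (simp add: vderiv_def vector_derivative_works)

lemma vderiv_eqI: "(\<And>x. (f has_vector_derivative f' x) (at x)) \<Longrightarrow> vderiv f = f'"
  by (auto simp: vderiv_def vector_derivative_at)

lemma sch_vderiv: "sch n f \<Longrightarrow> (f has_vector_derivative vderiv f x) (at x)"
  using sch_mono[of n f 0] by (simp add: sch_0 vderiv_works)

lemma sch_0I:
  "(\<And>x. (f has_vector_derivative f' x) (at x)) \<Longrightarrow> (\<And>k. bounded (range (\<lambda>x. x ^ k *\<^sub>R f x))) \<Longrightarrow> sch 0 f"
  by (auto simp: sch_0 intro: differentiableI_vector)

lemma sch_add: "sch n f \<Longrightarrow> sch n g \<Longrightarrow> sch n (\<lambda>x. f x + g x)"
proof (induction n arbitrary: f g)
  case 0
  then show ?case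
    by (auto simp: sch_0 scaleR_add_right intro: bounded_plus_comp)
next
  case (Suc n)
  have "vderiv (\<lambda>x. f x + g x) = (\<lambda>x. vderiv f x + vderiv g x)"
    using Suc.prems by (intro vderiv_eqI has_vector_derivative_add sch_vderiv)
  moreover have "sch 0 (\<lambda>x. f x + g x)"
    using Suc.prems by (auto simp: sch_Suc sch_0 scaleR_add_right intro: bounded_plus_comp)
  ultimately show ?case using Suc by (simp add: sch_Suc)
qed

lemma sch_linear:
  assumes L: "bounded_linear L" shows "sch n f \<Longrightarrow> sch n (\<lambda>x. L (f x))"
proof -
  have base: "sch 0 (\<lambda>x. L (f x))" if f: "sch 0 f" for f
  proof (rule sch_0I)
    show "((\<lambda>x. L (f x)) has_vector_derivative L (vderiv f x)) (at x)" for x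
      by (intro bounded_linear.has_vector_derivative[OF L] sch_vderiv[OF f])
    have e: "(\<lambda>x. x ^ k *\<^sub>R L (f x)) = (\<lambda>x. L (x ^ k *\<^sub>R f x))" for k
      by (simp add: linear_simps[OF L])
    show "bounded (range (\<lambda>x. x ^ k *\<^sub>R L (f x)))" for k
      unfolding e using bounded_linear_image[OF _ L, of "range (\<lambda>x. x ^ k *\<^sub>R f x)"] f
      by (simp add: sch_0 image_image)
  qed
  show "sch n f \<Longrightarrow> sch n (\<lambda>x. L (f x))"
  proof (induction n arbitrary: f)
    case 0 then show ?case by (rule base)
  next
    case (Suc n)
    have "vderiv (\<lambda>x. L (f x)) = (\<lambda>x. L (vderiv f x))"
      using Suc.prems by (intro vderiv_eqI bounded_linear.has_vector_derivative[OF L] sch_vderiv)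
    with Suc base show ?case by (simp add: sch_Suc)
  qed
qed

lemma sch_mult: "sch n f \<Longrightarrow> sch n g \<Longrightarrow> sch n (\<lambda>x. f x * g x)"
  for f g :: "real \<Rightarrow> 'a::real_normed_algebra"
proof -
  have base: "sch 0 (\<lambda>x. f x * g x)" if f: "sch 0 f" and g: "sch 0 g" for f g :: "real \<Rightarrow> 'a"
  proof (rule sch_0I)
    show "((\<lambda>x. f x * g x) has_vector_derivative f x * vderiv g x + vderiv f x * g x) (at x)" for x
      by (intro has_vector_derivative_mult sch_vderiv[OF f] sch_vderiv[OF g])
    fix k
    have "bounded (range (\<lambda>x. x ^ k *\<^sub>R f x))" "bounded (range g)"
      using f g unfolding sch_0 by (auto dest: spec[of _ 0] simp: scaleR_one)
    then obtain A B where AB: "\<And>x. norm (x ^ k *\<^sub>R f x) \<le> A" "\<And>x. norm (g x) \<le> B"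
      unfolding bounded_iff by blast
    show "bounded (range (\<lambda>x. x ^ k *\<^sub>R (f x * g x)))"
      unfolding bounded_iff
    proof (intro exI ballI, elim rangeE)
      fix y x assume y: "y = x ^ k *\<^sub>R (f x * g x)"
      have "norm ((x ^ k *\<^sub>R f x) * g x) \<le> A * B"
        by (rule order_trans[OF norm_mult_ineq mult_mono[OF AB]]) (use order_trans[OF norm_ge_zero AB(1)] in auto)
      then show "norm y \<le> A * B" unfolding y by simp
    qed
  qed
  show "sch n f \<Longrightarrow> sch n g \<Longrightarrow> sch n (\<lambda>x. f x * g x)"
  proof (induction n arbitrary: f g)
    case 0 then show ?case by (rule base)
  next
    case (Suc n)
    have "vderiv (\<lambda>x. f x * g x) = (\<lambda>x. f x * vderiv g x + vderiv f x * g x)"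
      using Suc.prems by (intro vderiv_eqI has_vector_derivative_mult sch_vderiv)
    moreover have "sch n (\<lambda>x. f x * vderiv g x)" "sch n (\<lambda>x. vderiv f x * g x)"
      using Suc.prems sch_mono[of "Suc n" f n] sch_mono[of "Suc n" g n] by (auto intro!: Suc.IH simp: sch_Suc)
    ultimately show ?case using Suc.prems base by (simp add: sch_Suc sch_add)
  qed
qed

lemma schwartz_add: "schwartz f \<Longrightarrow> schwartz g \<Longrightarrow> schwartz (\<lambda>x. f x + g x)"
  and schwartz_linear: "bounded_linear L \<Longrightarrow> schwartz f \<Longrightarrow> schwartz (\<lambda>x. L (f x))"
  by (auto simp: schwartz_iff_sch sch_add sch_linear)

lemma schwartz_mult: "schwartz f \<Longrightarrow> schwartz g \<Longrightarrow> schwartz (\<lambda>x. f x * g x)"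
  for f g :: "real \<Rightarrow> 'a::real_normed_algebra"
  by (auto simp: schwartz_iff_sch sch_mult)

lemma schwartz_zero: "schwartz (\<lambda>x. 0)"
proof -
  have z: "(vderiv ^^ n) (\<lambda>x. 0 :: 'a) = (\<lambda>x. 0)" for n
    by (induction n) (auto intro!: vderiv_eqI)
  show ?thesis by (simp add: schwartz_def z image_constant_conv)
qed

lemma schwartz_sum: "(\<And>i. i \<in> I \<Longrightarrow> schwartz (f i)) \<Longrightarrow> schwartz (\<lambda>x. \<Sum>i\<in>I. f i x)"
  by (induction I rule: infinite_finite_induct) (auto intro: schwartz_add schwartz_zero)

lemma schwartz_vderiv: "schwartz f \<Longrightarrow> schwartz (vderiv f)"
  unfolding schwartz_iff_sch using sch_Suc by blast

lemma schwartz_funpow: "schwartz f \<Longrightarrow> schwartz ((vderiv ^^ n) f)"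
  by (induction n) (auto intro: schwartz_vderiv)

lemma schwartz_derivative: "schwartz f \<Longrightarrow> (f has_vector_derivative vderiv f x) (at x)"
  unfolding schwartz_iff_sch using sch_vderiv by blast

lemma schwartz_dec: assumes "schwartz f" shows "dec f"
proof -
  have "sch 0 f" using assms by (simp add: schwartz_iff_sch)
  then have "bounded (range (\<lambda>x. x ^ 0 *\<^sub>R f x))" "bounded (range (\<lambda>x. x ^ 2 *\<^sub>R f x))"
    unfolding sch_0 by blast+
  then have "bounded (range (\<lambda>x. (1 + x\<^sup>2) *\<^sub>R f x))"
    using bounded_plus_comp[of f UNIV "\<lambda>x. x\<^sup>2 *\<^sub>R f x"] by (simp add: scaleR_add_left)
  moreover have "continuous_on UNIV f"
    by (rule has_vector_derivative_continuous_on_UNIV[OF schwartz_derivative[OF assms]])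
  ultimately show ?thesis
    unfolding dec_def bnd_def by (auto intro!: continuous_intros)
qed

lemma vderiv_add: "schwartz f \<Longrightarrow> schwartz g \<Longrightarrow> vderiv (\<lambda>x. f x + g x) = (\<lambda>x. vderiv f x + vderiv g x)"
  by (intro vderiv_eqI has_vector_derivative_add schwartz_derivative)

lemma vderiv_scaleR: "schwartz f \<Longrightarrow> vderiv (\<lambda>x. c *\<^sub>R f x) = (\<lambda>x. c *\<^sub>R vderiv f x)"
  by (intro vderiv_eqI bounded_linear.has_vector_derivative[OF bounded_linear_scaleR_right] schwartz_derivative)

lemma schwartz_scaleR: "schwartz f \<Longrightarrow> schwartz (\<lambda>x. c *\<^sub>R f x)"
  by (rule schwartz_linear[OF bounded_linear_scaleR_right])

lemma funpow_vderiv_linear: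
  assumes "schwartz f" "schwartz g"
  shows "(vderiv ^^ n) (\<lambda>x. f x + g x) = (\<lambda>x. (vderiv ^^ n) f x + (vderiv ^^ n) g x)"
    and "(vderiv ^^ n) (\<lambda>x. c *\<^sub>R f x) = (\<lambda>x. c *\<^sub>R (vderiv ^^ n) f x)"
  by (induction n) (use assms in \<open>simp_all add: vderiv_add vderiv_scaleR schwartz_funpow\<close>)

lemma funpow_vderiv_quotient:
  assumes "schwartz f" "schwartz g" "schwartz v"
  shows "(vderiv ^^ n) (\<lambda>y. c *\<^sub>R (f y - g y) - v y) x
    = c *\<^sub>R ((vderiv ^^ n) f x - (vderiv ^^ n) g x) - (vderiv ^^ n) v x"
proof -
  have "(\<lambda>y. c *\<^sub>R (f y - g y) - v y) = (\<lambda>y. c *\<^sub>R (f y + (-1) *\<^sub>R g y) + (-1) *\<^sub>R v y)" by simp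
  then have "(vderiv ^^ n) (\<lambda>y. c *\<^sub>R (f y - g y) - v y) x =
    c *\<^sub>R ((vderiv ^^ n) f x + (-1) *\<^sub>R (vderiv ^^ n) g x) + (-1) *\<^sub>R (vderiv ^^ n) v x"
    using assms by (simp only: funpow_vderiv_linear schwartz_add schwartz_scaleR)
  then show ?thesis by simp
qed

section \<open>Gaussians as test functions\<close>

lemma power_le_fact_exp: "(z::real) \<ge> 0 \<Longrightarrow> z ^ i \<le> fact i * exp z"
proof -
  assume z: "z \<ge> 0"
  have "(\<Sum>n\<in>{i}. z ^ n /\<^sub>R fact n) \<le> exp z"
    unfolding exp_def by (rule sum_le_suminf[OF summable_exp_generic]) (use z in auto)
  then show ?thesis by (simp add: field_simps)
qed

text \<open>The estimate of an absolute value by 1 plus its square reduces all powers to even ones,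
  and these are powers of c y^2, dominated by the exponential.\<close>

lemma gaussian_poly_bounded:
  fixes c :: real assumes c: "c > 0"
  shows "bounded (range (\<lambda>y. poly q y * exp (- c * y\<^sup>2)))"
proof -
  have "bounded (range (\<lambda>y. y ^ i * exp (- c * y\<^sup>2)))" for i
    unfolding bounded_iff
  proof (intro exI ballI, elim rangeE)
    fix z y :: real assume z: "z = y ^ i * exp (- c * y\<^sup>2)"
    have "(c * y\<^sup>2) ^ i \<le> fact i * exp (c * y\<^sup>2)" using c by (intro power_le_fact_exp) simp
    then have "(y ^ i)\<^sup>2 * exp (- c * y\<^sup>2) \<le> fact i / c ^ i"
      using c by (simp add: power_mult_distrib exp_minus field_simps flip: power_mult)
    moreover have "\<bar>y ^ i\<bar> \<le> 1 + (y ^ i)\<^sup>2"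
      using sum_power2_ge_zero[of "\<bar>y ^ i\<bar> - 1/2" 0] by (simp add: power2_eq_square algebra_simps)
    then have "\<bar>y ^ i\<bar> * exp (- c * y\<^sup>2) \<le> (1 + (y ^ i)\<^sup>2) * exp (- c * y\<^sup>2)" by (intro mult_right_mono) auto
    moreover have "exp (- c * y\<^sup>2) \<le> 1" using c by simp
    ultimately have "\<bar>y ^ i\<bar> * exp (- c * y\<^sup>2) \<le> 1 + fact i / c ^ i" unfolding distrib_right by linarith
    then show "norm z \<le> 1 + fact i / c ^ i" unfolding z by (simp add: abs_mult)
  qed
  then have "bounded (range (\<lambda>y. coeff q i *\<^sub>R (y ^ i * exp (- c * y\<^sup>2))))" for i
    by (rule bounded_scaleR_comp)
  then have "bounded (range (\<lambda>y. \<Sum>i\<in>I. coeff q i *\<^sub>R (y ^ i * exp (- c * y\<^sup>2))))" for I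
    by (induction I rule: infinite_finite_induct) (auto intro: bounded_plus_comp simp: image_constant_conv)
  then show ?thesis by (simp add: poly_altdef sum_distrib_right mult.assoc)
qed

lemma schwartz_gaussian:
  fixes \<theta> :: "'a::real_normed_vector" and c :: real
  assumes c: "c > 0"
  shows "schwartz (\<lambda>x. exp (- c * (x - a)\<^sup>2) *\<^sub>R \<theta>)"
proof -
  \<comment> \<open>Polynomials times the Gaussian are closed under differentiation:
    \<open>q\<close> becomes its derivative minus 2 c y times \<open>q\<close>. The induction
    therefore runs over all \<open>q\<close>.\<close>
  have D: "((\<lambda>x. (poly q (x - a) * exp (- c * (x - a)\<^sup>2)) *\<^sub>R \<theta>) has_vector_derivative
      ((poly (pderiv q - [:0, 2 * c:] * q) (x - a) * exp (- c * (x - a)\<^sup>2)) *\<^sub>R \<theta>)) (at x)" for q x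
  proof -
    have "((\<lambda>x. poly q (x - a) * exp (- c * (x - a)\<^sup>2)) has_real_derivative
      poly (pderiv q) (x - a) * exp (- c * (x - a)\<^sup>2) + poly q (x - a) * (exp (- c * (x - a)\<^sup>2) * (- c * (2 * (x - a))))) (at x)"
      by (auto intro!: derivative_eq_intros DERIV_chain'[where g = "poly q"] simp: algebra_simps)
    from has_vector_derivative_scaleR[OF this has_vector_derivative_const[of \<theta>]]
    show ?thesis by (simp add: algebra_simps)
  qed
  have "sch n (\<lambda>x. (poly q (x - a) * exp (- c * (x - a)\<^sup>2)) *\<^sub>R \<theta>)" for n q
  proof (induction n arbitrary: q)
    have base: "sch 0 (\<lambda>x. (poly q (x - a) * exp (- c * (x - a)\<^sup>2)) *\<^sub>R \<theta>)" for q
    proof (rule sch_0I[OF D])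
      fix k
      \<comment> \<open>With y = x - a, the power of x is absorbed into the polynomial, as
        \<open>[:a, 1:]\<close> takes the value x at y.\<close>
      have "bounded (range (\<lambda>y. poly ([:a, 1:] ^ k * q) y * exp (- c * y\<^sup>2)))"
        by (rule gaussian_poly_bounded[OF c])
      then obtain C where C: "\<And>y. norm (poly ([:a, 1:] ^ k * q) y * exp (- c * y\<^sup>2)) \<le> C"
        unfolding bounded_iff by blast
      have "norm (x ^ k *\<^sub>R (poly q (x - a) * exp (- c * (x - a)\<^sup>2)) *\<^sub>R \<theta>) \<le> C * norm \<theta>" for x
        using mult_right_mono[OF C[of "x - a"] norm_ge_zero[of \<theta>]] by (simp add: mult.assoc abs_mult)
      then show "bounded (range (\<lambda>x. x ^ k *\<^sub>R (poly q (x - a) * exp (- c * (x - a)\<^sup>2)) *\<^sub>R \<theta>))"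
        unfolding bounded_iff by blast
    qed
    case 0 show ?case by (rule base)
    case (Suc n)
    show ?case unfolding sch_Suc vderiv_eqI[OF D] using base Suc by blast
  qed
  from this[of _ 1] show ?thesis by (simp add: schwartz_iff_sch)
qed

section \<open>Uniqueness of functional derivatives\<close>

text \<open>Concentration of the Gaussians at \<open>a\<close>, rescaled so that the weight is at
  least 1 on an interval of radius \<open>\<delta>\<close>. There \<open>E\<close> differs from
  \<open>E a\<close> by at most half of its norm, so the inner integral has norm at least
  \<open>norm (E a) * \<delta>\<close>. The outer integral is its negative and tends to 0. As
  \<open>E\<close> may be unbounded, the dominating function is the integrand with n = 0.\<close>

lemma gaussian_test:
  fixes E :: "real \<Rightarrow> 'a::{banach, second_countable_topology}"
  assumes cont: "continuous_on UNIV E"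
    and int: "\<And>n. integrable lborel (\<lambda>x. exp (- real (Suc n) * (x - a)\<^sup>2) *\<^sub>R E x)"
    and zero: "\<And>n. (\<integral>x. exp (- real (Suc n) * (x - a)\<^sup>2) *\<^sub>R E x \<partial>lborel) = 0"
  shows "E a = 0"
proof (rule ccontr)
  assume nz: "E a \<noteq> 0"
  have [measurable]: "E \<in> borel_measurable borel" using cont by (rule borel_measurable_continuous_onI)
  have "isCont E a" using cont by (simp add: continuous_on_eq_continuous_at)
  then obtain d where d: "d > 0" "\<And>y. \<bar>y - a\<bar> < d \<Longrightarrow> norm (E y - E a) < norm (E a) / 2"
    unfolding continuous_at_eps_delta using nz by (metis half_gt_zero_iff zero_less_norm_iff dist_norm real_norm_def)
  define \<delta> where "\<delta> = d / 2"
  have \<delta>: "\<delta> > 0" "\<And>y. \<bar>y - a\<bar> \<le> \<delta> \<Longrightarrow> norm (E y - E a) \<le> norm (E a) / 2"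
    using d by (auto simp: \<delta>_def intro: less_imp_le)
  define I where "I = {a - \<delta>..a + \<delta>}"
  have I: "y \<in> I \<longleftrightarrow> \<bar>y - a\<bar> \<le> \<delta>" for y unfolding I_def by auto
  have [measurable]: "I \<in> sets borel" by (simp add: I_def)
  \<comment> \<open>normalised so as to be at least 1 inside \<open>I\<close> and to tend to 0 outside\<close>
  define w where "w n y = exp (real (Suc n) * (\<delta>\<^sup>2 - (y - a)\<^sup>2))" for n y
  have w_eq: "w n y = exp (real (Suc n) * \<delta>\<^sup>2) * exp (- real (Suc n) * (y - a)\<^sup>2)" for n y
    by (simp add: w_def flip: exp_add) (simp add: algebra_simps)
  have [measurable]: "w n \<in> borel_measurable borel" for n unfolding w_def by measurable
  have wE: "integrable lborel (\<lambda>y. w n y *\<^sub>R E y)" and wE0: "(\<integral>y. w n y *\<^sub>R E y \<partial>lborel) = 0" for n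
  proof -
    have *: "(\<lambda>y. w n y *\<^sub>R E y) = (\<lambda>y. exp (real (Suc n) * \<delta>\<^sup>2) *\<^sub>R (exp (- real (Suc n) * (y - a)\<^sup>2) *\<^sub>R E y))"
      by (simp add: w_eq)
    show "integrable lborel (\<lambda>y. w n y *\<^sub>R E y)"
      unfolding * by (intro integrable_scaleR_right int)
    show "(\<integral>y. w n y *\<^sub>R E y \<partial>lborel) = 0"
      unfolding * integral_scaleR_right zero by simp
  qed
  have in_int: "integrable lborel (\<lambda>y. indicator I y *\<^sub>R (w n y *\<^sub>R E y))"
    and out_int: "integrable lborel (\<lambda>y. indicator (- I) y *\<^sub>R (w n y *\<^sub>R E y))" for n
    by (intro kernel_integrable wE; auto simp: indicator_def)+
  have split: "(\<integral>y. indicator I y *\<^sub>R (w n y *\<^sub>R E y) \<partial>lborel) = - (\<integral>y. indicator (- I) y *\<^sub>R (w n y *\<^sub>R E y) \<partial>lborel)" for n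
  proof -
    have "(\<lambda>y. w n y *\<^sub>R E y) = (\<lambda>y. indicator I y *\<^sub>R (w n y *\<^sub>R E y) + indicator (- I) y *\<^sub>R (w n y *\<^sub>R E y))"
      by (auto simp: indicator_def fun_eq_iff)
    then have "0 = (\<integral>y. indicator I y *\<^sub>R (w n y *\<^sub>R E y) + indicator (- I) y *\<^sub>R (w n y *\<^sub>R E y) \<partial>lborel)"
      using wE0[of n] by simp
    also have "\<dots> = (\<integral>y. indicator I y *\<^sub>R (w n y *\<^sub>R E y) \<partial>lborel) + (\<integral>y. indicator (- I) y *\<^sub>R (w n y *\<^sub>R E y) \<partial>lborel)"
      by (rule Bochner_Integration.integral_add[OF in_int out_int])
    finally show ?thesis by (simp add: eq_neg_iff_add_eq_0)
  qed
  have "(\<lambda>n. \<integral>y. indicator (- I) y *\<^sub>R (w n y *\<^sub>R E y) \<partial>lborel) \<longlonglongrightarrow> (\<integral>y. 0 \<partial>(lborel :: real measure))"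
  proof (rule integral_dominated_convergence)
    show "integrable lborel (\<lambda>y. norm (w 0 y *\<^sub>R E y))" using wE by (rule integrable_norm)
    have neg: "\<delta>\<^sup>2 - (y - a)\<^sup>2 < 0" if "y \<notin> I" for y
      using that \<delta>(1) abs_le_square_iff[of "y - a" \<delta>] by (simp add: I not_le)
    show "AE y in lborel. (\<lambda>n. indicator (- I) y *\<^sub>R (w n y *\<^sub>R E y)) \<longlonglongrightarrow> 0"
    proof (rule AE_I2)
      fix y
      show "(\<lambda>n. indicator (- I) y *\<^sub>R (w n y *\<^sub>R E y)) \<longlonglongrightarrow> 0"
      proof (cases "y \<in> I")
        case False
        have "(\<lambda>n. exp (\<delta>\<^sup>2 - (y - a)\<^sup>2) ^ Suc n) \<longlonglongrightarrow> 0"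
          using neg[OF False] by (intro LIMSEQ_Suc LIMSEQ_power_zero) simp
        then have "(\<lambda>n. w n y) \<longlonglongrightarrow> 0" unfolding w_def exp_of_nat_mult .
        from tendsto_scaleR[OF this tendsto_const[of "E y"]] show ?thesis using False by simp
      qed simp
    qed
    show "AE y in lborel. norm (indicator (- I) y *\<^sub>R (w n y *\<^sub>R E y)) \<le> norm (w 0 y *\<^sub>R E y)" for n
    proof (rule AE_I2)
      fix y
      show "norm (indicator (- I) y *\<^sub>R (w n y *\<^sub>R E y)) \<le> norm (w 0 y *\<^sub>R E y)"
      proof (cases "y \<in> I")
        case False
        have "real n * (\<delta>\<^sup>2 - (y - a)\<^sup>2) \<le> 0" using neg[OF False] by (simp add: mult_nonneg_nonpos)
        then have "w n y \<le> w 0 y" by (simp add: w_def algebra_simps)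
        moreover have "w n y \<ge> 0" by (simp add: w_def)
        ultimately show ?thesis using False by (simp add: mult_right_mono)
      qed simp
    qed
  qed measurable
  then have lim: "(\<lambda>n. norm (\<integral>y. indicator I y *\<^sub>R (w n y *\<^sub>R E y) \<partial>lborel)) \<longlonglongrightarrow> 0"
    unfolding split by (simp add: tendsto_norm_zero)
  have "norm (\<integral>y. indicator I y *\<^sub>R (w n y *\<^sub>R E y) \<partial>lborel) \<ge> norm (E a) * \<delta>" for n
  proof -
    have wI: "integrable lborel (\<lambda>y. indicator I y *\<^sub>R w n y)"
      unfolding I_def by (rule borel_integrable_compact) (auto simp: w_def intro!: continuous_intros)
    define W where "W = (\<integral>y. indicator I y *\<^sub>R w n y \<partial>lborel)"
    have "(\<integral>y. indicator I y \<partial>lborel) \<le> W" unfolding W_def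
    proof (rule integral_mono[OF _ wI])
      show "integrable lborel (indicator I :: real \<Rightarrow> real)"
        using \<delta>(1) by (auto simp: I_def intro!: integrable_real_indicator)
      fix y
      have "\<delta>\<^sup>2 - (y - a)\<^sup>2 \<ge> 0" if "y \<in> I"
        using that abs_le_square_iff[of "y - a" \<delta>] \<delta>(1) by (simp add: I)
      then show "indicator I y \<le> indicator I y *\<^sub>R w n y"
        by (auto simp: indicator_def w_def)
    qed
    then have W: "2 * \<delta> \<le> W" using \<delta>(1) by (simp add: I_def)
    have i1: "integrable lborel (\<lambda>y. indicator I y *\<^sub>R (w n y *\<^sub>R E a))"
      using integrable_scaleR_left[of "E a", OF wI] by simp
    have i2: "integrable lborel (\<lambda>y. indicator I y *\<^sub>R (w n y *\<^sub>R (E y - E a)))"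
      using Bochner_Integration.integrable_diff[OF in_int[of n] i1] by (simp add: scaleR_diff_right)
    have "(\<integral>y. indicator I y *\<^sub>R (w n y *\<^sub>R E y) \<partial>lborel)
      = (\<integral>y. indicator I y *\<^sub>R (w n y *\<^sub>R E a) \<partial>lborel) + (\<integral>y. indicator I y *\<^sub>R (w n y *\<^sub>R (E y - E a)) \<partial>lborel)"
      unfolding Bochner_Integration.integral_add[OF i1 i2, symmetric] by (simp add: scaleR_diff_right)
    moreover have "(\<integral>y. indicator I y *\<^sub>R (w n y *\<^sub>R E a) \<partial>lborel) = W *\<^sub>R E a"
      using integral_scaleR_left[of "E a", OF wI] by (simp add: W_def)
    moreover have "norm (\<integral>y. indicator I y *\<^sub>R (w n y *\<^sub>R (E y - E a)) \<partial>lborel) \<le> W * (norm (E a) / 2)"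
    proof -
      have "norm (\<integral>y. indicator I y *\<^sub>R (w n y *\<^sub>R (E y - E a)) \<partial>lborel)
        \<le> (\<integral>y. (indicator I y *\<^sub>R w n y) * (norm (E a) / 2) \<partial>lborel)"
      proof (rule order_trans[OF integral_norm_bound integral_mono])
        show "integrable lborel (\<lambda>y. norm (indicator I y *\<^sub>R (w n y *\<^sub>R (E y - E a))))" using i2 by (rule integrable_norm)
        show "integrable lborel (\<lambda>y. (indicator I y *\<^sub>R w n y) * (norm (E a) / 2))" using wI by (intro integrable_mult_left)
        show "norm (indicator I y *\<^sub>R (w n y *\<^sub>R (E y - E a))) \<le> (indicator I y *\<^sub>R w n y) * (norm (E a) / 2)" for y
          using \<delta>(2)[of y] by (auto simp: indicator_def I w_def)
      qed
      also have "\<dots> = W * (norm (E a) / 2)" unfolding W_def using wI by (intro Bochner_Integration.integral_mult_left)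
      finally show ?thesis .
    qed
    moreover have "norm (W *\<^sub>R E a) = W * norm (E a)" using W \<delta>(1) by simp
    ultimately have "norm (\<integral>y. indicator I y *\<^sub>R (w n y *\<^sub>R E y) \<partial>lborel) \<ge> W * norm (E a) - W * (norm (E a) / 2)"
      by (smt (verit) norm_diff_ineq)
    moreover have "W * norm (E a) - W * (norm (E a) / 2) \<ge> norm (E a) * \<delta>"
      using mult_right_mono[OF W norm_ge_zero[of "E a"]] by (simp add: algebra_simps)
    ultimately show ?thesis by linarith
  qed
  from LIMSEQ_le_const[OF lim] this have "norm (E a) * \<delta> \<le> 0" by blast
  then show False using nz \<delta>(1) by (simp add: mult_le_0_iff)
qed

lemma parity_one: "parity (1 :: 'a::super_banach_algebra) = 1"
  by (metis mult.right_neutral mult_1 parity_mult parity_parity)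

text \<open>Testing with a Gaussian times a constant \<open>\<theta>\<close> of the grade of the
  field shows that \<open>\<theta>\<close> annihilates the difference of the derivatives. For an
  even field take \<open>\<theta> = 1\<close>; for an odd one let \<open>\<theta>\<close> run
  through the odd part and use faithfulness.\<close>

lemma has_functional_derivative_unique:
  fixes D1 D2 :: "real \<Rightarrow> 'a::super_banach_algebra"
  assumes faithful: "grade M l \<noteq> 0 \<Longrightarrow> (\<forall>a::'a. (\<forall>\<theta>\<in>graded 1. \<theta> * a = 0) \<longrightarrow> a = 0)"
    and D: "has_functional_derivative M F \<phi> l D1" "has_functional_derivative M F \<phi> l D2"
  shows "D1 = D2"
proof
  fix a
  have "\<theta> * (D1 a - D2 a) = 0" if \<theta>: "\<theta> \<in> graded (grade M l)" for \<theta>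
  proof -
    have c: "continuous_on UNIV D1" "continuous_on UNIV D2" using D by (auto simp: has_functional_derivative_def)
    have *: "integrable lborel (\<lambda>x. exp (- real (Suc n) * (x - a)\<^sup>2) *\<^sub>R (\<theta> * (D1 x - D2 x))) \<and>
      (\<integral>x. exp (- real (Suc n) * (x - a)\<^sup>2) *\<^sub>R (\<theta> * (D1 x - D2 x)) \<partial>lborel) = 0" for n
    proof -
      define h where "h x = exp (- real (Suc n) * (x - a)\<^sup>2) *\<^sub>R \<theta>" for x
      have "schwartz h" unfolding h_def by (rule schwartz_gaussian) simp
      moreover have "h x \<in> graded (grade M l)" for x unfolding h_def by (rule graded_scaleR[OF \<theta>])
      ultimately have h: "integrable lborel (\<lambda>x. h x * D1 x)" "integrable lborel (\<lambda>x. h x * D2 x)"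
        "(\<integral>x. h x * D1 x \<partial>lborel) = (\<integral>x. h x * D2 x \<partial>lborel)"
        using D unfolding has_functional_derivative_def by (blast, blast, blast intro: vector_derivative_unique_at)
      have e: "(\<lambda>x. exp (- real (Suc n) * (x - a)\<^sup>2) *\<^sub>R (\<theta> * (D1 x - D2 x))) = (\<lambda>x. h x * D1 x - h x * D2 x)"
        by (simp add: h_def algebra_simps)
      show ?thesis unfolding e using h by simp
    qed
    have "continuous_on UNIV (\<lambda>x. \<theta> * (D1 x - D2 x))" by (intro continuous_intros c)
    from gaussian_test[OF this] show ?thesis using * by blast
  qed
  moreover have "(1 :: 'a) \<in> graded 0" by (simp add: graded_def parity_one)
  ultimately have "D1 a - D2 a = 0"
    using faithful by (cases "grade M l = 0") (fastforce, metis grade_def)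
  then show "D1 a = D2 a" by simp
qed

lemma functional_derivative_eq:
  fixes D :: "real \<Rightarrow> 'a::super_banach_algebra"
  assumes "grade M l \<noteq> 0 \<Longrightarrow> (\<forall>a::'a. (\<forall>\<theta>\<in>graded 1. \<theta> * a = 0) \<longrightarrow> a = 0)"
    and "has_functional_derivative M F \<phi> l D"
  shows "functional_derivative M F \<phi> l = D"
  unfolding functional_derivative_def
  by (rule the_equality[of "has_functional_derivative M F \<phi> l" D, OF assms(2)])
     (rule has_functional_derivative_unique[OF assms(1) _ assms(2)])

section \<open>Fields as matrix-valued functions\<close>

text \<open>Index 0 is an auxiliary even index: the fields \<open>\<psi>\<close> form a row, the fields \<open>\<phi>\<close> a column of
  a square matrix of size \<open>M + N + 1\<close>, so that all products are matrix products.\<close>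

definition ext_grade :: "nat \<Rightarrow> nat \<Rightarrow> nat" where
  "ext_grade M i = (case i of 0 \<Rightarrow> 0 | Suc j \<Rightarrow> grade M j)"

lemma ext_grade_simps [simp]: "ext_grade M 0 = 0" "ext_grade M (Suc j) = grade M j"
  by (simp_all add: ext_grade_def)

lemma grade_le_1: "grade M l \<le> 1"
  by (simp add: grade_def)

lemma dx_component: "dx \<phi> j = vderiv (\<phi> j)"
  by (simp add: dx_def)

lemma graded_derivative:
  fixes f :: "real \<Rightarrow> 'a::super_banach_algebra"
  assumes "(f has_vector_derivative f') (at x)" "\<And>x. f x \<in> graded p"
  shows "f' \<in> graded p"
proof -
  have "((\<lambda>x. parity (f x)) has_vector_derivative parity f') (at x)"
    by (rule bounded_linear.has_vector_derivative[OF bounded_linear_parity assms(1)])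
  moreover have "(\<lambda>x. parity (f x)) = (\<lambda>x. (-1) ^ p *\<^sub>R f x)"
    using assms(2) by (simp add: graded_def)
  moreover have "((\<lambda>x. (-1) ^ p *\<^sub>R f x) has_vector_derivative (-1) ^ p *\<^sub>R f') (at x)"
    by (rule bounded_linear.has_vector_derivative[OF bounded_linear_scaleR_right assms(1)])
  ultimately show ?thesis
    unfolding graded_def using vector_derivative_unique_at by fastforce
qed

section \<open>Complex scalars in the algebra\<close>

lemma im_unit_even: "im_unit \<in> graded 0"
  by (simp add: graded_def parity_im_unit)

lemma im_unit_central: "a * im_unit = im_unit * a" for a :: "'a::super_banach_algebra"
  using even_central[OF im_unit_even] by metis

lemma im_unit_left_comm: "a * (im_unit * b) = im_unit * (a * b)" for a :: "'a::super_banach_algebra"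
  by (metis im_unit_central mult.assoc)

lemma cscale_unit_mult: "a * ((c *\<^sub>C 1) * b) = c *\<^sub>C (a * b)" for a b :: "'a::super_banach_algebra"
  by (simp add: cscale_def algebra_simps im_unit_left_comm)

lemma cscale_mult_unit: "(c *\<^sub>C 1) * (d *\<^sub>C 1) = (c * d) *\<^sub>C (1 :: 'a::super_banach_algebra)"
proof -
  have "(c *\<^sub>C 1) * (d *\<^sub>C 1) = (Re c * Re d) *\<^sub>R (1::'a) + (Re c * Im d) *\<^sub>R im_unit
      + (Im c * Re d) *\<^sub>R im_unit + (Im c * Im d) *\<^sub>R (im_unit * im_unit)"
    by (simp add: cscale_def algebra_simps)
  also have "\<dots> = (c * d) *\<^sub>C 1"
    unfolding im_unit_square by (simp add: cscale_def scaleR_add_left scaleR_diff_left algebra_simps)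
  finally show ?thesis .
qed

lemma cscale_add: "(c + d) *\<^sub>C a = c *\<^sub>C a + d *\<^sub>C (a :: 'a::super_banach_algebra)"
  by (simp add: cscale_def scaleR_add_left)

lemma cscale_zero [simp]: "0 *\<^sub>C (a :: 'a::super_banach_algebra) = 0"
  by (simp add: cscale_def)

lemma cscale_sum: "(\<Sum>i\<in>I. c i) *\<^sub>C (a :: 'a::super_banach_algebra) = (\<Sum>i\<in>I. c i *\<^sub>C a)"
  by (induction I rule: infinite_finite_induct) (simp_all add: cscale_add)

lemma cscale_unit_even: "c *\<^sub>C (1 :: 'a::super_banach_algebra) \<in> graded 0"
  by (simp add: cscale_def graded_def parity_add parity_scaleR parity_one parity_im_unit)

lemma dcurve_schwartz:
  fixes f :: "real \<Rightarrow> real \<Rightarrow> 'a::real_normed_vector"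
  assumes T: "open T" "t \<in> T" and f: "\<And>s. s \<in> T \<Longrightarrow> schwartz (f s)" and v: "schwartz v"
    and d: "has_schwartz_derivative f v t"
  shows "dcurve T (\<lambda>s. (vderiv ^^ n) (f s)) ((vderiv ^^ n) v) t"
  unfolding dcurve_def
proof (rule bcurve_uniform_limitI[OF T(2)])
  show "bnd (\<lambda>x. (1 + x\<^sup>2) *\<^sub>R (vderiv ^^ n) (f s) x)" if "s \<in> T" for s
    using schwartz_dec[OF schwartz_funpow[OF f[OF that], of n]] by (simp add: dec_def)
  show "bnd (\<lambda>x. (1 + x\<^sup>2) *\<^sub>R (vderiv ^^ n) v x)"
    using schwartz_dec[OF schwartz_funpow[OF v, of n]] by (simp add: dec_def)
  let ?q = "\<lambda>s. (vderiv ^^ n) (\<lambda>y. (1 / (s - t)) *\<^sub>R (f s y - f t y) - v y)"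
  \<comment> \<open>The weight 1 + x^2 is the sum of the weights of the seminorms with k = 0 and k =
    2.\<close>
  have "uniform_limit UNIV (\<lambda>s x. x ^ 0 *\<^sub>R ?q s x + x ^ 2 *\<^sub>R ?q s x) (\<lambda>x. 0 + 0) (at t)"
    using d unfolding has_schwartz_derivative_def by (intro uniform_limit_add) blast+
  then have "uniform_limit UNIV (\<lambda>s x. (1 + x\<^sup>2) *\<^sub>R ?q s x) (\<lambda>x. 0) (at t within T)"
    by (simp add: at_within_open[OF T(2,1)] scaleR_add_left)
  then show "uniform_limit UNIV (\<lambda>s x. (1 / (s - t)) *\<^sub>R ((1 + x\<^sup>2) *\<^sub>R (vderiv ^^ n) (f s) x
      - (1 + x\<^sup>2) *\<^sub>R (vderiv ^^ n) (f t) x) - (1 + x\<^sup>2) *\<^sub>R (vderiv ^^ n) v x) (\<lambda>x. 0) (at t within T)"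
  proof (rule uniform_limit_cong[THEN iffD1, rotated 2])
    show "\<forall>\<^sub>F s in at t within T. \<forall>x\<in>UNIV. (1 + x\<^sup>2) *\<^sub>R ?q s x = (1 / (s - t)) *\<^sub>R ((1 + x\<^sup>2) *\<^sub>R (vderiv ^^ n) (f s) x
      - (1 + x\<^sup>2) *\<^sub>R (vderiv ^^ n) (f t) x) - (1 + x\<^sup>2) *\<^sub>R (vderiv ^^ n) v x"
      unfolding eventually_at_filter
    proof (rule always_eventually, intro allI impI ballI)
      fix s x assume sT: "s \<in> T"
      show "(1 + x\<^sup>2) *\<^sub>R ?q s x = (1 / (s - t)) *\<^sub>R ((1 + x\<^sup>2) *\<^sub>R (vderiv ^^ n) (f s) x
        - (1 + x\<^sup>2) *\<^sub>R (vderiv ^^ n) (f t) x) - (1 + x\<^sup>2) *\<^sub>R (vderiv ^^ n) v x"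
        unfolding funpow_vderiv_quotient[OF f[OF sT] f[OF T(2)] v]
        by (simp only: scaleR_diff_right scaleR_scaleR mult.commute)
    qed
  qed simp
qed

lemma dec_if: "(c \<Longrightarrow> dec f) \<Longrightarrow> dec (\<lambda>x. if c then f x else 0)"
  by (cases c) simp_all

lemma dcurve_if: "t \<in> T \<Longrightarrow> (c \<Longrightarrow> dcurve T F F' t) \<Longrightarrow>
    dcurve T (\<lambda>s x. if c then F s x else 0) (\<lambda>x. if c then F' x else 0) t"
  by (cases c) (simp_all add: dcurve_zero)

lemma derivative_if: "(c \<Longrightarrow> (f has_vector_derivative f') (at x)) \<Longrightarrow>
    ((\<lambda>x. if c then f x else 0) has_vector_derivative (if c then f' else 0)) (at x)"
  by (cases c) simp_all

section \<open>Fields, charges and Hamiltonian in matrix form\<close>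

locale super_fields = graded_matrices "Suc (M + N)" "ext_grade M" for M N :: nat
begin

abbreviation K :: nat where "K \<equiv> M + N"

notation mprod (infixr "\<boxdot>" 70) and mmult (infixr "\<cdot>" 70)

definition colf :: "'a::super_banach_algebra fields \<Rightarrow> 'a mfun" where
  "colf \<phi> = (\<lambda>x i j. if i \<noteq> 0 \<and> i \<le> K \<and> j = 0 then \<phi> (i - 1) x else 0)"

definition rowf :: "'a::super_banach_algebra fields \<Rightarrow> 'a mfun" where
  "rowf \<psi> = (\<lambda>x i j. if i = 0 \<and> j \<noteq> 0 \<and> j \<le> K then \<psi> (j - 1) x else 0)"

definition matf :: "complex mat \<Rightarrow> 'a::super_banach_algebra mfun" where
  "matf \<sigma> = (\<lambda>x i j. if i \<noteq> 0 \<and> i \<le> K \<and> j \<noteq> 0 \<and> j \<le> K then (\<sigma> $$ (i - 1, j - 1)) *\<^sub>C 1 else 0)"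

lemma admissible_dx: "admissible M N \<phi> \<Longrightarrow> admissible M N (dx \<phi>)"
  unfolding admissible_def dx_component using schwartz_vderiv graded_derivative schwartz_derivative by metis

lemma admissible_schwartz: "admissible M N \<phi> \<Longrightarrow> j < K \<Longrightarrow> schwartz (\<phi> j)"
  and admissible_graded: "admissible M N \<phi> \<Longrightarrow> j < K \<Longrightarrow> \<phi> j x \<in> graded (grade M j)"
  by (simp_all add: admissible_def)

lemma is_row_rowf [simp]: "is_row (rowf \<psi>)" and is_col_colf [simp]: "is_col (colf \<phi>)"
  by (simp_all add: is_row_def is_col_def rowf_def colf_def)

lemma mdec_colf: "(\<And>j. j < K \<Longrightarrow> dec (\<phi> j)) \<Longrightarrow> mdec (colf \<phi>)"
  and mdec_rowf: "(\<And>j. j < K \<Longrightarrow> dec (\<phi> j)) \<Longrightarrow> mdec (rowf \<phi>)"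
  unfolding mdec_def colf_def rowf_def by (intro allI dec_if; auto)+

lemma admissible_col [simp]: "admissible M N \<phi> \<Longrightarrow> col (colf \<phi>)"
  and admissible_row [simp]: "admissible M N \<phi> \<Longrightarrow> row (rowf \<phi>)"
  unfolding row_def col_def by (auto intro!: mdec_colf mdec_rowf schwartz_dec admissible_schwartz)

lemma gr_fields [simp]: "admissible M N \<phi> \<Longrightarrow> gr 0 (colf \<phi>)" "admissible M N \<phi> \<Longrightarrow> gr 0 (rowf \<phi>)"
  by (auto simp: gr_def colf_def rowf_def ext_grade_def admissible_graded split: nat.split)

lemma mderiv_fields [simp]:
  "admissible M N \<phi> \<Longrightarrow> mderiv (colf \<phi>) (colf (dx \<phi>))" "admissible M N \<phi> \<Longrightarrow> mderiv (rowf \<phi>) (rowf (dx \<phi>))"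
  unfolding mderiv_def colf_def rowf_def dx_component
  by (intro allI derivative_if schwartz_derivative admissible_schwartz; auto)+

lemma const_matf [simp]: "const_mfun (matf \<sigma>)"
  by (auto simp: const_mfun_def matf_def)

lemma sum_shift: "(\<Sum>k<Suc K. f k) = f 0 + (\<Sum>k<K. f (Suc k))"
  by (rule sum.lessThan_Suc_shift)

lemma pair_eq: "(rowf \<psi> x \<boxdot> colf \<phi> y) 0 0 = pair K \<psi> x \<phi> y"
  unfolding mprod_def sum_shift by (simp add: rowf_def colf_def pair_def)

lemma mpair_eq: "(rowf \<psi> x \<boxdot> matf \<sigma> z \<boxdot> colf \<phi> y) 0 0 = mpair K \<psi> x \<sigma> \<phi> y"
  unfolding mprod_corner3 sum_shift
  by (simp add: rowf_def colf_def matf_def mpair_def mult.assoc cscale_unit_mult)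

text \<open>A partial product that ends in a column is supported in column 0. Hence the corner of a
  long product factors into scalars, and these are the factors \<open>pair\<close> and
  \<open>mpair\<close> of the integrands.\<close>

lemma corner_split: "is_col b \<Longrightarrow> ((A \<boxdot> b y) \<boxdot> X) 0 0 = (A \<boxdot> b y) 0 0 * X 0 0"
proof -
  assume "is_col b"
  then have "(A \<boxdot> b y) 0 (Suc k) = 0" for k by (simp add: mprod_def is_col_def)
  then show ?thesis unfolding mprod_def[of "A \<boxdot> b y"] sum_shift by simp
qed

lemma pair_even: "admissible M N \<phi> \<Longrightarrow> admissible M N \<psi> \<Longrightarrow> pair K \<psi> x \<phi> y \<in> graded 0"
  using gr_two_point[of 0 "rowf \<psi>" 0 "colf \<phi>" x y 0 0] by (simp add: pair_eq)

lemma charge0_eq: "charge0 K \<sigma> \<phi> \<psi> = abs_charge0 (matf \<sigma>) (rowf \<psi>) (colf \<phi>)"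
  by (simp add: charge0_def abs_charge0_def cint_def mmult_def mpair_eq)

lemma bilinear_term:
  assumes adm: "admissible M N \<phi>" "admissible M N \<phi>'" "admissible M N \<psi>" "admissible M N \<psi>'"
  shows "integrable (lborel :: (real \<times> real) measure) (\<lambda>(x, y). sgn (x - y) *\<^sub>R (mpair K \<psi> x \<sigma> \<phi> y * pair K \<psi>' y \<phi>' x))" (is ?T1)
    and "(\<integral>(x, y). sgn (x - y) *\<^sub>R (mpair K \<psi> x \<sigma> \<phi> y * pair K \<psi>' y \<phi>' x) \<partial>(lborel :: (real \<times> real) measure))
    = 2 *\<^sub>R cint (rowf \<psi> \<cdot> matf \<sigma> \<cdot> moI (colf \<phi> \<cdot> rowf \<psi>') \<cdot> colf \<phi>')" (is ?T2)
proof -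
  have e: "((rowf \<psi> \<cdot> matf \<sigma>) x \<boxdot> (colf \<phi> \<cdot> rowf \<psi>') y \<boxdot> colf \<phi>' x) 0 0 = mpair K \<psi> x \<sigma> \<phi> y * pair K \<psi>' y \<phi>' x" for x y
    using corner_split[of "colf \<phi>" "rowf \<psi> x \<boxdot> matf \<sigma> x" y "rowf \<psi>' y \<boxdot> colf \<phi>' x"]
    by (simp add: mmult_def mprod_assoc mpair_eq pair_eq)
  have m: "mdec (rowf \<psi> \<cdot> matf \<sigma>)" "mdec (colf \<phi> \<cdot> rowf \<psi>')" "mdec (colf \<phi>')"
    using adm by (auto intro!: mdec_mult1 mdec_mbnd)
  show ?T1
    using double_mintegral(1)[OF m] by (simp add: e case_prod_unfold)
  show ?T2
    using double_mintegral(2)[OF m] by (simp add: e case_prod_unfold mmult_assoc)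
qed

lemma charge1_eq:
  assumes "admissible M N \<phi>" "admissible M N \<psi>"
  shows "charge1 K g \<sigma> \<phi> \<psi> = abs_charge1 g (matf \<sigma>) (rowf \<psi>) (colf \<phi>) (colf (dx \<phi>))"
  using bilinear_term(2)[OF assms(1,1,2,2), of \<sigma>]
  by (simp add: charge1_def abs_charge1_def) (simp add: cint_def mmult_def mpair_eq)

lemma charge2_eq:
  assumes adm: "admissible M N \<phi>" "admissible M N \<psi>"
  shows "charge2 K g \<sigma> \<phi> \<psi> = abs_charge2 g (matf \<sigma>) (rowf \<psi>) (rowf (dx \<psi>)) (colf \<phi>) (colf (dx \<phi>)) (colf (dx (dx \<phi>)))"
proof -
  let ?r = "rowf \<psi>" and ?p = "colf \<phi>" and ?S = "matf \<sigma>"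
  note adm' = adm adm[THEN admissible_dx]
  have b: "(\<integral>(x, y). sgn (x - y) *\<^sub>R ((mpair K \<psi> x \<sigma> (dx \<phi>) y - mpair K (dx \<psi>) x \<sigma> \<phi> y) * pair K \<psi> y \<phi> x)
       \<partial>(lborel :: (real \<times> real) measure))
    = 2 *\<^sub>R cint (?r \<cdot> ?S \<cdot> moI (colf (dx \<phi>) \<cdot> ?r) \<cdot> ?p) - 2 *\<^sub>R cint (rowf (dx \<psi>) \<cdot> ?S \<cdot> moI (?p \<cdot> ?r) \<cdot> ?p)"
    unfolding bilinear_term(2)[OF adm'(3,1,2,2), of \<sigma>, symmetric] bilinear_term(2)[OF adm'(1,1,4,2), of \<sigma>, symmetric]
      Bochner_Integration.integral_diff[OF bilinear_term(1)[OF adm'(3,1,2,2), of \<sigma>] bilinear_term(1)[OF adm'(1,1,4,2), of \<sigma>], symmetric]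
    by (simp add: case_prod_unfold algebra_simps)
  \<comment> \<open>The matrix product begins at x and ends with the scalar joining y to x, which
    the charge writes in front; being even, that scalar may be moved. The points follow in the order
    x, z, y, which calls for the swapped triple integral.\<close>
  have e: "((?r \<cdot> ?S) x \<boxdot> (?p \<cdot> ?r) z \<boxdot> (?p \<cdot> ?r) y \<boxdot> ?p x) 0 0 = pair K \<psi> y \<phi> x * mpair K \<psi> x \<sigma> \<phi> z * pair K \<psi> z \<phi> y" for x y z
  proof -
    have "((?r \<cdot> ?S) x \<boxdot> (?p \<cdot> ?r) z \<boxdot> (?p \<cdot> ?r) y \<boxdot> ?p x) 0 0
      = (((?r x \<boxdot> ?S x) \<boxdot> ?p z) \<boxdot> (?r z \<boxdot> ?p y) \<boxdot> (?r y \<boxdot> ?p x)) 0 0"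
      by (simp add: mmult_def mprod_assoc)
    also have "\<dots> = mpair K \<psi> x \<sigma> \<phi> z * (pair K \<psi> z \<phi> y * pair K \<psi> y \<phi> x)"
      by (simp only: corner_split[OF is_col_colf] pair_eq) (simp add: mprod_assoc mpair_eq)
    also have "\<dots> = pair K \<psi> y \<phi> x * (mpair K \<psi> x \<sigma> \<phi> z * pair K \<psi> z \<phi> y)"
      unfolding even_central[OF pair_even[OF adm], of y x] by (simp add: mult.assoc)
    finally show ?thesis by (simp add: mult.assoc)
  qed
  have m: "mdec (?r \<cdot> ?S)" "mdec (?p \<cdot> ?r)" "mdec ?p"
    using adm by (auto intro!: mdec_mult1 mdec_mbnd)
  have t: "(\<integral>(x, y, z). (sgn (x - y) * sgn (y - z)) *\<^sub>R (pair K \<psi> y \<phi> x * mpair K \<psi> x \<sigma> \<phi> z * pair K \<psi> z \<phi> y)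
         \<partial>(lborel :: (real \<times> real \<times> real) measure))
    = 4 *\<^sub>R cint (?r \<cdot> ?S \<cdot> moI (moI (?p \<cdot> ?r) \<cdot> ?p \<cdot> ?r) \<cdot> ?p)"
    using triple_mintegral_swap[OF m(1) m(2) m(2) m(3)] by (simp add: e mmult_assoc)
  show ?thesis
    unfolding charge2_def abs_charge2_def b t
    by (simp add: scaleR_diff_right) (simp add: cint_def mmult_def mpair_eq)
qed

lemma hamiltonian_eq:
  assumes adm: "admissible M N \<phi>" "admissible M N \<psi>"
  shows "hamiltonian K g \<phi> \<psi> = abs_hamiltonian g (rowf \<psi>) (rowf (dx \<psi>)) (colf \<phi>) (colf (dx \<phi>))"
proof -
  note adm' = adm adm[THEN admissible_dx]
  have m: "mdec (rowf (dx \<psi>) \<cdot> colf (dx \<phi>))" "mdec (rowf \<psi> \<cdot> colf \<phi> \<cdot> rowf \<psi> \<cdot> colf \<phi>)"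
    using adm' by (auto intro!: mdec_mult1 mbnd_mult mdec_mbnd)
  have e: "(rowf \<psi> x \<boxdot> colf \<phi> x \<boxdot> rowf \<psi> x \<boxdot> colf \<phi> x) 0 0 = (pair K \<psi> x \<phi> x)\<^sup>2" for x
    using corner_split[of "colf \<phi>" "rowf \<psi> x" x "rowf \<psi> x \<boxdot> colf \<phi> x"]
    by (simp add: mprod_assoc pair_eq power2_eq_square)
  have "hamiltonian K g \<phi> \<psi> = cint (rowf (dx \<psi>) \<cdot> colf (dx \<phi>) + g *\<^sub>R (rowf \<psi> \<cdot> colf \<phi> \<cdot> rowf \<psi> \<cdot> colf \<phi>))"
    unfolding hamiltonian_def cint_def by (simp add: mmult_def e pair_eq)
  then show ?thesis using m by (simp add: abs_hamiltonian_def)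
qed

section \<open>Curves of fields and first variations\<close>

definition scurve :: "real set \<Rightarrow> (real \<Rightarrow> 'a::super_banach_algebra fields) \<Rightarrow> 'a fields \<Rightarrow> real \<Rightarrow> bool" where
  "scurve T \<Phi> V t \<longleftrightarrow> open T \<and> t \<in> T \<and> (\<forall>s\<in>T. admissible M N (\<Phi> s)) \<and> admissible M N V \<and>
     (\<forall>j<K. has_schwartz_derivative (\<lambda>s. \<Phi> s j) (V j) t)"

lemma scurve_mdcurve:
  assumes "scurve T \<Phi> V t"
  shows "mdcurve T (\<lambda>s. colf (\<Phi> s)) (colf V) t" "mdcurve T (\<lambda>s. colf (dx (\<Phi> s))) (colf (dx V)) t"
    "mdcurve T (\<lambda>s. colf (dx (dx (\<Phi> s)))) (colf (dx (dx V))) t" (is ?T1)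
    "mdcurve T (\<lambda>s. rowf (\<Phi> s)) (rowf V) t" "mdcurve T (\<lambda>s. rowf (dx (\<Phi> s))) (rowf (dx V)) t"
proof -
  have t: "t \<in> T" using assms by (simp add: scurve_def)
  have d: "dcurve T (\<lambda>s. (vderiv ^^ n) (\<Phi> s j)) ((vderiv ^^ n) (V j)) t" if "j < K" for j n
    using assms that by (intro dcurve_schwartz) (auto simp: scurve_def admissible_schwartz)
  have d': "dcurve T (\<lambda>s x. \<Phi> s j x) (\<lambda>x. V j x) t" "dcurve T (\<lambda>s x. dx (\<Phi> s) j x) (\<lambda>x. dx V j x) t"
    "dcurve T (\<lambda>s x. dx (dx (\<Phi> s)) j x) (\<lambda>x. dx (dx V) j x) t" if "j < K" for j
    using d[OF that, of 0] d[OF that, of 1] d[OF that, of 2] by (simp_all add: dx_component numeral_2_eq_2)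
  have k: "i - 1 < K" if "i \<noteq> 0" "i \<le> K" for i using that by auto
  show "mdcurve T (\<lambda>s. colf (\<Phi> s)) (colf V) t" "mdcurve T (\<lambda>s. colf (dx (\<Phi> s))) (colf (dx V)) t" ?T1
    "mdcurve T (\<lambda>s. rowf (\<Phi> s)) (rowf V) t" "mdcurve T (\<lambda>s. rowf (dx (\<Phi> s))) (rowf (dx V)) t"
    unfolding mdcurve_def colf_def rowf_def by (intro allI dcurve_if[OF t] d' k; simp)+
qed

lemma scurve_line:
  assumes \<phi>: "admissible M N \<phi>" and h: "schwartz h" "\<And>x. h x \<in> graded (grade M l)" and l: "l < K"
  shows "scurve UNIV (\<lambda>s. \<phi>(l := \<lambda>x. \<phi> l x + s *\<^sub>R h x)) ((\<lambda>j x. 0)(l := h)) 0"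
  unfolding scurve_def
proof (intro conjI ballI allI impI)
  show "admissible M N (\<phi>(l := \<lambda>x. \<phi> l x + s *\<^sub>R h x))" for s
    using \<phi> h by (auto simp: admissible_def intro!: schwartz_add schwartz_scaleR graded_add graded_scaleR)
  show "admissible M N ((\<lambda>j x. 0)(l := h))"
    using h by (auto simp: admissible_def schwartz_zero)
  fix j
  let ?f = "\<lambda>s. (\<phi>(l := \<lambda>x. \<phi> l x + s *\<^sub>R h x)) j" and ?v = "((\<lambda>j x. 0)(l := h)) j"
  have "(\<lambda>y. (1 / (s - 0)) *\<^sub>R (?f s y - ?f 0 y) - ?v y) = (\<lambda>y. 0)" if "s \<noteq> 0" for s
    using that by (auto simp: fun_eq_iff)
  moreover have "(vderiv ^^ n) (\<lambda>y. 0) = (\<lambda>y. 0 :: 'a)" for n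
    by (induction n) (auto intro!: vderiv_eqI)
  ultimately have "\<forall>\<^sub>F s in at 0. \<forall>x\<in>UNIV. dist (x ^ k *\<^sub>R (vderiv ^^ n) (\<lambda>y. (1 / (s - 0)) *\<^sub>R (?f s y - ?f 0 y) - ?v y) x) 0 < e"
    if "e > 0" for e k n
    unfolding eventually_at_filter using that by (intro always_eventually) auto
  then show "has_schwartz_derivative ?f ?v 0"
    unfolding has_schwartz_derivative_def by (intro allI uniform_limitI)
qed auto

lemma scurve_const:
  assumes \<phi>: "admissible M N \<phi>" shows "scurve UNIV (\<lambda>s. \<phi>) (\<lambda>j x. 0) 0"
proof -
  have "(vderiv ^^ n) (\<lambda>y. 0) = (\<lambda>y. 0 :: 'a)" for n
    by (induction n) (auto intro!: vderiv_eqI)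
  then show ?thesis
    using \<phi> by (auto simp: scurve_def has_schwartz_derivative_def admissible_def schwartz_zero intro!: uniform_limit_const)
qed

text \<open>Both fields vary together along arbitrary curves on an open set. Straight lines in one
  component yield the functional derivatives; solutions on an open interval yield the time
  derivative of the functional.\<close>

definition has_variation :: "'a::super_banach_algebra field_functional \<Rightarrow> 'a mfun \<Rightarrow> 'a mfun \<Rightarrow> 'a fields \<Rightarrow> 'a fields \<Rightarrow> bool" where
  "has_variation F Y X \<phi> \<psi> \<longleftrightarrow> (\<forall>T \<Phi> \<Psi> V W t. scurve T \<Phi> V t \<longrightarrow> scurve T \<Psi> W t \<longrightarrow> \<Phi> t = \<phi> \<longrightarrow> \<Psi> t = \<psi> \<longrightarrow>
     ((\<lambda>s. F (\<Phi> s) (\<Psi> s)) has_vector_derivative cint (Y \<cdot> colf V + rowf W \<cdot> X)) (at t within T))"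

lemma has_variationD:
  "has_variation F Y X \<phi> \<psi> \<Longrightarrow> scurve T \<Phi> V t \<Longrightarrow> scurve T \<Psi> W t \<Longrightarrow> \<Phi> t = \<phi> \<Longrightarrow> \<Psi> t = \<psi> \<Longrightarrow>
    ((\<lambda>s. F (\<Phi> s) (\<Psi> s)) has_vector_derivative cint (Y \<cdot> colf V + rowf W \<cdot> X)) (at t within T)"
  unfolding has_variation_def by blast

lemma has_variation_cong:
  assumes "has_variation F Y X \<phi> \<psi>"
    and "\<And>\<phi> \<psi>. admissible M N \<phi> \<Longrightarrow> admissible M N \<psi> \<Longrightarrow> F' \<phi> \<psi> = F \<phi> \<psi>"
  shows "has_variation F' Y X \<phi> \<psi>"
  unfolding has_variation_def
proof (intro allI impI)
  fix T \<Phi> \<Psi> V W t assume *: "scurve T \<Phi> V t" "scurve T \<Psi> W t" "\<Phi> t = \<phi>" "\<Psi> t = \<psi>"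
  then show "((\<lambda>s. F' (\<Phi> s) (\<Psi> s)) has_vector_derivative cint (Y \<cdot> colf V + rowf W \<cdot> X)) (at t within T)"
    by (intro has_vector_derivative_transform[OF _ _ has_variationD[OF assms(1) *]]) (auto simp: scurve_def assms(2))
qed

lemma has_variation_zero: "has_variation (\<lambda>\<phi> \<psi>. 0) 0 0 \<phi> \<psi>"
  by (simp add: has_variation_def mmult_linear)

end

section \<open>Functional derivatives and Poisson brackets\<close>

lemma parity_funpow_graded: "a \<in> graded q \<Longrightarrow> k \<le> 1 \<Longrightarrow> (parity ^^ k) a = (-1::real) ^ (q * k) *\<^sub>R a"
  for a :: "'a::super_banach_algebra"
  by (cases k) (auto simp: graded_def)

lemma bounded_linear_parity_funpow: "bounded_linear (parity ^^ k :: 'a::super_banach_algebra \<Rightarrow> 'a)"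
proof (induction k)
  case 0 show ?case by (simp add: bounded_linear_ident id_def)
next
  case (Suc k) then show ?case
    using bounded_linear_compose[OF bounded_linear_parity Suc] by (simp add: o_def)
qed

context graded_matrices
begin

lemma gr_linear [simp]:
  "gr p F \<Longrightarrow> gr p G \<Longrightarrow> gr p (F + G)" "gr p F \<Longrightarrow> gr p G \<Longrightarrow> gr p (F - G)"
  "gr p F \<Longrightarrow> gr p (c *\<^sub>R F)" "gr p F \<Longrightarrow> gr p (- F)"
proof -
  show "gr p F \<Longrightarrow> gr p G \<Longrightarrow> gr p (F + G)" "gr p F \<Longrightarrow> gr p G \<Longrightarrow> gr p (F - G)"
    by (auto simp: gr_def graded_add graded_diff)
  show 1: "gr p F \<Longrightarrow> gr p (c *\<^sub>R F)" for c F by (auto simp: gr_def graded_scaleR)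
  show "gr p F \<Longrightarrow> gr p (- F)" using 1[of F "-1"] by simp
qed

lemma cint_graded:
  assumes "mdec F" "gr p F" shows "cint F \<in> graded p"
proof -
  have "F x 0 0 \<in> graded p" for x using assms(2) \<gamma>_0 unfolding gr_def by (metis add.right_neutral)
  then have "(\<integral>x. parity (F x 0 0) \<partial>lborel) = (\<integral>x. (-1) ^ p *\<^sub>R F x 0 0 \<partial>lborel)"
    by (simp add: graded_def)
  then show ?thesis
    using integral_bounded_linear[OF bounded_linear_parity mdec_int[OF assms(1), of 0 0]]
    by (simp add: cint_def graded_def)
qed

end

context super_fields
begin

text \<open>Row 0 vanishes, so the auxiliary index contributes nothing when such a factor stands on
  the right, and the sum reduces to the components of the fields, as in the bracket.\<close>

definition corner_free :: "'a::super_banach_algebra mfun \<Rightarrow> bool" where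
  "corner_free F \<longleftrightarrow> (\<forall>x j. F x 0 j = 0)"

lemma corner_free_simps [simp]:
  "corner_free (colf \<phi>)" "corner_free (matf \<sigma>)" "corner_free F \<Longrightarrow> corner_free (F \<cdot> G)"
  "corner_free F \<Longrightarrow> corner_free (moI F)" "corner_free F \<Longrightarrow> corner_free G \<Longrightarrow> corner_free (F + G)"
  "corner_free F \<Longrightarrow> corner_free G \<Longrightarrow> corner_free (F - G)" "corner_free F \<Longrightarrow> corner_free (c *\<^sub>R F)"
  "corner_free F \<Longrightarrow> corner_free (- F)"
  by (simp_all add: corner_free_def colf_def matf_def mmult_def mprod_def moI_def oI_def)

lemma cint_prod:
  assumes "mdec Y" "mdec X" "corner_free X"
  shows "cint (Y \<cdot> X) = (\<Sum>l<K. \<integral>x. Y x 0 (Suc l) * X x (Suc l) 0 \<partial>lborel)"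
proof -
  have "integrable lborel (\<lambda>x. Y x 0 (Suc l) * X x (Suc l) 0)" for l
    using assms by (intro dec_integrable dec_mult_bnd dec_bnd) (auto simp: mdec_def)
  moreover have "(Y \<cdot> X) x 0 0 = (\<Sum>l<K. Y x 0 (Suc l) * X x (Suc l) 0)" for x
    using assms(3) unfolding mmult_def mprod_def sum_shift by (simp add: corner_free_def)
  ultimately show ?thesis
    unfolding cint_def by (simp add: Bochner_Integration.integral_sum)
qed

text \<open>In \<open>rowf W \<cdot> X\<close> the variation already stands on the left, so
  \<open>X\<close> is the derivative itself. In \<open>Y \<cdot> colf V\<close> it stands on the
  right; carrying it across twists \<open>Y\<close> by a power of \<open>parity\<close>.\<close>

lemma has_variation_functional_derivative:
  fixes F :: "'a::super_banach_algebra field_functional"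
  assumes adm: "admissible M N \<phi>" "admissible M N \<psi>" and var: "has_variation F Y X \<phi> \<psi>"
    and d: "mdec Y" "mdec X" and l: "l < K"
  shows "has_functional_derivative M (\<lambda>\<phi>'. F \<phi>' \<psi>) \<phi> l (\<lambda>x. (parity ^^ grade M l) (Y x 0 (Suc l)))" (is ?T1)
    and "has_functional_derivative M (\<lambda>\<psi>'. F \<phi> \<psi>') \<psi> l (\<lambda>x. X x (Suc l) 0)" (is ?T2)
proof -
  have dY: "dec (\<lambda>x. Y x 0 (Suc l))" and dX: "dec (\<lambda>x. X x (Suc l) 0)" using d by (simp_all add: mdec_def)
  have cont: "continuous_on UNIV (\<lambda>x. Y x 0 (Suc l))" "continuous_on UNIV (\<lambda>x. X x (Suc l) 0)"
    using dY dX dec_bnd by (auto simp: bnd_def)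
  have z: "colf (\<lambda>j x. 0 :: 'a) = 0" "rowf (\<lambda>j x. 0 :: 'a) = 0" by (auto simp: colf_def rowf_def fun_eq_iff)
  have single: "(Y \<cdot> colf ((\<lambda>j x. 0)(l := h))) x 0 0 = Y x 0 (Suc l) * h x"
    "(rowf ((\<lambda>j x. 0)(l := h)) \<cdot> X) x 0 0 = h x * X x (Suc l) 0" for h x
  proof -
    have "(\<Sum>k<K. Y x 0 (Suc k) * (if k = l then h x else 0)) = Y x 0 (Suc l) * h x"
      "(\<Sum>k<K. (if k = l then h x else 0) * X x (Suc k) 0) = h x * X x (Suc l) 0"
      using l by (simp_all add: if_distrib[of "\<lambda>a. _ * a"] if_distrib[of "\<lambda>a. a * _"] cong: if_cong)
    moreover have "((\<lambda>j x. 0)(l := h)) k x = (if k = l then h x else 0)" for k by simp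
    ultimately show "(Y \<cdot> colf ((\<lambda>j x. 0)(l := h))) x 0 0 = Y x 0 (Suc l) * h x"
      "(rowf ((\<lambda>j x. 0)(l := h)) \<cdot> X) x 0 0 = h x * X x (Suc l) 0"
      unfolding mmult_def mprod_def sum_shift by (simp_all add: colf_def rowf_def)
  qed
  show ?T1
    unfolding has_functional_derivative_def
  proof (intro conjI allI impI)
    show "continuous_on UNIV (\<lambda>x. (parity ^^ grade M l) (Y x 0 (Suc l)))"
      by (rule bounded_linear.continuous_on[OF bounded_linear_parity_funpow cont(1)])
    fix h :: "real \<Rightarrow> 'a" assume h: "schwartz h \<and> (\<forall>x. h x \<in> graded (grade M l))"
    have e: "h x * (parity ^^ grade M l) (Y x 0 (Suc l)) = Y x 0 (Suc l) * h x" for x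
      using parity_twist[OF grade_le_1[of M l], of "h x" "Y x 0 (Suc l)"] h by simp
    show "integrable lborel (\<lambda>x. h x * (parity ^^ grade M l) (Y x 0 (Suc l)))"
      unfolding e using h by (intro dec_integrable dec_mult_bnd dY dec_bnd schwartz_dec) simp
    have "((\<lambda>s. F (\<phi>(l := \<lambda>x. \<phi> l x + s *\<^sub>R h x)) \<psi>) has_vector_derivative
        cint (Y \<cdot> colf ((\<lambda>j x. 0)(l := h)) + rowf (\<lambda>j x. 0) \<cdot> X)) (at 0)"
      using h by (intro has_variationD[OF var scurve_line scurve_const] adm l) auto
    then show "((\<lambda>s. F (\<phi>(l := \<lambda>x. \<phi> l x + s *\<^sub>R h x)) \<psi>) has_vector_derivative
        (\<integral>x. h x * (parity ^^ grade M l) (Y x 0 (Suc l)) \<partial>lborel)) (at 0)"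
      by (simp add: e z mmult_linear cint_def single)
  qed
  show ?T2
    unfolding has_functional_derivative_def
  proof (intro conjI allI impI cont(2))
    fix h :: "real \<Rightarrow> 'a" assume h: "schwartz h \<and> (\<forall>x. h x \<in> graded (grade M l))"
    show "integrable lborel (\<lambda>x. h x * X x (Suc l) 0)"
      using h by (intro dec_integrable dec_mult_bnd dec_bnd[OF dX] schwartz_dec) simp
    have "((\<lambda>s. F \<phi> (\<psi>(l := \<lambda>x. \<psi> l x + s *\<^sub>R h x))) has_vector_derivative
        cint (Y \<cdot> colf (\<lambda>j x. 0) + rowf ((\<lambda>j x. 0)(l := h)) \<cdot> X)) (at 0)"
      using h by (intro has_variationD[OF var scurve_const scurve_line] adm l) auto
    then show "((\<lambda>s. F \<phi> (\<psi>(l := \<lambda>x. \<psi> l x + s *\<^sub>R h x))) has_vector_derivative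
        (\<integral>x. h x * X x (Suc l) 0 \<partial>lborel)) (at 0)"
      by (simp add: z mmult_linear cint_def single)
  qed
qed

lemma deltas:
  fixes F :: "'a::super_banach_algebra field_functional"
  assumes faithful: "N > 0 \<longrightarrow> (\<forall>a::'a. (\<forall>\<theta>\<in>graded 1. \<theta> * a = 0) \<longrightarrow> a = 0)"
    and adm: "admissible M N \<phi>" "admissible M N \<psi>" and var: "has_variation F Y X \<phi> \<psi>"
    and d: "mdec Y" "mdec X" and l: "l < K"
  shows "delta_phi M F l \<phi> \<psi> = (\<lambda>x. (parity ^^ grade M l) (Y x 0 (Suc l)))" (is ?T1)
    "delta_psi M F l \<phi> \<psi> = (\<lambda>x. X x (Suc l) 0)"
proof -
  have f: "grade M l \<noteq> 0 \<Longrightarrow> \<forall>a::'a. (\<forall>\<theta>\<in>graded 1. \<theta> * a = 0) \<longrightarrow> a = 0"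
    using faithful l by (auto simp: grade_def split: if_splits)
  show ?T1
    "delta_psi M F l \<phi> \<psi> = (\<lambda>x. X x (Suc l) 0)"
    unfolding delta_phi_def delta_psi_def
    using functional_derivative_eq[OF f] has_variation_functional_derivative[OF adm var d l] by blast+
qed

text \<open>The exchange rule \<open>comm\<close> is left as a hypothesis with a free sign
  \<open>s\<close>, so that one lemma covers two homogeneous functionals as well as an even first
  argument with an arbitrary second one.\<close>

lemma poisson_eq:
  fixes F G :: "'a::super_banach_algebra field_functional"
  assumes faithful: "N > 0 \<longrightarrow> (\<forall>a::'a. (\<forall>\<theta>\<in>graded 1. \<theta> * a = 0) \<longrightarrow> a = 0)"
    and adm: "admissible M N \<phi>" "admissible M N \<psi>"
    and p: "p \<in> {0, 1}" and F: "has_variation F YF XF \<phi> \<psi>" and G: "has_variation G YG XG \<phi> \<psi>"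
    and graded: "\<And>\<phi> \<psi>. admissible M N \<phi> \<Longrightarrow> admissible M N \<psi> \<Longrightarrow> F \<phi> \<psi> \<in> graded p"
    and d: "mdec YF" "mdec XF" "mdec YG" "mdec XG" and gr: "gr p YF" and cf: "corner_free XF" "corner_free XG"
    and comm: "\<And>l x. l < K \<Longrightarrow> (-1::real) ^ (p * grade M l) *\<^sub>R (XF x (Suc l) 0 * (parity ^^ grade M l) (YG x 0 (Suc l)))
       = s *\<^sub>R (YG x 0 (Suc l) * XF x (Suc l) 0)"
  shows "poisson M N F G \<phi> \<psi> = im_unit * (cint (YF \<cdot> XG) - s *\<^sub>R cint (YG \<cdot> XF))"
proof -
  note dG = deltas[OF faithful adm G d(3,4)]
  \<comment> \<open>The component of the other grade vanishes on admissible fields; hence its first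
    variation, its derivatives and its contribution are 0.\<close>
  have other: "poisson_homogeneous M N q (\<lambda>\<phi> \<psi>. gpart q (F \<phi> \<psi>)) G \<phi> \<psi> = 0" if q: "odd (p + q)" for q
  proof -
    have "has_variation (\<lambda>\<phi> \<psi>. gpart q (F \<phi> \<psi>)) 0 0 \<phi> \<psi>"
      by (rule has_variation_cong[OF has_variation_zero]) (use q in \<open>simp add: gpart_graded[OF graded]\<close>)
    note dF = deltas[OF faithful adm this mdec_linear(5) mdec_linear(5)]
    have "(parity ^^ k) (0::'a) = 0" for k by (rule linear_0[OF bounded_linear.linear[OF bounded_linear_parity_funpow]])
    then show ?thesis unfolding poisson_homogeneous_def by (simp add: dF)
  qed
  have "has_variation (\<lambda>\<phi> \<psi>. gpart p (F \<phi> \<psi>)) YF XF \<phi> \<psi>"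
    by (rule has_variation_cong[OF F]) (simp add: gpart_graded[OF graded])
  note dF = deltas[OF faithful adm this d(1,2)]
  have int: "integrable lborel (\<lambda>x. Y x 0 (Suc l) * X x (Suc l) 0)" if "mdec Y" "mdec X" for Y X :: "'a mfun" and l
    using that by (intro dec_integrable dec_mult_bnd dec_bnd) (auto simp: mdec_def)
  have "(\<integral>x. (-1::real) ^ (p * grade M l) *\<^sub>R
         ((-1::real) ^ grade M l *\<^sub>R (delta_phi M (\<lambda>\<phi> \<psi>. gpart p (F \<phi> \<psi>)) l \<phi> \<psi> x * delta_psi M G l \<phi> \<psi> x)
          - delta_psi M (\<lambda>\<phi> \<psi>. gpart p (F \<phi> \<psi>)) l \<phi> \<psi> x * delta_phi M G l \<phi> \<psi> x) \<partial>lborel)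
      = (\<integral>x. YF x 0 (Suc l) * XG x (Suc l) 0 \<partial>lborel) - s *\<^sub>R (\<integral>x. YG x 0 (Suc l) * XF x (Suc l) 0 \<partial>lborel)"
    if l: "l < K" for l
  proof -
    have k: "grade M l = 0 \<or> grade M l = 1" by (simp add: grade_def)
    \<comment> \<open>With k the grade of the field, the twist gives (-1)^((p + k) k), while the
      bracket has the signs (-1)^(p k) and (-1)^k. As k is 0 or 1, the total sign is plus.\<close>
    have "YF x 0 (Suc l) \<in> graded (p + grade M l)" for x
      using gr unfolding gr_def by (metis ext_grade_simps add.right_neutral)
    from parity_funpow_graded[OF this grade_le_1]
    have "(-1::real) ^ (p * grade M l) *\<^sub>R (-1::real) ^ grade M l *\<^sub>R (parity ^^ grade M l) (YF x 0 (Suc l)) = YF x 0 (Suc l)" for x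
      using k by (auto simp: minus_one_power_iff)
    then have "(-1::real) ^ (p * grade M l) *\<^sub>R
         ((-1::real) ^ grade M l *\<^sub>R (delta_phi M (\<lambda>\<phi> \<psi>. gpart p (F \<phi> \<psi>)) l \<phi> \<psi> x * delta_psi M G l \<phi> \<psi> x)
          - delta_psi M (\<lambda>\<phi> \<psi>. gpart p (F \<phi> \<psi>)) l \<phi> \<psi> x * delta_phi M G l \<phi> \<psi> x)
       = YF x 0 (Suc l) * XG x (Suc l) 0 - s *\<^sub>R (YG x 0 (Suc l) * XF x (Suc l) 0)" for x
      unfolding scaleR_diff_right comm[OF l, symmetric] dF[OF l] dG[OF l] by (metis mult_scaleR_left)
    then show ?thesis
      using int[OF d(1,4)] int[OF d(3,2)] by simp
  qed
  then have main: "poisson_homogeneous M N p (\<lambda>\<phi> \<psi>. gpart p (F \<phi> \<psi>)) G \<phi> \<psi>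
      = im_unit * (cint (YF \<cdot> XG) - s *\<^sub>R cint (YG \<cdot> XF))"
    unfolding poisson_homogeneous_def cint_prod[OF d(1,4) cf(2)] cint_prod[OF d(3,2) cf(1)]
    by (simp add: sum_subtractf scaleR_sum_right)
  show ?thesis
    unfolding poisson_def using p main other[of 0] other[of 1] by auto
qed

lemma homogeneous_comm:
  assumes X: "gr p (X :: 'a::super_banach_algebra mfun)" and Y: "gr q Y"
  shows "(-1::real) ^ (p * grade M l) *\<^sub>R (X x (Suc l) 0 * (parity ^^ grade M l) (Y x 0 (Suc l)))
       = (-1) ^ (p * q) *\<^sub>R (Y x 0 (Suc l) * X x (Suc l) 0)"
proof -
  have k: "grade M l = 0 \<or> grade M l = 1" by (simp add: grade_def)
  have gX: "X x (Suc l) 0 \<in> graded (p + grade M l)" and gY: "Y x 0 (Suc l) \<in> graded (q + grade M l)"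
    using X Y unfolding gr_def by (metis ext_grade_simps add.right_neutral)+
  show ?thesis
    unfolding parity_funpow_graded[OF gY grade_le_1] mult_scaleR_right supercommute_graded[OF gX gY] scaleR_scaleR
    using k by (auto simp: minus_one_power_iff)
qed

text \<open>With an even first argument the twist of \<open>Y\<close> is exactly what is needed to
  exchange the factors, so \<open>Y\<close> may be inhomogeneous. This allows arbitrary matrices in
  the bracket with the Hamiltonian.\<close>

lemma even_comm:
  assumes X: "gr 0 (X :: 'a::super_banach_algebra mfun)"
  shows "(-1::real) ^ (0 * grade M l) *\<^sub>R (X x (Suc l) 0 * (parity ^^ grade M l) (Y x 0 (Suc l)))
       = 1 *\<^sub>R (Y x 0 (Suc l) * X x (Suc l) 0)"
proof -
  have "X x (Suc l) 0 \<in> graded (grade M l)"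
    using X unfolding gr_def by (metis ext_grade_simps add.right_neutral add_0)
  from parity_twist[OF grade_le_1 this] show ?thesis by simp
qed

section \<open>Conservation along solutions\<close>

definition imul :: "'a::super_banach_algebra mfun \<Rightarrow> 'a mfun" where
  "imul F = (\<lambda>x i j. im_unit * F x i j)"

lemma cint_imul:
  assumes "mdec Y" "mdec X"
  shows "cint (Y \<cdot> imul X) = im_unit * cint (Y \<cdot> X)" "cint (imul Y \<cdot> X) = im_unit * cint (Y \<cdot> X)"
proof -
  have "(Y \<cdot> imul X) x 0 0 = im_unit * (Y \<cdot> X) x 0 0" "(imul Y \<cdot> X) x 0 0 = im_unit * (Y \<cdot> X) x 0 0" for x
    by (simp_all add: mmult_def mprod_def imul_def im_unit_left_comm sum_distrib_left distrib_left mult.assoc)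
  moreover have "integrable lborel (\<lambda>x. (Y \<cdot> X) x 0 0)"
    using assms by (intro mdec_int mdec_mult1 mdec_mbnd)
  ultimately show "cint (Y \<cdot> imul X) = im_unit * cint (Y \<cdot> X)" "cint (imul Y \<cdot> X) = im_unit * cint (Y \<cdot> X)"
    by (simp_all add: cint_def)
qed

lemma mdec_imul: "mdec F \<Longrightarrow> mdec (imul F)"
  by (simp add: mdec_def imul_def bnd_mult_dec)

definition flow_phi :: "real \<Rightarrow> 'a::super_banach_algebra fields \<Rightarrow> 'a fields \<Rightarrow> 'a mfun" where
  "flow_phi g \<phi> \<psi> = colf (dx (dx \<phi>)) - (2 * g) *\<^sub>R (colf \<phi> \<cdot> rowf \<psi> \<cdot> colf \<phi>)"

definition flow_psi :: "real \<Rightarrow> 'a::super_banach_algebra fields \<Rightarrow> 'a fields \<Rightarrow> 'a mfun" where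
  "flow_psi g \<phi> \<psi> = - rowf (dx (dx \<psi>)) + (2 * g) *\<^sub>R (rowf \<psi> \<cdot> colf \<phi> \<cdot> rowf \<psi>)"

lemma pair_schwartz:
  "admissible M N \<phi> \<Longrightarrow> admissible M N \<psi> \<Longrightarrow> schwartz (\<lambda>x. pair K \<psi> x \<phi> x)"
  unfolding pair_def by (intro schwartz_sum schwartz_mult admissible_schwartz) auto

text \<open>A solution only asserts that velocities exist. The equation expresses them through the
  fields, and therefore they are themselves rapidly decreasing and of the right grade, as a curve of
  fields requires.\<close>

lemma flow_admissible:
  fixes \<phi> \<psi> \<eta> v :: "'a::super_banach_algebra fields"
  assumes adm: "admissible M N \<phi>" "admissible M N \<psi>" "admissible M N \<eta>"
    and v: "\<And>j x. j < K \<Longrightarrow> v j x = im_unit * (c *\<^sub>R vderiv (vderiv (\<eta> j)) x + d *\<^sub>R (pair K \<psi> x \<phi> x * \<eta> j x))"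
  shows "admissible M N v"
  unfolding admissible_def
proof (intro allI impI conjI)
  fix j assume j: "j < M + N"
  have "schwartz (\<lambda>x. im_unit * (c *\<^sub>R vderiv (vderiv (\<eta> j)) x + d *\<^sub>R (pair K \<psi> x \<phi> x * \<eta> j x)))"
    by (intro schwartz_linear[OF bounded_linear_mult_right] schwartz_add schwartz_scaleR schwartz_mult pair_schwartz
        schwartz_vderiv admissible_schwartz[OF adm(3) j] adm)
  moreover have "v j = (\<lambda>x. im_unit * (c *\<^sub>R vderiv (vderiv (\<eta> j)) x + d *\<^sub>R (pair K \<psi> x \<phi> x * \<eta> j x)))"
    using v[OF j] by blast
  ultimately show "schwartz (v j)" by simp
  fix x
  have "dx (dx \<eta>) j x \<in> graded (grade M j)"
    by (rule admissible_graded[OF admissible_dx[OF admissible_dx[OF adm(3)]] j])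
  then have "c *\<^sub>R vderiv (vderiv (\<eta> j)) x + d *\<^sub>R (pair K \<psi> x \<phi> x * \<eta> j x) \<in> graded (grade M j)"
    using graded_mult[OF pair_even[OF adm(1,2), of x x] admissible_graded[OF adm(3) j, of x]]
    by (intro graded_add graded_scaleR) (simp_all add: dx_component)
  from graded_mult[OF im_unit_even this] show "v j x \<in> graded (grade M j)"
    unfolding v[OF j] by simp
qed

lemma row_col_row: "(rowf \<psi> \<cdot> colf \<phi> \<cdot> rowf \<psi>) x i j = (if i = 0 \<and> j \<noteq> 0 \<and> j \<le> K then pair K \<psi> x \<phi> x * \<psi> (j - 1) x else 0)"
proof -
  have z: "(rowf \<psi> x \<boxdot> colf \<phi> x) i k = (if i = 0 \<and> k = 0 then pair K \<psi> x \<phi> x else 0)" for i k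
    using pair_eq[of \<psi> x \<phi> x] by (cases "i = 0 \<and> k = 0") (auto simp: mprod_def colf_def rowf_def)
  have "(rowf \<psi> \<cdot> colf \<phi> \<cdot> rowf \<psi>) x = (rowf \<psi> x \<boxdot> colf \<phi> x) \<boxdot> rowf \<psi> x"
    by (simp add: mmult_def mprod_assoc)
  then show ?thesis
    unfolding mprod_def[of "rowf \<psi> x \<boxdot> colf \<phi> x"] sum_shift z by (simp add: rowf_def)
qed

text \<open>The product puts the scalar to the right of the field, the equation to its left;
  evenness of the scalar reconciles the two.\<close>

lemma col_row_col:
  assumes "admissible M N \<phi>" "admissible M N \<psi>"
  shows "(colf \<phi> \<cdot> rowf \<psi> \<cdot> colf \<phi>) x i j = (if i \<noteq> 0 \<and> i \<le> K \<and> j = 0 then pair K \<psi> x \<phi> x * \<phi> (i - 1) x else 0)"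
proof -
  have z: "(rowf \<psi> x \<boxdot> colf \<phi> x) 0 j = (if j = 0 then pair K \<psi> x \<phi> x else 0)" for j
    by (cases j) (simp_all add: pair_eq, simp add: mprod_def colf_def)
  show ?thesis
    unfolding mmult_def mprod_def[of "colf \<phi> x"] sum_shift z
    by (simp add: colf_def even_central[OF pair_even[OF assms], of x x])
qed

lemma flow_entries:
  assumes "admissible M N \<phi>" "admissible M N \<psi>"
  shows "flow_phi g \<phi> \<psi> x i j = (if i \<noteq> 0 \<and> i \<le> K \<and> j = 0
      then vderiv (vderiv (\<phi> (i - 1))) x - (2 * g) *\<^sub>R (pair K \<psi> x \<phi> x * \<phi> (i - 1) x) else 0)"
    "flow_psi g \<phi> \<psi> x i j = (if i = 0 \<and> j \<noteq> 0 \<and> j \<le> K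
      then - vderiv (vderiv (\<psi> (j - 1))) x + (2 * g) *\<^sub>R (pair K \<psi> x \<phi> x * \<psi> (j - 1) x) else 0)"
  by (simp_all add: flow_phi_def flow_psi_def col_row_col[OF assms] row_col_row)
     (simp_all add: colf_def rowf_def dx_component)

text \<open>Along a solution the velocities are \<open>im_unit\<close> times the flow. Being
  central, \<open>im_unit\<close> comes out of the first variation, the remaining integral vanishes
  by assumption, and zero derivative on an interval means constant.\<close>

lemma conserved:
  fixes F :: "'a::super_banach_algebra field_functional"
  assumes var: "\<And>\<phi> \<psi>. admissible M N \<phi> \<Longrightarrow> admissible M N \<psi> \<Longrightarrow> \<exists>Y X. has_variation F Y X \<phi> \<psi> \<and> mdec Y \<and> mdec X \<and>
      cint (Y \<cdot> flow_phi g \<phi> \<psi> + flow_psi g \<phi> \<psi> \<cdot> X) = 0"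
  shows "conserved_by_nlss M N g F"
  unfolding conserved_by_nlss_def
proof (intro allI impI ballI)
  fix a b :: real and \<Phi> \<Psi> :: "real \<Rightarrow> 'a fields" and s t
  assume sol: "nlss_solution M N g {a<..<b} \<Phi> \<Psi>" and st: "s \<in> {a<..<b}" "t \<in> {a<..<b}"
  have "((\<lambda>s. F (\<Phi> s) (\<Psi> s)) has_vector_derivative 0) (at t within {a<..<b})" if t: "t \<in> {a<..<b}" for t
  proof -
    have adm: "admissible M N (\<Phi> s)" "admissible M N (\<Psi> s)" if "s \<in> {a<..<b}" for s
      using sol that unfolding nlss_solution_def by blast+
    let ?\<rho> = "\<lambda>x. pair K (\<Psi> t) x (\<Phi> t) x"
    \<comment> \<open>Velocities are given for each component separately; pairing them lets one
      choice produce the velocity fields \<open>V\<close> and \<open>W\<close>.\<close>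
    have "\<forall>j\<in>{..<K}. \<exists>vw. has_schwartz_derivative (\<lambda>s. \<Phi> s j) (fst vw) t \<and> has_schwartz_derivative (\<lambda>s. \<Psi> s j) (snd vw) t \<and>
       (\<forall>x. im_unit * fst vw x = - vderiv (vderiv (\<Phi> t j)) x + (2 * g) *\<^sub>R (?\<rho> x * \<Phi> t j x)) \<and>
       (\<forall>x. - im_unit * snd vw x = - vderiv (vderiv (\<Psi> t j)) x + (2 * g) *\<^sub>R (?\<rho> x * \<Psi> t j x))"
      using sol t unfolding nlss_solution_def by (fastforce simp del: minus_mult_left mult_minus_left)
    from bchoice[OF this] obtain f where f: "\<And>j. j < K \<Longrightarrow> has_schwartz_derivative (\<lambda>s. \<Phi> s j) (fst (f j)) t"
      "\<And>j. j < K \<Longrightarrow> has_schwartz_derivative (\<lambda>s. \<Psi> s j) (snd (f j)) t"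
      "\<And>j x. j < K \<Longrightarrow> im_unit * fst (f j) x = - vderiv (vderiv (\<Phi> t j)) x + (2 * g) *\<^sub>R (?\<rho> x * \<Phi> t j x)"
      "\<And>j x. j < K \<Longrightarrow> - im_unit * snd (f j) x = - vderiv (vderiv (\<Psi> t j)) x + (2 * g) *\<^sub>R (?\<rho> x * \<Psi> t j x)"
      by blast
    define V W where "V j = fst (f j)" and "W j = snd (f j)" for j
    have im2: "im_unit * (im_unit * c) = - c" for c :: 'a
      by (simp add: mult.assoc[symmetric] im_unit_square)
    have V: "V j x = im_unit * (1 *\<^sub>R vderiv (vderiv (\<Phi> t j)) x + (- (2 * g)) *\<^sub>R (?\<rho> x * \<Phi> t j x))" if "j < K" for j x
    proof -
      \<comment> \<open>Multiplying the equation by \<open>- im_unit\<close> solves it for the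
        velocity.\<close>
      have "V j x = - (im_unit * (im_unit * V j x))" by (simp add: im2)
      also have "\<dots> = im_unit * (- (- vderiv (vderiv (\<Phi> t j)) x + (2 * g) *\<^sub>R (?\<rho> x * \<Phi> t j x)))"
        unfolding V_def f(3)[OF that] by (rule mult_minus_right[symmetric])
      finally show ?thesis by simp
    qed
    have W: "W j x = im_unit * ((-1) *\<^sub>R vderiv (vderiv (\<Psi> t j)) x + (2 * g) *\<^sub>R (?\<rho> x * \<Psi> t j x))" if "j < K" for j x
    proof -
      have "W j x = im_unit * (- im_unit * W j x)" by (simp add: im2)
      then show ?thesis unfolding W_def f(4)[OF that] by simp
    qed
    have "admissible M N V" "admissible M N W"
      using flow_admissible[OF adm[OF t] adm(1)[OF t] V] flow_admissible[OF adm[OF t] adm(2)[OF t] W] by blast+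
    then have curves: "scurve {a<..<b} \<Phi> V t" "scurve {a<..<b} \<Psi> W t"
      using adm t f(1,2) by (auto simp: scurve_def V_def W_def)
    have kk: "i - 1 < K" if "i \<noteq> 0" "i \<le> K" for i using that by auto
    have cV: "colf V = imul (flow_phi g (\<Phi> t) (\<Psi> t))"
    proof (intro ext)
      fix x i j
      show "colf V x i j = imul (flow_phi g (\<Phi> t) (\<Psi> t)) x i j"
        using V[OF kk, of i x]
        by (auto simp: imul_def flow_entries[OF adm[OF t]] colf_def)
    qed
    have cW: "rowf W = imul (flow_psi g (\<Phi> t) (\<Psi> t))"
    proof (intro ext)
      fix x i j
      show "rowf W x i j = imul (flow_psi g (\<Phi> t) (\<Psi> t)) x i j"
        using W[OF kk, of j x]
        by (auto simp: imul_def flow_entries[OF adm[OF t]] rowf_def)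
    qed
    obtain Y X where YX: "has_variation F Y X (\<Phi> t) (\<Psi> t)" "mdec Y" "mdec X"
      "cint (Y \<cdot> flow_phi g (\<Phi> t) (\<Psi> t) + flow_psi g (\<Phi> t) (\<Psi> t) \<cdot> X) = 0"
      using var[OF adm[OF t]] by blast
    note adm2 = adm[OF t] adm[OF t, THEN admissible_dx, THEN admissible_dx]
    have m: "mdec (flow_phi g (\<Phi> t) (\<Psi> t))" "mdec (flow_psi g (\<Phi> t) (\<Psi> t))"
      unfolding flow_phi_def flow_psi_def
      using adm2 by (auto intro!: mdec_linear mdec_mult1 mbnd_mult mdec_mbnd)
    have "cint (Y \<cdot> colf V + rowf W \<cdot> X) = im_unit * cint (Y \<cdot> flow_phi g (\<Phi> t) (\<Psi> t) + flow_psi g (\<Phi> t) (\<Psi> t) \<cdot> X)"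
      using m YX(2,3) by (simp add: cV cW mdec_imul mdec_mult1 mdec_mbnd cint_imul algebra_simps)
    with has_variationD[OF YX(1) curves refl refl] show ?thesis by (simp add: YX(4))
  qed
  then obtain c where "\<And>s. s \<in> {a<..<b} \<Longrightarrow> F (\<Phi> s) (\<Psi> s) = c"
    using has_vector_derivative_zero_constant[of "{a<..<b}" "\<lambda>s. F (\<Phi> s) (\<Psi> s)"] by (metis convex_real_interval(8))
  then show "F (\<Phi> s) (\<Psi> s) = F (\<Phi> t) (\<Psi> t)" using st by simp
qed

end

section \<open>The charges of the nonlinear super-Schroedinger equation\<close>

locale admissible_pair = super_fields M N for M N +
  fixes \<phi> \<psi> :: "'a::super_banach_algebra fields" and g :: real
  assumes adm [simp]: "admissible M N \<phi>" "admissible M N \<psi>"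
begin

sublocale field_pair "Suc (M + N)" "ext_grade M" "rowf \<psi>" "rowf (dx \<psi>)" "rowf (dx (dx \<psi>))"
  "colf \<phi>" "colf (dx \<phi>)" "colf (dx (dx \<phi>))" g
  by unfold_locales (simp_all add: admissible_dx)

lemma curve_variations:
  assumes c: "scurve T \<Phi> V t" "scurve T \<Psi> W t" "\<Phi> t = \<phi>" "\<Psi> t = \<psi>"
  shows "((\<lambda>s. abs_charge0 (matf \<sigma>) (rowf (\<Psi> s)) (colf (\<Phi> s))) has_vector_derivative
      cint (Y0 (matf \<sigma>) \<cdot> colf V + rowf W \<cdot> X0 (matf \<sigma>))) (at t within T)" (is ?T1)
    "((\<lambda>s. abs_charge1 g (matf \<sigma>) (rowf (\<Psi> s)) (colf (\<Phi> s)) (colf (dx (\<Phi> s)))) has_vector_derivative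
      cint (Y1 (matf \<sigma>) \<cdot> colf V + rowf W \<cdot> X1 (matf \<sigma>))) (at t within T)" (is ?T2)
    "((\<lambda>s. abs_charge2 g (matf \<sigma>) (rowf (\<Psi> s)) (rowf (dx (\<Psi> s))) (colf (\<Phi> s)) (colf (dx (\<Phi> s))) (colf (dx (dx (\<Phi> s)))))
      has_vector_derivative cint (Y2 (matf \<sigma>) \<cdot> colf V + rowf W \<cdot> X2 (matf \<sigma>))) (at t within T)" (is ?T3)
    "((\<lambda>s. abs_hamiltonian g (rowf (\<Psi> s)) (rowf (dx (\<Psi> s))) (colf (\<Phi> s)) (colf (dx (\<Phi> s)))) has_vector_derivative
      cint (YH \<cdot> colf V + rowf W \<cdot> XH)) (at t within T)" (is ?T4)
proof -
  have a: "admissible M N V" "admissible M N W" "t \<in> T" using c by (auto simp: scurve_def)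
  interpret fv: field_variation "Suc (M + N)" "ext_grade M" "rowf \<psi>" "rowf (dx \<psi>)" "rowf (dx (dx \<psi>))"
    "colf \<phi>" "colf (dx \<phi>)" "colf (dx (dx \<phi>))" g T t "\<lambda>s. rowf (\<Psi> s)" "\<lambda>s. rowf (dx (\<Psi> s))"
    "\<lambda>s. colf (\<Phi> s)" "\<lambda>s. colf (dx (\<Phi> s))" "\<lambda>s. colf (dx (dx (\<Phi> s)))"
    "colf V" "colf (dx V)" "colf (dx (dx V))" "rowf W" "rowf (dx W)"
    by unfold_locales (use a c scurve_mdcurve[OF c(1)] scurve_mdcurve[OF c(2)] in \<open>simp_all add: admissible_dx\<close>)
  show ?T1
    by (rule fv.charge0_variation) simp
  show ?T2
    by (rule fv.charge1_variation) simp
  show ?T3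
    by (rule fv.charge2_variation) simp
  show ?T4
    by (rule fv.hamiltonian_variation)
qed

lemma variations:
  "has_variation (charge0 K \<sigma>) (Y0 (matf \<sigma>)) (X0 (matf \<sigma>)) \<phi> \<psi>" (is ?T1)
  "has_variation (charge1 K g \<sigma>) (Y1 (matf \<sigma>)) (X1 (matf \<sigma>)) \<phi> \<psi>" (is ?T2)
  "has_variation (charge2 K g \<sigma>) (Y2 (matf \<sigma>)) (X2 (matf \<sigma>)) \<phi> \<psi>" (is ?T3)
  "has_variation (hamiltonian K g) YH XH \<phi> \<psi>"
proof -
  have "has_variation (\<lambda>\<phi> \<psi>. abs_charge0 (matf \<sigma>) (rowf \<psi>) (colf \<phi>)) (Y0 (matf \<sigma>)) (X0 (matf \<sigma>)) \<phi> \<psi>"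
    "has_variation (\<lambda>\<phi> \<psi>. abs_charge1 g (matf \<sigma>) (rowf \<psi>) (colf \<phi>) (colf (dx \<phi>))) (Y1 (matf \<sigma>)) (X1 (matf \<sigma>)) \<phi> \<psi>"
    "has_variation (\<lambda>\<phi> \<psi>. abs_charge2 g (matf \<sigma>) (rowf \<psi>) (rowf (dx \<psi>)) (colf \<phi>) (colf (dx \<phi>)) (colf (dx (dx \<phi>))))
      (Y2 (matf \<sigma>)) (X2 (matf \<sigma>)) \<phi> \<psi>"
    "has_variation (\<lambda>\<phi> \<psi>. abs_hamiltonian g (rowf \<psi>) (rowf (dx \<psi>)) (colf \<phi>) (colf (dx \<phi>))) YH XH \<phi> \<psi>"
    unfolding has_variation_def by (intro allI impI curve_variations; assumption)+
  note v = this
  show ?T1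
    by (rule has_variation_cong[OF v(1)]) (rule charge0_eq)
  show ?T2
    by (rule has_variation_cong[OF v(2)]) (rule charge1_eq)
  show ?T3
    by (rule has_variation_cong[OF v(3)]) (rule charge2_eq)
  show "has_variation (hamiltonian K g) YH XH \<phi> \<psi>"
    by (rule has_variation_cong[OF v(4)]) (rule hamiltonian_eq)
qed

lemma mdec_XY [simp]:
  assumes S: "const_mfun S"
  shows "mdec (X0 S)" "mdec (Y0 S)" "mdec (X1 S)" "mdec (Y1 S)" "mdec (X2 S)" "mdec (Y2 S)"
  using S by (simp_all add: X0_def Y0_def X1_def Y1_def X2_def Y2_def)

lemma mdec_H [simp]: "mdec XH" "mdec YH"
  by (simp_all add: XH_def YH_def)

lemma corner_free_P [simp]: "corner_free P" "corner_free A" "corner_free A'" "corner_free B'"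
  by (simp_all add: P_def A_def A'_def B'_def)

lemma corner_free_X [simp]:
  assumes "corner_free S" shows "corner_free (X0 S)" "corner_free (X1 S)" "corner_free (X2 S)" "corner_free XH"
  using assms by (simp_all add: X0_def X1_def X2_def XH_def)

lemma gr_XY [simp]:
  assumes "gr q S"
  shows "gr q (X0 S)" "gr q (Y0 S)" "gr q (X1 S)" "gr q (Y1 S)" "gr q (X2 S)" "gr q (Y2 S)"
  using assms by (simp_all add: X0_def Y0_def X1_def Y1_def X2_def Y2_def)

lemma gr_H [simp]: "gr 0 XH" "gr 0 YH"
  by (simp_all add: XH_def YH_def)

lemma flow_eq: "flow_phi g \<phi> \<psi> = u0" "flow_psi g \<phi> \<psi> = v0"
  by (simp_all add: flow_phi_def flow_psi_def u0_def v0_def)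

lemma charges_graded:
  assumes S: "gr q (matf \<sigma> :: 'a mfun)"
  shows "charge0 K \<sigma> \<phi> \<psi> \<in> graded q" "charge1 K g \<sigma> \<phi> \<psi> \<in> graded q"
  unfolding charge0_eq charge1_eq[OF adm] abs_charge0_def abs_charge1_def P_def[symmetric]
  using S by (auto intro!: cint_graded graded_diff graded_scaleR)

lemma hamiltonian_graded: "hamiltonian K g \<phi> \<psi> \<in> graded 0"
  unfolding hamiltonian_eq[OF adm] abs_hamiltonian_def
  by (auto intro!: cint_graded graded_add graded_scaleR)

end

section \<open>Constant matrices: products, supercommutators and grades\<close>

context super_fields
begin

lemma matf_mult:
  assumes "\<sigma> \<in> carrier_mat K K" "\<omega> \<in> carrier_mat K K"
  shows "matf \<sigma> \<cdot> matf \<omega> = (matf (\<sigma> * \<omega>) :: 'a::super_banach_algebra mfun)"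
proof (intro ext)
  fix x i j
  have "(\<sigma> * \<omega>) $$ (i - 1, j - 1) = (\<Sum>k<K. \<sigma> $$ (i - 1, k) * \<omega> $$ (k, j - 1))"
    if "i \<noteq> 0" "i \<le> K" "j \<noteq> 0" "j \<le> K"
    using that assms by (subst index_mult_mat) (auto simp: scalar_prod_def lessThan_atLeast0 intro!: sum.cong)
  then show "(matf \<sigma> \<cdot> matf \<omega>) x i j = (matf (\<sigma> * \<omega>) x i j :: 'a)"
    unfolding mmult_def mprod_def sum_shift
    by (auto simp: matf_def cscale_mult_unit cscale_sum)
qed

lemma matf_supercomm:
  assumes "\<sigma> \<in> carrier_mat K K" "\<omega> \<in> carrier_mat K K"
  shows "(matf (supercomm p q \<sigma> \<omega>) :: 'a::super_banach_algebra mfun)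
    = matf \<sigma> \<cdot> matf \<omega> - (-1) ^ (p * q) *\<^sub>R (matf \<omega> \<cdot> matf \<sigma>)"
proof -
  have c: "(a - (-1) ^ (p * q) * b) *\<^sub>C 1 = a *\<^sub>C 1 - (-1::real) ^ (p * q) *\<^sub>R (b *\<^sub>C (1::'a))" for a b
    by (cases "even (p * q)") (simp_all add: cscale_def scaleR_diff_left algebra_simps)
  show ?thesis
    unfolding matf_mult[OF assms] matf_mult[OF assms(2,1)]
    using assms by (auto simp: matf_def supercomm_def c fun_eq_iff)
qed

lemma gr_matf:
  assumes "homogeneous M N p \<sigma>" shows "gr p (matf \<sigma> :: 'a::super_banach_algebra mfun)"
  unfolding gr_def
proof (intro allI)
  fix x i j
  show "(matf \<sigma> x i j :: 'a) \<in> graded (p + ext_grade M i + ext_grade M j)"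
  proof (cases "i \<noteq> 0 \<and> i \<le> K \<and> j \<noteq> 0 \<and> j \<le> K \<and> \<sigma> $$ (i - 1, j - 1) \<noteq> 0")
    case True
    then obtain k l where kl: "i = Suc k" "j = Suc l" "k < K" "l < K" "\<sigma> $$ (k, l) \<noteq> 0"
      by (metis Suc_le_lessD Suc_pred' neq0_conv diff_Suc_1)
    then have "(grade M k + grade M l) mod 2 = p" using assms by (auto simp: homogeneous_def)
    then have "even (p + ext_grade M i + ext_grade M j + 0)" using kl by simp presburger
    then have "graded (p + ext_grade M i + ext_grade M j) = (graded 0 :: 'a set)" by (rule graded_cong)
    then show ?thesis by (simp add: matf_def cscale_unit_even)
  qed (auto simp: matf_def)
qed

end

section \<open>The bracket with the Hamiltonian and the sign kernel integral\<close>

context admissible_pair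
begin

lemma charges_differentiable:
  assumes l: "l < K"
  shows "\<exists>D. has_functional_derivative M (\<lambda>\<phi>'. hamiltonian K g \<phi>' \<psi>) \<phi> l D" (is ?T1)
    "\<exists>D. has_functional_derivative M (\<lambda>\<psi>'. hamiltonian K g \<phi> \<psi>') \<psi> l D" (is ?T2)
    "Q \<in> {charge0 K, charge1 K g, charge2 K g} \<Longrightarrow> \<exists>D. has_functional_derivative M (\<lambda>\<phi>'. Q \<sigma> \<phi>' \<psi>) \<phi> l D"
    "Q \<in> {charge0 K, charge1 K g, charge2 K g} \<Longrightarrow> \<exists>D. has_functional_derivative M (\<lambda>\<psi>'. Q \<sigma> \<phi> \<psi>') \<psi> l D"
proof -
  note d = has_variation_functional_derivative[OF adm _ _ _ l]
  show ?T1 ?T2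
    using d[OF variations(4)] by auto
  show "Q \<in> {charge0 K, charge1 K g, charge2 K g} \<Longrightarrow> \<exists>D. has_functional_derivative M (\<lambda>\<phi>'. Q \<sigma> \<phi>' \<psi>) \<phi> l D"
    "Q \<in> {charge0 K, charge1 K g, charge2 K g} \<Longrightarrow> \<exists>D. has_functional_derivative M (\<lambda>\<psi>'. Q \<sigma> \<phi> \<psi>') \<psi> l D"
    using d[OF variations(1)[of \<sigma>]] d[OF variations(2)[of \<sigma>]] d[OF variations(3)[of \<sigma>]] by auto
qed

text \<open>Collects what the three charges have in common, so that the bracket with the Hamiltonian
  and the conservation law are each derived only once.\<close>

lemma charge_cases:
  assumes "Q \<in> {charge0 K, charge1 K g, charge2 K g}"
  obtains Y X where "has_variation (Q \<sigma>) Y X \<phi> \<psi>" "mdec Y" "mdec X" "corner_free X"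
    "cint (Y \<cdot> u0 + v0 \<cdot> X) = 0"
proof -
  consider "Q = charge0 K" | "Q = charge1 K g" | "Q = charge2 K g" using assms by auto
  then show thesis
  proof cases
    case 1 show thesis
      by (rule that[of "Y0 (matf \<sigma>)" "X0 (matf \<sigma>)"]) (simp_all add: 1 variations(1) conserved0)
  next
    case 2 show thesis
      by (rule that[of "Y1 (matf \<sigma>)" "X1 (matf \<sigma>)"]) (simp_all add: 2 variations(2) conserved1)
  next
    case 3 show thesis
      by (rule that[of "Y2 (matf \<sigma>)" "X2 (matf \<sigma>)"]) (simp_all add: 3 variations(3) conserved2)
  qed
qed

text \<open>As \<open>YH = v0\<close> and \<open>XH = - u0\<close>, the bracket is
  \<open>im_unit\<close> times the first variation of the charge in the direction \<open>u0\<close>,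
  \<open>v0\<close>, whose integrand is a total derivative.\<close>

lemma poisson_hamiltonian:
  assumes faithful: "N > 0 \<longrightarrow> (\<forall>a::'a. (\<forall>\<theta>\<in>graded 1. \<theta> * a = 0) \<longrightarrow> a = 0)"
    and Q: "Q \<in> {charge0 K, charge1 K g, charge2 K g}"
  shows "poisson M N (hamiltonian K g) (Q \<sigma>) \<phi> \<psi> = 0"
proof -
  obtain Y X where *: "has_variation (Q \<sigma>) Y X \<phi> \<psi>" "mdec Y" "mdec X" "corner_free X"
    "cint (Y \<cdot> u0 + v0 \<cdot> X) = 0" using Q by (rule charge_cases)
  have H: "hamiltonian K g \<phi> \<psi> \<in> graded 0" if "admissible M N \<phi>" "admissible M N \<psi>" for \<phi> \<psi> :: "'a fields"
  proof -
    interpret ap: admissible_pair M N \<phi> \<psi> g by unfold_locales (use that in auto)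
    show ?thesis by (rule ap.hamiltonian_graded)
  qed
  have "poisson M N (hamiltonian K g) (Q \<sigma>) \<phi> \<psi> = im_unit * (cint (YH \<cdot> X) - 1 *\<^sub>R cint (Y \<cdot> XH))"
    by (rule poisson_eq[OF faithful adm _ variations(4) *(1) H])
       (use * in \<open>simp_all add: even_comm[simplified] corner_free_X(4)[OF corner_free_simps(2)]\<close>)
  also have "cint (YH \<cdot> X) - 1 *\<^sub>R cint (Y \<cdot> XH) = cint (Y \<cdot> u0 + v0 \<cdot> X)"
    using *(2,3) by (simp add: u0_v0 mmult_linear)
  finally show ?thesis by (simp add: *(5))
qed

lemma kernel_integral:
  fixes \<sigma> \<omega> :: "complex mat"
  defines "J \<equiv> \<lambda>x y t. mpair K \<psi> x \<sigma> \<phi> y * mpair K \<psi> y \<omega> \<phi> t * pair K \<psi> t \<phi> x"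
  shows "integrable (lborel :: (real \<times> real \<times> real) measure) (\<lambda>(x, y, t). sign_kernel x y t *\<^sub>R J x y t)" (is ?T1)
    and "(\<integral>(x, y, t). sign_kernel x y t *\<^sub>R J x y t \<partial>(lborel :: (real \<times> real \<times> real) measure))
      = 4 *\<^sub>R (cint (rowf \<psi> \<cdot> matf \<sigma> \<cdot> moI (colf \<phi> \<cdot> rowf \<psi> \<cdot> matf \<omega> \<cdot> P) \<cdot> colf \<phi>)
        + cint (rowf \<psi> \<cdot> matf \<sigma> \<cdot> moI (P \<cdot> matf \<omega> \<cdot> colf \<phi> \<cdot> rowf \<psi>) \<cdot> colf \<phi>)
        - cint (rowf \<psi> \<cdot> matf \<sigma> \<cdot> P \<cdot> matf \<omega> \<cdot> P \<cdot> colf \<phi>))" (is ?T2)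
proof -
  let ?r = "rowf \<psi>" and ?p = "colf \<phi>"
  have e: "((?r \<cdot> matf \<sigma>) x \<boxdot> (?p \<cdot> ?r \<cdot> matf \<omega>) y \<boxdot> (?p \<cdot> ?r) t \<boxdot> ?p x) 0 0 = J x y t" for x y t
  proof -
    have "((?r \<cdot> matf \<sigma>) x \<boxdot> (?p \<cdot> ?r \<cdot> matf \<omega>) y \<boxdot> (?p \<cdot> ?r) t \<boxdot> ?p x) 0 0
      = (((?r x \<boxdot> matf \<sigma> x) \<boxdot> ?p y) \<boxdot> ((?r y \<boxdot> matf \<omega> y) \<boxdot> ?p t) \<boxdot> (?r t \<boxdot> ?p x)) 0 0"
      by (simp add: mmult_def mprod_assoc)
    also have "\<dots> = J x y t"
      unfolding J_def by (simp only: corner_split[OF is_col_colf] pair_eq) (simp add: mprod_assoc mpair_eq mult.assoc)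
    finally show ?thesis .
  qed
  have m: "mdec (?r \<cdot> matf \<sigma>)" "mdec (?p \<cdot> ?r \<cdot> matf \<omega>)" "mdec (?p \<cdot> ?r)" "mdec ?p" by simp_all
  note t = triple_mintegral[OF m, unfolded e]
  \<comment> \<open>The summands join their signs at x, y and t in turn. The first gives the product
    of two antiderivatives with a minus sign, the other two give the nested ones.\<close>
  have k: "(\<lambda>(x, y, t). sign_kernel x y t *\<^sub>R J x y t)
    = (\<lambda>z. (case z of (x, y, t) \<Rightarrow> (sgn (t - x) * sgn (x - y)) *\<^sub>R J x y t)
      + (case z of (x, y, t) \<Rightarrow> (sgn (x - y) * sgn (y - t)) *\<^sub>R J x y t)
      + (case z of (x, y, t) \<Rightarrow> (sgn (y - t) * sgn (t - x)) *\<^sub>R J x y t))"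
    by (auto simp: sign_kernel_def fun_eq_iff scaleR_add_left)
  show ?T1
    unfolding k using t by (intro Bochner_Integration.integrable_add)
  have P: "moI (?p \<cdot> ?r) = P" by (simp add: P_def)
  show ?T2
    unfolding k using t
    by (simp add: Bochner_Integration.integral_add Bochner_Integration.integrable_add mmult_assoc P
        moI_fold[OF const_matf] scaleR_add_right scaleR_diff_right)
qed

end

section \<open>Brackets of charges of homogeneous matrices\<close>

locale homogeneous_pair = admissible_pair M N \<phi> \<psi> g for M N and \<phi> \<psi> :: "'a::super_banach_algebra fields" and g +
  fixes p q :: nat and \<sigma> \<omega> :: "complex mat"
  assumes hom: "homogeneous M N p \<sigma>" "homogeneous M N q \<omega>"
    and faithful: "N > 0 \<longrightarrow> (\<forall>a::'a. (\<forall>\<theta>\<in>graded 1. \<theta> * a = 0) \<longrightarrow> a = 0)"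
begin

lemma gr_hom [simp]: "gr p (matf \<sigma> :: 'a mfun)" "gr q (matf \<omega> :: 'a mfun)"
  using hom by (simp_all add: gr_matf)

lemma carriers: "\<sigma> \<in> carrier_mat K K" "\<omega> \<in> carrier_mat K K" "p \<in> {0, 1}"
  using hom by (auto simp: homogeneous_def)

sublocale charge_pair "Suc (M + N)" "ext_grade M" "rowf \<psi>" "rowf (dx \<psi>)" "rowf (dx (dx \<psi>))"
  "colf \<phi>" "colf (dx \<phi>)" "colf (dx (dx \<phi>))" g "matf \<sigma>" "matf \<omega>" p q
  by unfold_locales simp_all

lemma graded_charges:
  assumes "admissible M N \<phi>'" "admissible M N (\<psi>' :: 'a fields)"
  shows "charge0 K \<sigma> \<phi>' \<psi>' \<in> graded p" "charge1 K g \<sigma> \<phi>' \<psi>' \<in> graded p"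
proof -
  interpret ap: admissible_pair M N \<phi>' \<psi>' g by unfold_locales (use assms in auto)
  show "charge0 K \<sigma> \<phi>' \<psi>' \<in> graded p" "charge1 K g \<sigma> \<phi>' \<psi>' \<in> graded p"
    using ap.charges_graded gr_hom(1) by blast+
qed

lemma poisson_homogeneous_pair:
  assumes F: "has_variation F YF XF \<phi> \<psi>" and G: "has_variation G YG XG \<phi> \<psi>"
    and "\<And>\<phi> \<psi>. admissible M N \<phi> \<Longrightarrow> admissible M N \<psi> \<Longrightarrow> F \<phi> \<psi> \<in> graded p"
    and "mdec YF" "mdec XF" "mdec YG" "mdec XG" "gr p YF" "gr p XF" "gr q YG" "corner_free XF" "corner_free XG"
  shows "poisson M N F G \<phi> \<psi> = im_unit * (cint (YF \<cdot> XG) - (-1) ^ (p * q) *\<^sub>R cint (YG \<cdot> XF))"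
  using assms by (intro poisson_eq[OF faithful adm carriers(3) F G] homogeneous_comm)

lemma poisson_charge0:
  "poisson M N (charge0 K \<sigma>) (charge0 K \<omega>) \<phi> \<psi> = im_unit * charge0 K (supercomm p q \<sigma> \<omega>) \<phi> \<psi>" (is ?T1)
  "poisson M N (charge0 K \<sigma>) (charge1 K g \<omega>) \<phi> \<psi> = im_unit * charge1 K g (supercomm p q \<sigma> \<omega>) \<phi> \<psi>" (is ?T2)
  "poisson M N (charge0 K \<sigma>) (charge2 K g \<omega>) \<phi> \<psi> = im_unit * charge2 K g (supercomm p q \<sigma> \<omega>) \<phi> \<psi>" (is ?T3)
proof -
  note pb = poisson_homogeneous_pair[OF variations(1) _ graded_charges(1)]
  have "poisson M N (charge0 K \<sigma>) (charge0 K \<omega>) \<phi> \<psi>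
    = im_unit * (cint (Y0 (matf \<sigma>) \<cdot> X0 (matf \<omega>)) - sg *\<^sub>R cint (Y0 (matf \<omega>) \<cdot> X0 (matf \<sigma>)))"
    by (rule pb[OF variations(1)]; simp)
  then show ?T1
    unfolding bracket00 charge0_eq[of "supercomm p q \<sigma> \<omega>"] matf_supercomm[OF carriers(1,2)] .
  have "poisson M N (charge0 K \<sigma>) (charge1 K g \<omega>) \<phi> \<psi>
    = im_unit * (cint (Y0 (matf \<sigma>) \<cdot> X1 (matf \<omega>)) - sg *\<^sub>R cint (Y1 (matf \<omega>) \<cdot> X0 (matf \<sigma>)))"
    by (rule pb[OF variations(2)]; simp)
  then show ?T2
    unfolding bracket01 charge1_eq[OF adm, of _ "supercomm p q \<sigma> \<omega>"] matf_supercomm[OF carriers(1,2)] .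
  have "poisson M N (charge0 K \<sigma>) (charge2 K g \<omega>) \<phi> \<psi>
    = im_unit * (cint (Y0 (matf \<sigma>) \<cdot> X2 (matf \<omega>)) - sg *\<^sub>R cint (Y2 (matf \<omega>) \<cdot> X0 (matf \<sigma>)))"
    by (rule pb[OF variations(3)]; simp)
  then show ?T3
    unfolding bracket02 charge2_eq[OF adm, of _ "supercomm p q \<sigma> \<omega>"] matf_supercomm[OF carriers(1,2)] .
qed

lemma poisson_charge1:
  "poisson M N (charge1 K g \<sigma>) (charge1 K g \<omega>) \<phi> \<psi> =
     im_unit * charge2 K g (supercomm p q \<sigma> \<omega>) \<phi> \<psi>
     - im_unit * ((g / 2)\<^sup>2 *\<^sub>R
         (\<integral>(x, y, t). sign_kernel x y t *\<^sub>R
            ((mpair K \<psi> x \<sigma> \<phi> y * mpair K \<psi> y \<omega> \<phi> t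
               - (-1::real) ^ (p * q) *\<^sub>R (mpair K \<psi> x \<omega> \<phi> y * mpair K \<psi> y \<sigma> \<phi> t))
             * pair K \<psi> t \<phi> x)
          \<partial>(lborel :: (real \<times> real \<times> real) measure)))"
proof -
  let ?J = "\<lambda>\<sigma> \<omega> x y t. mpair K \<psi> x \<sigma> \<phi> y * mpair K \<psi> y \<omega> \<phi> t * pair K \<psi> t \<phi> x"
  have "(\<lambda>(x, y, t). sign_kernel x y t *\<^sub>R
            ((mpair K \<psi> x \<sigma> \<phi> y * mpair K \<psi> y \<omega> \<phi> t
               - (-1::real) ^ (p * q) *\<^sub>R (mpair K \<psi> x \<omega> \<phi> y * mpair K \<psi> y \<sigma> \<phi> t))
             * pair K \<psi> t \<phi> x))
    = (\<lambda>z. (case z of (x, y, t) \<Rightarrow> sign_kernel x y t *\<^sub>R ?J \<sigma> \<omega> x y t)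
        - (-1::real) ^ (p * q) *\<^sub>R (case z of (x, y, t) \<Rightarrow> sign_kernel x y t *\<^sub>R ?J \<omega> \<sigma> x y t))"
    by (auto simp: fun_eq_iff algebra_simps)
  then have i: "(\<integral>(x, y, t). sign_kernel x y t *\<^sub>R
            ((mpair K \<psi> x \<sigma> \<phi> y * mpair K \<psi> y \<omega> \<phi> t
               - (-1::real) ^ (p * q) *\<^sub>R (mpair K \<psi> x \<omega> \<phi> y * mpair K \<psi> y \<sigma> \<phi> t))
             * pair K \<psi> t \<phi> x)
          \<partial>(lborel :: (real \<times> real \<times> real) measure))
     = 4 *\<^sub>R kernel_term (matf \<sigma>) (matf \<omega>) - (-1::real) ^ (p * q) *\<^sub>R 4 *\<^sub>R kernel_term (matf \<omega>) (matf \<sigma>)"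
    unfolding kernel_term_def kernel_integral(2)[symmetric]
    using kernel_integral(1)[of \<sigma> \<omega>] kernel_integral(1)[of \<omega> \<sigma>] by simp
  have "poisson M N (charge1 K g \<sigma>) (charge1 K g \<omega>) \<phi> \<psi>
    = im_unit * (cint (Y1 (matf \<sigma>) \<cdot> X1 (matf \<omega>)) - (-1) ^ (p * q) *\<^sub>R cint (Y1 (matf \<omega>) \<cdot> X1 (matf \<sigma>)))"
    by (rule poisson_homogeneous_pair[OF variations(2) variations(2) graded_charges(2)]; simp)
  \<comment> \<open>The factor 4 of the triple integrals cancels the denominator of (g/2)^2.\<close>
  moreover have "(g / 2)\<^sup>2 *\<^sub>R (4 *\<^sub>R a - sg *\<^sub>R 4 *\<^sub>R b) = g\<^sup>2 *\<^sub>R (a - sg *\<^sub>R b)" for a b :: 'a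
    by (simp add: scaleR_diff_right power_divide)
  ultimately show ?thesis
    unfolding bracket11 i charge2_eq[OF adm, of _ "supercomm p q \<sigma> \<omega>"] matf_supercomm[OF carriers(1,2)]
    by (simp only: right_diff_distrib)
qed

end

section \<open>Differentiability, conservation and assembly of the result\<close>

lemma functionally_differentiable_charges:
  fixes Q :: "complex mat \<Rightarrow> 'a::super_banach_algebra field_functional"
  shows "functionally_differentiable M N (hamiltonian (M + N) g :: 'a field_functional)"
    and "Q \<in> {charge0 (M + N), charge1 (M + N) g, charge2 (M + N) g} \<Longrightarrow> functionally_differentiable M N (Q \<sigma>)"
  unfolding functionally_differentiable_def
proof (safe del: insertE)
  fix \<phi> \<psi> :: "'a fields" and l assume "admissible M N \<phi>" "admissible M N \<psi>" and l: "l < M + N"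
  then interpret admissible_pair M N \<phi> \<psi> g by unfold_locales simp_all
  show "\<exists>D. has_functional_derivative M (\<lambda>\<phi>'. hamiltonian (M + N) g \<phi>' \<psi>) \<phi> l D"
    "\<exists>D. has_functional_derivative M (hamiltonian (M + N) g \<phi>) \<psi> l D"
    using charges_differentiable(1,2)[OF l] by simp_all
  assume Q: "Q \<in> {charge0 (M + N), charge1 (M + N) g, charge2 (M + N) g}"
  show "\<exists>D. has_functional_derivative M (\<lambda>\<phi>'. Q \<sigma> \<phi>' \<psi>) \<phi> l D"
    "\<exists>D. has_functional_derivative M (Q \<sigma> \<phi>) \<psi> l D"
    using charges_differentiable(3,4)[OF l Q] by simp_all
qed

lemma conserved_charges:
  assumes Q: "Q \<in> {charge0 (M + N), charge1 (M + N) g, charge2 (M + N) g}"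
  shows "conserved_by_nlss M N g (Q \<sigma> :: 'a::super_banach_algebra field_functional)"
proof -
  interpret super_fields M N by unfold_locales simp_all
  show ?thesis
  proof (rule conserved)
    fix \<phi> \<psi> :: "'a fields" assume "admissible M N \<phi>" "admissible M N \<psi>"
    then interpret admissible_pair M N \<phi> \<psi> g by unfold_locales
    from Q obtain Y X where "has_variation (Q \<sigma>) Y X \<phi> \<psi>" "mdec Y" "mdec X" "corner_free X"
      "cint (mmult Y u0 + mmult v0 X) = 0" by (rule charge_cases)
    then show "\<exists>Y X. has_variation (Q \<sigma>) Y X \<phi> \<psi> \<and> mdec Y \<and> mdec X \<and>
      cint (mmult Y (flow_phi g \<phi> \<psi>) + mmult (flow_psi g \<phi> \<psi>) X) = 0"
      unfolding flow_eq by blast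
  qed
qed

theorem mainTheorem15:
  fixes M N K :: nat and g :: real
    and H :: "'a::super_banach_algebra field_functional"
    and Q0 Q1 Q2 :: "complex mat \<Rightarrow> 'a field_functional"
  defines "K \<equiv> M + N"
    and "H \<equiv> hamiltonian K g"
    and "Q0 \<equiv> charge0 K"
    and "Q1 \<equiv> charge1 K g"
    and "Q2 \<equiv> charge2 K g"
  assumes "g > 0"
    and odd_faithful: "N > 0 \<longrightarrow> (\<forall>a::'a. (\<forall>\<theta>\<in>graded 1. \<theta> * a = 0) \<longrightarrow> a = 0)"
  shows "functionally_differentiable M N H \<and>
    (\<forall>\<sigma>\<in>carrier_mat K K. \<forall>Q\<in>{Q0, Q1, Q2}.
       functionally_differentiable M N (Q \<sigma>) \<and>
       (\<forall>\<phi> \<psi>. admissible M N \<phi> \<and> admissible M N \<psi> \<longrightarrow> poisson M N H (Q \<sigma>) \<phi> \<psi> = 0) \<and>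
       conserved_by_nlss M N g (Q \<sigma>)) \<and>
    (\<forall>p q \<sigma> \<omega> \<phi> \<psi>.
       homogeneous M N p \<sigma> \<and> homogeneous M N q \<omega> \<and> admissible M N \<phi> \<and> admissible M N \<psi> \<longrightarrow>
       (\<forall>Q\<in>{Q0, Q1, Q2}.
          poisson M N (Q0 \<sigma>) (Q \<omega>) \<phi> \<psi> = im_unit * Q (supercomm p q \<sigma> \<omega>) \<phi> \<psi>) \<and>
       poisson M N (Q1 \<sigma>) (Q1 \<omega>) \<phi> \<psi> =
         im_unit * Q2 (supercomm p q \<sigma> \<omega>) \<phi> \<psi>
         - im_unit * ((g / 2)\<^sup>2 *\<^sub>R
             (\<integral>(x, y, t). sign_kernel x y t *\<^sub>R
                ((mpair K \<psi> x \<sigma> \<phi> y * mpair K \<psi> y \<omega> \<phi> t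
                   - (-1::real) ^ (p * q) *\<^sub>R (mpair K \<psi> x \<omega> \<phi> y * mpair K \<psi> y \<sigma> \<phi> t))
                 * pair K \<psi> t \<phi> x)
              \<partial>(lborel :: (real \<times> real \<times> real) measure))))"
proof -
  have diff: "functionally_differentiable M N H"
    unfolding H_def K_def by (rule functionally_differentiable_charges)
  have charges: "functionally_differentiable M N (Q \<sigma>) \<and>
       (\<forall>\<phi> \<psi>. admissible M N \<phi> \<and> admissible M N \<psi> \<longrightarrow> poisson M N H (Q \<sigma>) \<phi> \<psi> = 0) \<and>
       conserved_by_nlss M N g (Q \<sigma>)" if "Q \<in> {Q0, Q1, Q2}" for Q \<sigma>
  proof (intro conjI allI impI)
    have Q: "Q \<in> {charge0 (M + N), charge1 (M + N) g, charge2 (M + N) g}"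
      using that by (simp add: Q0_def Q1_def Q2_def K_def)
    show "functionally_differentiable M N (Q \<sigma>)" using Q by (rule functionally_differentiable_charges)
    show "conserved_by_nlss M N g (Q \<sigma>)" using Q by (rule conserved_charges)
    fix \<phi> \<psi> :: "'a fields" assume "admissible M N \<phi> \<and> admissible M N \<psi>"
    then interpret admissible_pair M N \<phi> \<psi> g by unfold_locales simp_all
    show "poisson M N H (Q \<sigma>) \<phi> \<psi> = 0"
      unfolding H_def K_def by (rule poisson_hamiltonian[OF odd_faithful Q])
  qed
  have brackets: "(\<forall>Q\<in>{Q0, Q1, Q2}.
          poisson M N (Q0 \<sigma>) (Q \<omega>) \<phi> \<psi> = im_unit * Q (supercomm p q \<sigma> \<omega>) \<phi> \<psi>) \<and>
       poisson M N (Q1 \<sigma>) (Q1 \<omega>) \<phi> \<psi> =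
         im_unit * Q2 (supercomm p q \<sigma> \<omega>) \<phi> \<psi>
         - im_unit * ((g / 2)\<^sup>2 *\<^sub>R
             (\<integral>(x, y, t). sign_kernel x y t *\<^sub>R
                ((mpair K \<psi> x \<sigma> \<phi> y * mpair K \<psi> y \<omega> \<phi> t
                   - (-1::real) ^ (p * q) *\<^sub>R (mpair K \<psi> x \<omega> \<phi> y * mpair K \<psi> y \<sigma> \<phi> t))
                 * pair K \<psi> t \<phi> x)
              \<partial>(lborel :: (real \<times> real \<times> real) measure)))"
    if "homogeneous M N p \<sigma>" "homogeneous M N q \<omega>" "admissible M N \<phi>" "admissible M N \<psi>"
    for p q \<sigma> \<omega> and \<phi> \<psi> :: "'a fields"
  proof -
    interpret homogeneous_pair M N \<phi> \<psi> g p q \<sigma> \<omega>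
      by unfold_locales (use that odd_faithful in auto)
    show ?thesis
      unfolding Q0_def Q1_def Q2_def K_def
    proof (intro conjI ballI)
      fix Q :: "complex mat \<Rightarrow> 'a field_functional"
      assume "Q \<in> {charge0 (M + N), charge1 (M + N) g, charge2 (M + N) g}"
      then show "poisson M N (charge0 (M + N) \<sigma>) (Q \<omega>) \<phi> \<psi> = im_unit * Q (supercomm p q \<sigma> \<omega>) \<phi> \<psi>"
        by (elim insertE emptyE) (simp_all only: poisson_charge0)
    qed (rule poisson_charge1)
  qed
  show ?thesis
    by (rule conjI[OF diff conjI], intro ballI, rule charges, assumption,
        intro allI impI, elim conjE, rule brackets)
qed

end
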